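(* Let $\varphi\in\mathcal{F}(\mathbb{C}^n)$. Then $S_\varphi$ is bounded on the Fock space $\mathcal{F}(\mathbb{C}^n)$ if and only if there exists $m\in L^\infty(\mathbb{R}^n)$ such that $$\varphi(z)=\int_{\mathbb{R}^n} m(\xi)\,e^{-(\xi-\frac{i}{2}z)^2}\,d\xi,\qquad z\in\mathbb{C}^n,$$ whereas $\widetilde S_\varphi$ is bounded on $\mathcal{F}(\mathbb{C}^n)$ if and only if there exists (another) $m\in L^\infty(\mathbb{R}^n)$ such that $$\varphi(z)=\int_{\mathbb{R}^n} m(\xi)\,e^{-(\xi-\frac{1}{2}z)^2}\,d\xi,\qquad z\in\mathbb{C}^n.$$ Moreover, for any non-constant $\varphi\in\mathcal{F}(\mathbb{C}^n)$, at least one of the operators $S_\varphi$, $\widetilde S_\varphi$ is unbounded on $\mathcal{F}(\mathbb{C}^n)$.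
   Context: For $z,w\in\mathbb{C}^n$ write $z\cdot w=\sum_{j=1}^n z_jw_j$ (bilinear) and $z^2=z\cdot z$. Let $d\nu(z)=c_n e^{-\frac12|z|^2}dz$ on $\mathbb{C}^n$, with $c_n=(2\pi)^{-n}$ ($dz$ is Lebesgue measure). The Fock space $\mathcal{F}(\mathbb{C}^n)$ is the Hilbert space of entire functions on $\mathbb{C}^n$ that are square integrable with respect to $\nu$. For $\varphi\in\mathcal{F}(\mathbb{C}^n)$ define $$S_\varphi F(z)=\int_{\mathbb{C}^n}F(w)\,\varphi(z-\bar w)\,e^{\frac12 z\cdot\bar w}\,d\nu(w),\qquad \widetilde S_\varphi F(z)=\int_{\mathbb{C}^n}F(w)\,\varphi(z+\bar w)\,e^{\frac12 z\cdot\bar w}\,d\nu(w).$$ These integrals converge absolutely when $F$ is a holomorphic polynomial. The operator is called bounded on $\mathcal{F}(\mathbb{C}^n)$ if, defined initially on the (dense) space of holomorphic polynomials, it extends to a bounded linear operator of $\mathcal{F}(\mathbb{C}^n)$ into itself; otherwise it is called unbounded. *)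

theory Defs
  imports "HOL-Analysis.Analysis"
begin

definition cdot :: "complex ^ 'n \<Rightarrow> complex ^ 'n \<Rightarrow> complex" where
  "cdot z w = (\<Sum>j\<in>UNIV. z $ j * w $ j)"

definition csq :: "complex ^ 'n \<Rightarrow> complex" where
  "csq z = cdot z z"

definition vcnj :: "complex ^ 'n \<Rightarrow> complex ^ 'n" where
  "vcnj z = (\<chi> j. cnj (z $ j))"

definition vcomplex :: "real ^ 'n \<Rightarrow> complex ^ 'n" where
  "vcomplex \<xi> = (\<chi> j. complex_of_real (\<xi> $ j))"

definition gauss_measure :: "(complex ^ 'n) measure" where
  "gauss_measure =
     density lborel (\<lambda>z. ennreal (exp (- (norm z)\<^sup>2 / 2) / (2 * pi) ^ CARD('n)))"

text \<open>Holomorphy in several variables: the real Frechet derivative exists everywhere and is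
  complex linear.\<close>

definition entire :: "(complex ^ 'n \<Rightarrow> complex) \<Rightarrow> bool" where
  "entire F \<longleftrightarrow>
     (\<forall>z. \<exists>D. (F has_derivative D) (at z) \<and> (\<forall>c v. D (c *s v) = c * D v))"

definition fock_space :: "(complex ^ 'n \<Rightarrow> complex) set" where
  "fock_space = {F. entire F \<and> integrable gauss_measure (\<lambda>z. (norm (F z))\<^sup>2)}"

definition fock_norm :: "(complex ^ 'n \<Rightarrow> complex) \<Rightarrow> real" where
  "fock_norm F = sqrt (LINT z|gauss_measure. (norm (F z))\<^sup>2)"

definition hol_polynomial :: "(complex ^ 'n \<Rightarrow> complex) \<Rightarrow> bool" where
  "hol_polynomial P \<longleftrightarrow>
     (\<exists>(A :: ('n \<Rightarrow> nat) set) a. finite A \<and>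
        P = (\<lambda>z. \<Sum>\<alpha>\<in>A. a \<alpha> * (\<Prod>j\<in>UNIV. (z $ j) ^ \<alpha> j)))"

text \<open>The Bochner integrals below are only used for polynomial \<open>F\<close>, where they converge
  absolutely if \<open>\<phi>\<close> lies in the Fock space.\<close>

definition S_op ::
  "(complex ^ 'n \<Rightarrow> complex) \<Rightarrow> (complex ^ 'n \<Rightarrow> complex) \<Rightarrow> complex ^ 'n \<Rightarrow> complex" where
  "S_op \<phi> F z =
     (LINT w|gauss_measure. F w * \<phi> (z - vcnj w) * exp (cdot z (vcnj w) / 2))"

definition S_tilde_op ::
  "(complex ^ 'n \<Rightarrow> complex) \<Rightarrow> (complex ^ 'n \<Rightarrow> complex) \<Rightarrow> complex ^ 'n \<Rightarrow> complex" where
  "S_tilde_op \<phi> F z =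
     (LINT w|gauss_measure. F w * \<phi> (z + vcnj w) * exp (cdot z (vcnj w) / 2))"

definition bounded_linear_operator_on_fock ::
  "((complex ^ 'n \<Rightarrow> complex) \<Rightarrow> complex ^ 'n \<Rightarrow> complex) \<Rightarrow> bool" where
  "bounded_linear_operator_on_fock T \<longleftrightarrow>
     (\<forall>F\<in>fock_space. T F \<in> fock_space) \<and>
     (\<forall>F\<in>fock_space. \<forall>G\<in>fock_space. \<forall>a b.
        T (\<lambda>z. a * F z + b * G z) = (\<lambda>z. a * T F z + b * T G z)) \<and>
     (\<exists>C. \<forall>F\<in>fock_space. fock_norm (T F) \<le> C * fock_norm F)"

text \<open>Only the values of \<open>S\<close> on holomorphic polynomials matter: these are required to extend to
  a bounded operator, which need not be given by the defining integral of \<open>S\<close> elsewhere.\<close>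

definition bounded_on_fock ::
  "((complex ^ 'n \<Rightarrow> complex) \<Rightarrow> complex ^ 'n \<Rightarrow> complex) \<Rightarrow> bool" where
  "bounded_on_fock S \<longleftrightarrow>
     (\<exists>T. bounded_linear_operator_on_fock T \<and> (\<forall>P. hol_polynomial P \<longrightarrow> T P = S P))"

definition unbounded_on_fock ::
  "((complex ^ 'n \<Rightarrow> complex) \<Rightarrow> complex ^ 'n \<Rightarrow> complex) \<Rightarrow> bool" where
  "unbounded_on_fock S \<longleftrightarrow> \<not> bounded_on_fock S"

text \<open>Functions rather than almost-everywhere classes; every class has a Borel representative.\<close>

definition L_infinity :: "(real ^ 'n \<Rightarrow> complex) set" where
  "L_infinity =
     {m. m \<in> borel_measurable lborel \<and> (\<exists>C. AE \<xi> in lborel. norm (m \<xi>) \<le> C)}"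

end

theory Submission
  imports Defs "HOL-Complex_Analysis.Conformal_Mappings" "HOL-Probability.Distributions"
begin

text \<open>
  The whole proof rests on one completion of a square. With the Bargmann kernel \<open>bkernel z \<xi>\<close>, the product
  \<open>bkernel z \<xi> * cnj (bkernel w \<xi>)\<close> is \<open>exp (- csq (vcomplex \<xi> - (1/2) *s (z + vcnj w)))\<close> times the
  reproducing kernel \<open>exp (cdot z (vcnj w) / 2)\<close> (\<open>bkernel_mult_cnj\<close>). Hence, if the symbol is
  \<open>\<phi> z = \<integral> m \<xi> * exp (- csq (vcomplex \<xi> - (1/2) *s z)) d\<xi>\<close>, then \<open>S_tilde_op \<phi>\<close> is multiplication by \<open>m\<close>,
  transported from the Lebesgue space of square integrable functions to the Fock space by the Bargmann
  transform \<open>bargmann u z = \<integral> u \<xi> * bkernel z \<xi> d\<xi>\<close>. A bounded \<open>m\<close> therefore gives a bounded operator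
  (\<open>S_tilde_op_bounded\<close>).

  Conversely, the Bargmann transform is onto (\<open>bargmann_surj\<close>), so every symbol \<open>\<phi> = bargmann f\<close> has the
  formal multiplier \<open>f \<xi> * exp ((norm \<xi>)\<^sup>2 / 2)\<close>, and only its boundedness is in question. The quadratic form of
  the operator at a suitable Gaussian \<open>testfun x \<eta>\<close> is, up to a constant, the integral of this multiplier with
  weight \<open>exp (- (norm \<xi>)\<^sup>2)\<close> against a Gaussian centred at \<open>x\<close> (\<open>quadratic_form_testfun\<close>), and the same formula for the symbol 1, whose operator is the
  identity, computes the norm of the test function. A bounded operator thus has all Gaussian averages of its
  multiplier bounded, and when the width of the Gaussians tends to 0 the multiplier itself is bounded almost everywhere
  (\<open>AE_norm_le_if_Gaussian_averages_le\<close>). The bounded operator is only known on polynomials, but its values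
  on the test functions follow by Taylor expansion (\<open>extension_on_exponentials\<close>).

  The operator \<open>S_op \<phi>\<close> is conjugate to \<open>S_tilde_op (\<lambda>z. \<phi> (- \<i> *s z))\<close> under the unitary rotation
  \<open>z \<mapsto> \<i> *s z\<close>, which turns the second characterisation into the first. If both operators are bounded, then
  \<open>\<phi>\<close> grows at \<open>vcomplex x + \<i> *s vcomplex y\<close> at most like \<open>exp ((norm x)\<^sup>2 / 4)\<close> and at most like
  \<open>exp ((norm y)\<^sup>2 / 4)\<close>. On a complex line through 0 in a real direction such a function is constant, by a
  Phragmen-Lindelof argument (\<open>constant_if_bounded_along_axes\<close>), and an entire function that is constant on
  the real points is constant.

  The Bargmann transform is controlled through its adjoint, first on compactly supported functions, where all
  integrals converge absolutely and the composition of the two maps is a multiple of the orthogonal projection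
  onto the Fock space. The reproducing property used for this comes from the mean value property of entire
  functions with respect to the rotation invariant Gaussian measure (\<open>gauss_mean_value\<close>).\<close>

section \<open>Square integrable functions\<close>

abbreviation norm_sq :: "'a measure \<Rightarrow> ('a \<Rightarrow> complex) \<Rightarrow> real" where
  "norm_sq M f \<equiv> LINT x|M. (cmod (f x))\<^sup>2"

definition square_integrable :: "'a measure \<Rightarrow> ('a \<Rightarrow> complex) \<Rightarrow> bool" where
  "square_integrable M f \<longleftrightarrow> f \<in> borel_measurable M \<and> integrable M (\<lambda>x. (cmod (f x))\<^sup>2)"

lemma square_integrableD [measurable_dest]: "square_integrable M f \<Longrightarrow> f \<in> borel_measurable M"
  by (simp add: square_integrable_def)

lemma square_integrable_bound:
  assumes "square_integrable M g" "f \<in> borel_measurable M" "AE x in M. cmod (f x) \<le> C * cmod (g x)"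
  shows "square_integrable M f"
  unfolding square_integrable_def
proof
  show "integrable M (\<lambda>x. (cmod (f x))\<^sup>2)"
  proof (rule Bochner_Integration.integrable_bound)
    show "integrable M (\<lambda>x. C\<^sup>2 * (cmod (g x))\<^sup>2)"
      using assms(1) by (simp add: square_integrable_def)
    show "(\<lambda>x. (cmod (f x))\<^sup>2) \<in> borel_measurable M" using assms(2) by measurable
    show "AE x in M. norm ((cmod (f x))\<^sup>2) \<le> norm (C\<^sup>2 * (cmod (g x))\<^sup>2)"
      using assms(3) by eventually_elim (simp add: power_mult_distrib[symmetric] power_mono)
  qed
qed (use assms in auto)

lemma square_integrable_mult_integrable:
  assumes "square_integrable M f" "square_integrable M g"
  shows "integrable M (\<lambda>x. f x * g x)"
proof (rule Bochner_Integration.integrable_bound)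
  show "integrable M (\<lambda>x. (cmod (f x))\<^sup>2 + (cmod (g x))\<^sup>2)"
    using assms by (simp add: square_integrable_def)
  show "(\<lambda>x. f x * g x) \<in> borel_measurable M" using assms by measurable
  have "norm (f x * g x) \<le> norm ((cmod (f x))\<^sup>2 + (cmod (g x))\<^sup>2)" for x
  proof -
    have "0 \<le> cmod (f x) * cmod (g x)" by simp
    then have "cmod (f x) * cmod (g x) \<le> (cmod (f x))\<^sup>2 + (cmod (g x))\<^sup>2"
      using sum_squares_bound[of "cmod (f x)" "cmod (g x)"] by linarith
    then show ?thesis by (simp add: norm_mult)
  qed
  then show "AE x in M. norm (f x * g x) \<le> norm ((cmod (f x))\<^sup>2 + (cmod (g x))\<^sup>2)" by simp
qed

lemma measurable_cnj [measurable]: "cnj \<in> borel_measurable borel"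
  by (intro borel_measurable_continuous_onI continuous_intros)

lemma square_integrable_cnj: "square_integrable M f \<Longrightarrow> square_integrable M (\<lambda>x. cnj (f x))"
  unfolding square_integrable_def by (auto intro: measurable_compose[OF _ measurable_cnj])

lemma square_integrable_cmult: "square_integrable M f \<Longrightarrow> square_integrable M (\<lambda>x. c * f x)"
  unfolding square_integrable_def by (auto simp: norm_mult power_mult_distrib)

lemma square_integrable_add:
  assumes f: "square_integrable M f" and g: "square_integrable M g"
  shows "square_integrable M (\<lambda>x. f x + g x)"
  unfolding square_integrable_def
proof
  show "integrable M (\<lambda>x. (cmod (f x + g x))\<^sup>2)"
  proof (rule Bochner_Integration.integrable_bound)
    show "integrable M (\<lambda>x. 2 * (cmod (f x))\<^sup>2 + 2 * (cmod (g x))\<^sup>2)"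
      using assms by (simp add: square_integrable_def)
    show "(\<lambda>x. (cmod (f x + g x))\<^sup>2) \<in> borel_measurable M" using assms by measurable
    have "(cmod (f x + g x))\<^sup>2 \<le> 2 * (cmod (f x))\<^sup>2 + 2 * (cmod (g x))\<^sup>2" for x
    proof -
      have "(cmod (f x + g x))\<^sup>2 \<le> (cmod (f x) + cmod (g x))\<^sup>2"
        by (intro power_mono norm_triangle_ineq) auto
      also have "\<dots> \<le> 2 * (cmod (f x))\<^sup>2 + 2 * (cmod (g x))\<^sup>2"
        using sum_squares_bound[of "cmod (f x)" "cmod (g x)"] by (simp add: power2_sum)
      finally show ?thesis .
    qed
    then show "AE x in M. norm ((cmod (f x + g x))\<^sup>2) \<le> norm (2 * (cmod (f x))\<^sup>2 + 2 * (cmod (g x))\<^sup>2)"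
      by simp
  qed
qed (use assms in measurable)

lemma square_integrable_diff:
  assumes "square_integrable M f" "square_integrable M g"
  shows "square_integrable M (\<lambda>x. f x - g x)"
  using square_integrable_add[OF assms(1) square_integrable_cmult[OF assms(2), of "-1"]] by simp

lemma Cauchy_Schwarz_integral:
  assumes f: "square_integrable M f" and g: "square_integrable M g"
  shows "(cmod (LINT x|M. f x * g x))\<^sup>2 \<le> norm_sq M f * norm_sq M g"
proof -
  define I where "I = (LINT x|M. cmod (f x) * cmod (g x))"
  define A where "A = norm_sq M f"
  define B where "B = norm_sq M g"
  have int: "integrable M (\<lambda>x. cmod (f x) * cmod (g x))"
    using integrable_norm[OF square_integrable_mult_integrable[OF f g]] by (simp add: norm_mult)
  have iA: "integrable M (\<lambda>x. (cmod (f x))\<^sup>2)" and iB: "integrable M (\<lambda>x. (cmod (g x))\<^sup>2)"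
    using f g by (auto simp: square_integrable_def)
  have quad: "0 \<le> s\<^sup>2 * A - 2 * s * I + B" for s
  proof -
    have "0 \<le> (LINT x|M. s\<^sup>2 * (cmod (f x))\<^sup>2 - 2 * s * (cmod (f x) * cmod (g x)) + (cmod (g x))\<^sup>2)"
    proof (rule integral_nonneg_AE, rule AE_I2)
      fix x
      show "0 \<le> s\<^sup>2 * (cmod (f x))\<^sup>2 - 2 * s * (cmod (f x) * cmod (g x)) + (cmod (g x))\<^sup>2"
        using zero_le_power2[of "s * cmod (f x) - cmod (g x)"]
        by (simp add: power2_diff power_mult_distrib algebra_simps)
    qed
    also have "\<dots> = s\<^sup>2 * A - 2 * s * I + B"
      unfolding A_def B_def I_def
      using int iA iB by simp
    finally show ?thesis .
  qed
  have "I\<^sup>2 \<le> A * B"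
  proof (cases "A = 0")
    case True
    have "I = 0"
    proof (rule ccontr)
      assume "I \<noteq> 0"
      with quad[of "(B + 1) / (2 * I)"] True show False by (simp add: field_simps)
    qed
    then show ?thesis using True by simp
  next
    case False
    moreover have "A \<ge> 0" unfolding A_def by (simp add: integral_nonneg_AE)
    ultimately have "A > 0" by simp
    then show ?thesis using quad[of "I / A"]
      by (simp add: power2_eq_square field_simps)
  qed
  moreover have "cmod (LINT x|M. f x * g x) \<le> I"
    unfolding I_def using integral_norm_bound[of M "\<lambda>x. f x * g x"] by (simp add: norm_mult)
  ultimately show ?thesis
    unfolding A_def[symmetric] B_def[symmetric]
    by (meson norm_ge_zero order_trans power_mono)
qed

text \<open>
  The quantitative form of completeness of \<open>L\<^sup>2\<close>: the weights \<open>2 ^ k\<close> turn the geometric decay of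
  the increments into one integrable majorant of all the \<open>(cmod (f k x))\<^sup>2\<close>, so that later limits
  can be taken by dominated convergence.\<close>

lemma square_integrable_fast_Cauchy_limit:
  fixes f :: "nat \<Rightarrow> 'a \<Rightarrow> complex"
  assumes f: "\<And>k. square_integrable M (f k)"
    and fast: "\<And>k. norm_sq M (\<lambda>x. f (Suc k) x - f k x) \<le> D * (1/4) ^ k"
  obtains g H where "square_integrable M g" "integrable M H"
    "\<And>k. AE x in M. (cmod (f k x))\<^sup>2 \<le> H x" "AE x in M. (\<lambda>k. f k x) \<longlonglongrightarrow> g x"
proof -
  have [measurable]: "f k \<in> borel_measurable M" for k using f by measurable
  define d where "d k x = f (Suc k) x - f k x" for k x
  have d: "square_integrable M (d k)" for k
    unfolding d_def by (intro square_integrable_diff f)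
  have [measurable]: "d k \<in> borel_measurable M" for k using d by measurable
  define w where "w k x = 2 ^ k * (cmod (d k x))\<^sup>2" for k :: nat and x
  have [measurable]: "w k \<in> borel_measurable M" for k unfolding w_def by measurable
  have w0: "w k x \<ge> 0" for k x unfolding w_def by simp
  have iw: "integrable M (w k)" for k
    unfolding w_def using d by (simp add: square_integrable_def)
  have Iw: "(LINT x|M. w k x) \<le> D * (1/2) ^ k" for k
  proof -
    have "(LINT x|M. w k x) = 2 ^ k * norm_sq M (d k)"
      unfolding w_def by simp
    also have "\<dots> \<le> 2 ^ k * (D * (1/4) ^ k)"
      unfolding d_def by (intro mult_left_mono fast) auto
    also have "\<dots> = D * (2 * (1/4)) ^ k" by (simp only: power_mult_distrib mult_ac)
    finally show ?thesis by simp
  qed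
  have sI: "summable (\<lambda>k. LINT x|M. norm (w k x))"
  proof (rule summable_comparison_test)
    show "summable (\<lambda>k. D * (1/2::real) ^ k)" by (intro summable_mult summable_geometric) simp
    show "\<exists>N. \<forall>n\<ge>N. norm (LINT x|M. norm (w n x)) \<le> D * (1/2) ^ n"
      using Iw w0 by (simp add: integral_nonneg_AE)
  qed
  have sAE: "AE x in M. summable (\<lambda>k. norm (w k x))"
  proof -
    have "(\<integral>\<^sup>+x. (\<Sum>k. ennreal (w k x)) \<partial>M) = (\<Sum>k. \<integral>\<^sup>+x. ennreal (w k x) \<partial>M)"
      by (rule nn_integral_suminf) simp
    also have "\<dots> = (\<Sum>k. ennreal (LINT x|M. w k x))"
      using iw w0 by (simp add: nn_integral_eq_integral)
    also have "\<dots> \<noteq> \<infinity>"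
      using sI w0 by (subst suminf_ennreal2) (auto simp: integral_nonneg_AE)
    finally have "AE x in M. (\<Sum>k. ennreal (w k x)) \<noteq> \<infinity>"
      by (intro nn_integral_noteq_infinite) auto
    then show ?thesis
    proof eventually_elim
      case (elim x)
      then have "summable (\<lambda>k. w k x)"
        using summable_suminf_not_top[of "\<lambda>k. w k x"] w0 by auto
      then show ?case using w0 by simp
    qed
  qed
  define S where "S x = (\<Sum>k. w k x)" for x
  have iS: "integrable M S" unfolding S_def
    by (rule integrable_suminf[OF iw sAE sI])
  define H where "H x = 2 * (cmod (f 0 x))\<^sup>2 + 4 * S x" for x
  have iH: "integrable M H" unfolding H_def using iS f by (auto simp: square_integrable_def)
  define g where "g x = lim (\<lambda>k. f k x)" for x
  have gm: "g \<in> borel_measurable M" unfolding g_def by (rule borel_measurable_lim_metric) simp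
  have tel: "f k x = f 0 x + (\<Sum>j<k. d j x)" for k x
    unfolding d_def using sum_lessThan_telescope[of "\<lambda>k. f k x" k] by simp
  have conv: "AE x in M. (\<lambda>k. f k x) \<longlonglongrightarrow> g x"
    using sAE
  proof eventually_elim
    case (elim x)
    have "summable (\<lambda>k. cmod (d k x))"
    proof (rule summable_comparison_test)
      show "summable (\<lambda>k. (1/2) ^ k + norm (w k x))"
        by (intro summable_add elim summable_geometric) simp
      have "norm (d n x) \<le> (1/2) ^ n + norm (w n x)" for n
      proof -
        have *: "2 ^ n * ((1/2::real) ^ n * (1/2) ^ n) = (1/2) ^ n"
          by (simp add: power_mult_distrib[symmetric])
        have "2 * ((1/2) ^ n * cmod (d n x)) \<le> ((1/2) ^ n)\<^sup>2 + (cmod (d n x))\<^sup>2"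
          using sum_squares_bound[of "(1/2) ^ n" "cmod (d n x)"] by simp
        from mult_left_mono[OF this, of "2 ^ n"]
        have "2 * (2 ^ n * (1/2) ^ n) * cmod (d n x) \<le> (1/2) ^ n + norm (w n x)"
          using * by (simp add: w_def algebra_simps power2_eq_square abs_mult)
        then have "2 * cmod (d n x) \<le> (1/2) ^ n + norm (w n x)"
          by (simp add: power_mult_distrib[symmetric])
        then show ?thesis using norm_ge_zero[of "d n x"] by linarith
      qed
      then show "\<exists>N. \<forall>n\<ge>N. norm (cmod (d n x)) \<le> (1/2) ^ n + norm (w n x)" by simp
    qed
    then have "summable (\<lambda>k. d k x)" by (rule summable_norm_cancel)
    then have "(\<lambda>k. f 0 x + (\<Sum>j<k. d j x)) \<longlonglongrightarrow> f 0 x + (\<Sum>k. d k x)"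
      by (intro tendsto_add tendsto_const summable_LIMSEQ)
    moreover have "(\<lambda>k. f k x) = (\<lambda>k. f 0 x + (\<Sum>j<k. d j x))" by (intro ext tel)
    ultimately have "(\<lambda>k. f k x) \<longlonglongrightarrow> f 0 x + (\<Sum>k. d k x)" by simp
    then show ?case unfolding g_def by (simp add: limI)
  qed
  have bound: "AE x in M. (cmod (f k x))\<^sup>2 \<le> H x" for k
    using sAE
  proof eventually_elim
    case (elim x)
    have "(\<Sum>j<k. cmod (d j x))\<^sup>2 = (\<Sum>j<k. sqrt ((1/2) ^ j) * sqrt (w j x))\<^sup>2"
    proof -
      have "sqrt ((1/2) ^ j) * sqrt (w j x) = cmod (d j x)" for j
        unfolding real_sqrt_mult[symmetric] w_def by (simp add: power_mult_distrib[symmetric] mult.assoc[symmetric])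
      then show ?thesis by simp
    qed
    also have "\<dots> \<le> (\<Sum>j<k. (sqrt ((1/2) ^ j))\<^sup>2) * (\<Sum>j<k. (sqrt (w j x))\<^sup>2)"
      by (rule Cauchy_Schwarz_ineq_sum)
    also have "\<dots> = (\<Sum>j<k. (1/2::real) ^ j) * (\<Sum>j<k. w j x)"
      using w0 by simp
    also have "\<dots> \<le> 2 * S x"
    proof (rule mult_mono)
      have "(\<Sum>j<k. (1/2::real) ^ j) \<le> (\<Sum>j. (1/2::real) ^ j)"
        by (intro sum_le_suminf summable_geometric) auto
      then show "(\<Sum>j<k. (1/2::real) ^ j) \<le> 2" by (simp add: suminf_geometric)
      show "(\<Sum>j<k. w j x) \<le> S x" unfolding S_def
        using elim w0 by (intro sum_le_suminf) auto
    qed (auto intro: sum_nonneg w0)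
    finally have 1: "(\<Sum>j<k. cmod (d j x))\<^sup>2 \<le> 2 * S x" .
    have "cmod (f k x) \<le> cmod (f 0 x) + (\<Sum>j<k. cmod (d j x))"
      using tel[of k x] norm_triangle_ineq[of "f 0 x" "\<Sum>j<k. d j x"] norm_sum[of "\<lambda>j. d j x" "{..<k}"]
      by simp
    then have "(cmod (f k x))\<^sup>2 \<le> (cmod (f 0 x) + (\<Sum>j<k. cmod (d j x)))\<^sup>2"
      by (intro power_mono) auto
    also have "\<dots> \<le> 2 * (cmod (f 0 x))\<^sup>2 + 2 * (\<Sum>j<k. cmod (d j x))\<^sup>2"
      using sum_squares_bound[of "cmod (f 0 x)" "\<Sum>j<k. cmod (d j x)"] by (simp add: power2_sum)
    finally show ?case using 1 unfolding H_def by simp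
  qed
  have "square_integrable M g"
    unfolding square_integrable_def
  proof
    show "integrable M (\<lambda>x. (cmod (g x))\<^sup>2)"
    proof (rule Bochner_Integration.integrable_bound[OF iH])
      show "(\<lambda>x. (cmod (g x))\<^sup>2) \<in> borel_measurable M" using gm by measurable
      have "AE x in M. \<forall>k. (cmod (f k x))\<^sup>2 \<le> H x" using bound by (simp add: AE_all_countable)
      then show "AE x in M. norm ((cmod (g x))\<^sup>2) \<le> norm (H x)"
        using conv
      proof eventually_elim
        case (elim x)
        have "(\<lambda>k. (cmod (f k x))\<^sup>2) \<longlonglongrightarrow> (cmod (g x))\<^sup>2"
          using elim by (intro tendsto_power tendsto_norm)
        then have "(cmod (g x))\<^sup>2 \<le> H x"
          by (rule LIMSEQ_le_const2) (use elim in auto)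
        then show ?case by simp
      qed
    qed
  qed (rule gm)
  from that[OF this iH bound conv] show thesis .
qed

section \<open>Gaussian integrals\<close>

text \<open>The integrand factors over the coordinates, and in one variable it is a multiple of a normal density.\<close>

lemma nn_integral_gaussian:
  assumes "a > 0"
  shows "(\<integral>\<^sup>+x. ennreal (exp (- a * (norm (x::'a::euclidean_space))\<^sup>2)) \<partial>lborel)
     = ennreal (sqrt (pi / a) ^ DIM('a))"
proof -
  have 1: "(\<integral>\<^sup>+x. ennreal (exp (- a * x\<^sup>2)) \<partial>lborel) = ennreal (sqrt (pi / a))"
  proof -
    define \<sigma> where "\<sigma> = sqrt (1 / (2 * a))"
    have s: "\<sigma> > 0" "\<sigma>\<^sup>2 = 1 / (2 * a)" using assms by (simp_all add: \<sigma>_def)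
    have "2 * pi * \<sigma>\<^sup>2 = pi / a" "2 * \<sigma>\<^sup>2 = 1 / a" by (simp_all add: s)
    moreover have "sqrt (pi / a) \<noteq> 0" using assms by simp
    ultimately have "exp (- a * x\<^sup>2) = sqrt (pi / a) * normal_density 0 \<sigma> x" for x
      unfolding normal_density_def by (simp del: real_sqrt_eq_zero_cancel_iff)
    then have "(\<integral>\<^sup>+x. ennreal (exp (- a * x\<^sup>2)) \<partial>lborel)
       = (\<integral>\<^sup>+x. ennreal (sqrt (pi / a)) * ennreal (normal_density 0 \<sigma> x) \<partial>lborel)"
      using assms by (simp add: ennreal_mult)
    also have "\<dots> = ennreal (sqrt (pi / a)) * ennreal 1"
      using s by (subst nn_integral_cmult) (simp_all add: nn_integral_eq_integral)
    finally show ?thesis by simp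
  qed
  have "exp (- a * (norm x)\<^sup>2) = (\<Prod>b\<in>Basis. exp (- a * (x \<bullet> b)\<^sup>2))" for x :: 'a
  proof -
    have "(norm x)\<^sup>2 = (\<Sum>b\<in>Basis. (x \<bullet> b)\<^sup>2)"
      using euclidean_inner[of x x] unfolding power2_norm_eq_inner by (simp add: power2_eq_square)
    then show ?thesis by (simp add: sum_distrib_left exp_sum)
  qed
  then have "(\<integral>\<^sup>+x. ennreal (exp (- a * (norm (x::'a))\<^sup>2)) \<partial>lborel)
     = (\<integral>\<^sup>+x. (\<Prod>b\<in>Basis. ennreal (exp (- a * (x \<bullet> b)\<^sup>2))) \<partial>(lborel :: 'a measure))"
    by (simp add: prod_ennreal)
  also have "\<dots> = (\<Prod>b\<in>(Basis::'a set). (\<integral>\<^sup>+x. ennreal (exp (- a * x\<^sup>2)) \<partial>lborel))"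
    by (rule nn_integral_lborel_prod) auto
  also have "\<dots> = ennreal (sqrt (pi / a) ^ DIM('a))"
    using assms 1 by (simp add: ennreal_power)
  finally show ?thesis .
qed

lemma integrable_gaussian:
  assumes "a > 0"
  shows "integrable lborel (\<lambda>x::'a::euclidean_space. exp (- a * (norm x)\<^sup>2))"
  by (rule integrableI_nonneg) (use nn_integral_gaussian[OF assms, where 'a='a] in auto)

lemma integral_gaussian:
  assumes "a > 0"
  shows "(LINT x|lborel. exp (- a * (norm (x::'a::euclidean_space))\<^sup>2)) = sqrt (pi / a) ^ DIM('a)"
  using nn_integral_gaussian[OF assms, where 'a='a] nn_integral_eq_integral[OF integrable_gaussian[OF assms, where 'a='a]]
    assms by (simp add: integral_nonneg_AE)

lemma exp_linear_le_gaussian: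
  fixes a b t :: real
  assumes "a > 0"
  shows "exp (b * t - a * t\<^sup>2) \<le> exp (b\<^sup>2 / (2 * a)) * exp (- (a / 2) * t\<^sup>2)"
proof -
  have "0 \<le> (a / 2) * (t - b / a)\<^sup>2" using assms by simp
  also have "\<dots> = (a / 2) * t\<^sup>2 - b * t + b\<^sup>2 / (2 * a)"
    using assms by (simp add: power2_eq_square field_simps)
  finally show ?thesis unfolding exp_add[symmetric] exp_le_cancel_iff by simp
qed

lemma integrable_gaussian_linear:
  assumes "a > 0"
  shows "integrable lborel (\<lambda>x::'a::euclidean_space. exp (b * norm x - a * (norm x)\<^sup>2))"
proof (rule Bochner_Integration.integrable_bound)
  show "integrable lborel (\<lambda>x::'a. exp (b\<^sup>2 / (2 * a)) * exp (- (a / 2) * (norm x)\<^sup>2))"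
    using assms by (intro integrable_mult_right integrable_gaussian) auto
  show "AE x in lborel. norm (exp (b * norm x - a * (norm x)\<^sup>2)) \<le>
      norm (exp (b\<^sup>2 / (2 * a)) * exp (- (a / 2) * (norm (x::'a))\<^sup>2))"
    using exp_linear_le_gaussian[OF assms, of b] by (intro AE_I2) (simp add: abs_mult)
qed measurable

lemma integrable_lborel_translate:
  fixes f :: "'a::euclidean_space \<Rightarrow> 'b::{banach, second_countable_topology}"
  assumes [measurable]: "f \<in> borel_measurable borel"
  shows "integrable lborel (\<lambda>x. f (a + x)) \<longleftrightarrow> integrable lborel f"
proof -
  have "integrable (distr lborel borel ((+) a)) f \<longleftrightarrow> integrable lborel (\<lambda>x. f (a + x))"
    by (subst integrable_distr_eq) auto
  then show ?thesis by (simp add: lborel_distr_plus)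
qed

lemma integral_lborel_translate:
  fixes f :: "'a::euclidean_space \<Rightarrow> 'b::{banach, second_countable_topology}"
  assumes [measurable]: "f \<in> borel_measurable borel"
  shows "(LINT x|lborel. f (a + x)) = (LINT x|lborel. f x)"
proof -
  have "(LINT x|distr lborel borel ((+) a). f x) = (LINT x|lborel. f (a + x))"
    by (subst integral_distr) auto
  then show ?thesis by (simp add: lborel_distr_plus)
qed

section \<open>The bilinear form and conjugation on complex coordinate space\<close>

lemma norm_vec_cmod: "(norm (z :: complex ^ 'n))\<^sup>2 = (\<Sum>j\<in>UNIV. (cmod (z $ j))\<^sup>2)"
  unfolding norm_vec_def L2_set_def by (simp add: sum_nonneg)

lemma norm_cdot_le: "cmod (cdot z w) \<le> norm z * norm w"
proof -
  have "cmod (cdot z w) \<le> (\<Sum>j\<in>UNIV. \<bar>cmod (z $ j)\<bar> * \<bar>cmod (w $ j)\<bar>)"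
    unfolding cdot_def by (rule order_trans[OF norm_sum]) (simp add: norm_mult)
  also have "\<dots> \<le> norm z * norm w"
    unfolding norm_vec_def by (rule L2_set_mult_ineq)
  finally show ?thesis .
qed

lemma bounded_bilinear_cdot: "bounded_bilinear cdot"
proof
  show "\<exists>K. \<forall>a b. norm (cdot a b) \<le> norm a * norm b * K"
    using norm_cdot_le by (intro exI[of _ 1]) auto
qed (auto simp: cdot_def algebra_simps sum.distrib scaleR_sum_right)

lemma cdot_commute: "cdot z w = cdot w z" by (simp add: cdot_def mult.commute)

lemma cdot_add_left: "cdot (z + u) w = cdot z w + cdot u w"
  and cdot_add_right: "cdot w (z + u) = cdot w z + cdot w u"
  and cdot_diff_left: "cdot (z - u) w = cdot z w - cdot u w"
  and cdot_diff_right: "cdot w (z - u) = cdot w z - cdot w u"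
  and cdot_smult_left: "cdot (c *s z) w = c * cdot z w"
  and cdot_smult_right: "cdot w (c *s z) = c * cdot w z"
  and cdot_zero_left: "cdot 0 w = 0" and cdot_zero_right: "cdot w 0 = 0"
  and cdot_minus_left: "cdot (- z) w = - cdot z w"
  and cdot_minus_right: "cdot w (- z) = - cdot w z"
  by (simp_all add: cdot_def distrib_left distrib_right left_diff_distrib right_diff_distrib
      sum.distrib sum_subtractf sum_distrib_left sum_negf mult.assoc mult.left_commute[of _ c])

lemmas cdot_simps = cdot_add_left cdot_add_right cdot_diff_left cdot_diff_right cdot_smult_left
  cdot_smult_right cdot_zero_left cdot_zero_right cdot_minus_left cdot_minus_right

lemma vcnj_simps [simp]: "vcnj (z + w) = vcnj z + vcnj w" "vcnj (z - w) = vcnj z - vcnj w"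
  "vcnj (c *s z) = cnj c *s vcnj z" "vcnj (vcnj z) = z" "vcnj (vcomplex x) = vcomplex x"
  "vcnj 0 = 0" "vcnj (- z) = - vcnj z"
  by (simp_all add: vcnj_def vcomplex_def vec_eq_iff)

lemma norm_vcnj [simp]: "norm (vcnj z) = norm z"
  by (simp add: vcnj_def norm_vec_def L2_set_def)

lemma norm_vcomplex [simp]: "norm (vcomplex x) = norm x"
  by (simp add: vcomplex_def norm_vec_def L2_set_def)

lemma norm_smult [simp]: "norm (c *s (z :: complex ^ 'n)) = cmod c * norm z"
  unfolding norm_vec_def by (simp add: norm_mult L2_set_right_distrib)

lemma smult_scaleR: "complex_of_real r *s (z :: complex ^ 'n) = r *\<^sub>R z"
  by (simp add: vec_eq_iff complex_eq_iff)

lemma bounded_linear_vcnj: "bounded_linear vcnj"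
proof
  show "\<exists>K. \<forall>x. norm (vcnj x) \<le> norm x * K" by (intro exI[of _ 1]) auto
qed (simp_all add: vcnj_def vec_eq_iff)

lemma bounded_linear_vcomplex: "bounded_linear vcomplex"
proof
  show "\<exists>K. \<forall>x. norm (vcomplex x) \<le> norm x * K" by (intro exI[of _ 1]) auto
qed (simp_all add: vcomplex_def vec_eq_iff complex_eq_iff)

lemma bounded_linear_smult: "bounded_linear (\<lambda>z :: complex ^ 'n. c *s z)"
proof
  show "\<exists>K. \<forall>x. norm (c *s (x :: complex ^ 'n)) \<le> norm x * K"
    by (intro exI[of _ "cmod c"]) (auto simp: mult.commute)
qed (simp_all add: vec_eq_iff distrib_left distrib_right complex_eq_iff algebra_simps)

lemma bounded_linear_smult_left: "bounded_linear (\<lambda>c. c *s (z :: complex ^ 'n))"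
proof
  show "\<exists>K. \<forall>x. norm (x *s z) \<le> norm x * K" by (intro exI[of _ "norm z"]) auto
qed (simp_all add: vec_eq_iff distrib_left distrib_right complex_eq_iff algebra_simps)

lemma cnj_cdot: "cnj (cdot z w) = cdot (vcnj z) (vcnj w)"
  by (simp add: cdot_def vcnj_def)

lemma cdot_vcomplex: "cdot (vcomplex x) (vcomplex y) = complex_of_real (x \<bullet> y)"
  by (simp add: cdot_def vcomplex_def inner_vec_def)

lemma Re_cdot_vcnj: "Re (cdot z (vcnj w)) = z \<bullet> w"
  by (simp add: cdot_def vcnj_def inner_vec_def inner_complex_def)

lemma cdot_vcnj_self: "cdot z (vcnj z) = complex_of_real ((norm z)\<^sup>2)"
  unfolding norm_vec_cmod cdot_def by (simp add: vcnj_def complex_mult_cnj cmod_power2)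

lemma csq_add: "csq (z + w) = csq z + 2 * cdot z w + csq w"
  using cdot_commute[of w z] by (simp add: csq_def cdot_simps)

lemma csq_diff: "csq (z - w) = csq z - 2 * cdot z w + csq w"
  using cdot_commute[of w z] by (simp add: csq_def cdot_simps)

lemma csq_smult: "csq (c *s z) = c\<^sup>2 * csq z"
  by (simp add: csq_def cdot_simps power2_eq_square)

lemma csq_vcomplex: "csq (vcomplex x) = complex_of_real ((norm x)\<^sup>2)"
  by (simp add: csq_def cdot_vcomplex power2_norm_eq_inner)

lemma cnj_csq: "cnj (csq z) = csq (vcnj z)"
  by (simp add: csq_def cnj_cdot)

lemma norm_csq_le: "cmod (csq z) \<le> (norm z)\<^sup>2"
  unfolding csq_def power2_eq_square by (rule norm_cdot_le)

lemma real_imag_decomp: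
  obtains x y :: "real ^ 'n" where "z = vcomplex x + \<i> *s vcomplex y"
proof
  show "z = vcomplex (\<chi> j. Re (z $ j)) + \<i> *s vcomplex (\<chi> j. Im (z $ j))"
    by (simp add: vec_eq_iff vcomplex_def complex_eq_iff)
qed

lemma measurable_cdot [measurable (raw)]:
  assumes [measurable]: "f \<in> borel_measurable M" "g \<in> borel_measurable M"
  shows "(\<lambda>x. cdot (f x) (g x)) \<in> borel_measurable M"
  by (rule borel_measurable_continuous_Pair[OF assms])
    (intro bounded_bilinear.continuous_on[OF bounded_bilinear_cdot] continuous_intros)

lemma measurable_csq [measurable (raw)]:
  "f \<in> borel_measurable M \<Longrightarrow> (\<lambda>x. csq (f x)) \<in> borel_measurable M"
  unfolding csq_def by measurable

lemma measurable_vcnj [measurable]: "vcnj \<in> borel_measurable borel"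
  by (intro borel_measurable_continuous_onI linear_continuous_on bounded_linear_vcnj)

lemma measurable_vcomplex [measurable]: "vcomplex \<in> borel_measurable borel"
  by (intro borel_measurable_continuous_onI linear_continuous_on bounded_linear_vcomplex)

lemma measurable_smult [measurable]: "(\<lambda>z :: complex ^ 'n. c *s z) \<in> borel_measurable borel"
  by (intro borel_measurable_continuous_onI linear_continuous_on bounded_linear_smult)

section \<open>Entire functions of several variables\<close>

lemma entire_const: "entire (\<lambda>z. c)"
  unfolding entire_def by (intro allI exI[of _ "\<lambda>_. 0"]) auto

lemma entire_cdot: "entire (\<lambda>z. cdot z a)"
  unfolding entire_def
  using bounded_linear_imp_has_derivative[OF
      bounded_bilinear.bounded_linear_left[OF bounded_bilinear_cdot, of a]]
  by (auto intro!: exI[of _ "\<lambda>v. cdot v a"] simp: cdot_simps)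

lemma entire_add: assumes "entire F" "entire G" shows "entire (\<lambda>z. F z + G z)"
  unfolding entire_def
proof
  fix z
  obtain D E where "(F has_derivative D) (at z)" "\<forall>c v. D (c *s v) = c * D v"
    "(G has_derivative E) (at z)" "\<forall>c v. E (c *s v) = c * E v"
    using assms unfolding entire_def by meson
  then show "\<exists>D. ((\<lambda>z. F z + G z) has_derivative D) (at z) \<and> (\<forall>c v. D (c *s v) = c * D v)"
    by (intro exI[of _ "\<lambda>v. D v + E v"]) (auto intro!: derivative_eq_intros simp: algebra_simps)
qed

lemma entire_mult: assumes "entire F" "entire G" shows "entire (\<lambda>z. F z * G z)"
  unfolding entire_def
proof
  fix z
  obtain D E where "(F has_derivative D) (at z)" "\<forall>c v. D (c *s v) = c * D v"
    "(G has_derivative E) (at z)" "\<forall>c v. E (c *s v) = c * E v"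
    using assms unfolding entire_def by meson
  note DE = this
  have "((\<lambda>z. F z * G z) has_derivative (\<lambda>v. F z * E v + D v * G z)) (at z)"
    by (rule has_derivative_mult[OF DE(1,3)])
  with DE(2,4)
  show "\<exists>D. ((\<lambda>z. F z * G z) has_derivative D) (at z) \<and> (\<forall>c v. D (c *s v) = c * D v)"
    by (intro exI[of _ "\<lambda>v. F z * E v + D v * G z"]) (simp add: algebra_simps)
qed

lemma entire_exp: assumes "entire F" shows "entire (\<lambda>z. exp (F z))"
  unfolding entire_def
proof
  fix z
  obtain D where D: "(F has_derivative D) (at z)" "\<forall>c v. D (c *s v) = c * D v"
    using assms unfolding entire_def by meson
  have "(exp has_derivative (*) (exp (F z))) (at (F z))"
    using DERIV_exp[of "F z"] by (simp add: has_field_derivative_def)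
  from has_derivative_compose[OF D(1) this] D(2)
  show "\<exists>D. ((\<lambda>z. exp (F z)) has_derivative D) (at z) \<and> (\<forall>c v. D (c *s v) = c * D v)"
    by (intro exI[of _ "\<lambda>v. exp (F z) * D v"]) auto
qed

lemma entire_cmult: "entire F \<Longrightarrow> entire (\<lambda>z. c * F z)"
  by (rule entire_mult[OF entire_const])

lemma entire_affine: assumes "entire F" shows "entire (\<lambda>z. F (a + c *s z))"
  unfolding entire_def
proof
  fix z
  obtain D where D: "(F has_derivative D) (at (a + c *s z))" "\<forall>c v. D (c *s v) = c * D v"
    using assms unfolding entire_def by meson
  have "((\<lambda>z. a + c *s z) has_derivative (\<lambda>v. c *s v)) (at z)"
    by (auto intro!: derivative_eq_intros bounded_linear.has_derivative[OF bounded_linear_smult])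
  from has_derivative_compose[OF this D(1)] D(2)
  show "\<exists>D. ((\<lambda>z. F (a + c *s z)) has_derivative D) (at z) \<and> (\<forall>c v. D (c *s v) = c * D v)"
    by (intro exI[of _ "\<lambda>v. D (c *s v)"]) (auto simp: mult.left_commute)
qed

lemma entire_csq: "entire (\<lambda>z. csq z)"
  unfolding entire_def csq_def
proof
  fix z :: "complex ^ 'a"
  show "\<exists>D. ((\<lambda>z. cdot z z) has_derivative D) (at z) \<and> (\<forall>c v. D (c *s v) = c * D v)"
    by (intro exI[of _ "\<lambda>v. cdot z v + cdot v z"] conjI
        bounded_bilinear.FDERIV[OF bounded_bilinear_cdot] has_derivative_ident)
      (simp add: cdot_simps distrib_left)
qed

lemma entire_conjugate: assumes "entire F" shows "entire (\<lambda>z. cnj (F (vcnj z)))"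
  unfolding entire_def
proof
  fix z
  obtain D where D: "(F has_derivative D) (at (vcnj z))" "\<forall>c v. D (c *s v) = c * D v"
    using assms unfolding entire_def by meson
  have "(vcnj has_derivative vcnj) (at z)"
    by (rule bounded_linear_imp_has_derivative[OF bounded_linear_vcnj])
  from bounded_linear.has_derivative[OF bounded_linear_cnj has_derivative_compose[OF this D(1)]] D(2)
  show "\<exists>D. ((\<lambda>z. cnj (F (vcnj z))) has_derivative D) (at z) \<and> (\<forall>c v. D (c *s v) = c * D v)"
    by (intro exI[of _ "\<lambda>v. cnj (D (vcnj v))"]) auto
qed

lemma entire_continuous_on: assumes "entire F" shows "continuous_on A F"
proof -
  have "isCont F z" for z
    using assms has_derivative_continuous unfolding entire_def by blast
  then show ?thesis by (simp add: continuous_at_imp_continuous_on)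
qed

lemma entire_measurable: "entire F \<Longrightarrow> F \<in> borel_measurable borel"
  by (intro borel_measurable_continuous_onI entire_continuous_on)

lemma entire_holomorphic_on_line:
  assumes "entire F" shows "(\<lambda>t. F (a + t *s b)) holomorphic_on A"
proof (rule holomorphic_onI)
  fix t
  obtain D where D: "(F has_derivative D) (at (a + t *s b))" "\<forall>c v. D (c *s v) = c * D v"
    using assms unfolding entire_def by meson
  have "((\<lambda>t. a + t *s b) has_derivative (\<lambda>s. s *s b)) (at t)"
    by (auto intro!: derivative_eq_intros bounded_linear.has_derivative[OF bounded_linear_smult_left])
  from has_derivative_compose[OF this D(1)]
  have "((\<lambda>t. F (a + t *s b)) has_derivative (\<lambda>s. D b * s)) (at t)"
    using D(2) by (simp add: mult.commute)
  then show "(\<lambda>t. F (a + t *s b)) field_differentiable (at t within A)"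
    unfolding field_differentiable_def has_field_derivative_def
    using has_derivative_at_withinI by blast
qed

text \<open>
  The points with real coordinates form a set of uniqueness: on the complex line through
  two real points this is the one-variable identity theorem, and these lines cover the space.\<close>

lemma entire_eq_if_eq_on_reals:
  assumes F: "entire F" and G: "entire G" and eq: "\<And>x. F (vcomplex x) = G (vcomplex x)"
  shows "F z = G z"
proof -
  obtain x y where z: "z = vcomplex x + \<i> *s vcomplex y" by (rule real_imag_decomp)
  define h where "h t = F (vcomplex x + t *s vcomplex y) - G (vcomplex x + t *s vcomplex y)" for t
  have "h \<i> = 0"
  proof (rule analytic_continuation[of h UNIV "\<real>" 0])
    show "h holomorphic_on UNIV"
      unfolding h_def by (intro holomorphic_intros entire_holomorphic_on_line F G)
    show "0 islimpt (\<real> :: complex set)"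
      unfolding islimpt_approachable
    proof (intro allI impI)
      fix e :: real assume "e > 0"
      then show "\<exists>t\<in>\<real>. t \<noteq> 0 \<and> dist t (0::complex) < e"
        by (intro bexI[of _ "complex_of_real (e / 2)"]) auto
    qed
    fix t :: complex assume "t \<in> \<real>"
    then obtain r where r: "t = complex_of_real r" by (auto elim: Reals_cases)
    have "vcomplex x + t *s vcomplex y = vcomplex (x + r *\<^sub>R y)"
      by (simp add: r vec_eq_iff vcomplex_def)
    then show "h t = 0" by (simp add: h_def eq)
  qed auto
  then show ?thesis by (simp add: h_def z)
qed

section \<open>Laplace integrals\<close>

lemma norm_exp_cdot_vcomplex_le:
  "cmod (exp (cdot (vcomplex \<xi>) z)) \<le> exp (norm z * norm \<xi>)"
proof -
  have "Re (cdot (vcomplex \<xi>) z) \<le> norm z * norm \<xi>"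
    using complex_Re_le_cmod[of "cdot (vcomplex \<xi>) z"] norm_cdot_le[of "vcomplex \<xi>" z]
    by (simp add: mult.commute)
  then show ?thesis by simp
qed

lemma norm_Laplace_integrand_le:
  "cmod (g * exp (cdot (vcomplex \<xi>) z)) \<le> cmod g * exp (norm z * norm \<xi>)"
  unfolding norm_mult by (intro mult_left_mono norm_exp_cdot_vcomplex_le) simp

text \<open>
  Differentiation under the integral sign. The second order Taylor remainder of the exponential is
  controlled by the same kind of majorant as the integrand, which gives the Frechet derivative directly.\<close>

lemma entire_Laplace:
  fixes g :: "real ^ 'n \<Rightarrow> complex"
  assumes [measurable]: "g \<in> borel_measurable borel"
    and int: "\<And>R. integrable lborel (\<lambda>\<xi>. cmod (g \<xi>) * exp (R * norm \<xi>))"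
  shows "entire (\<lambda>z. LINT \<xi>|lborel. g \<xi> * exp (cdot (vcomplex \<xi>) z))"
  unfolding entire_def
proof
  fix z :: "complex ^ 'n"
  define E where "E \<xi> = g \<xi> * exp (cdot (vcomplex \<xi>) z)" for \<xi>
  have [measurable]: "E \<in> borel_measurable borel" unfolding E_def by measurable
  have intE: "integrable lborel (\<lambda>\<xi>. g \<xi> * exp (cdot (vcomplex \<xi>) y))" for y
    by (rule Bochner_Integration.integrable_bound[OF int[of "norm y"]])
      (use norm_Laplace_integrand_le in \<open>auto simp: abs_mult\<close>)
  have bE: "cmod (E \<xi>) \<le> cmod (g \<xi>) * exp (norm z * norm \<xi>)" for \<xi>
    unfolding E_def by (rule norm_Laplace_integrand_le)
  have exp1: "norm \<xi> \<le> exp (norm \<xi>)" for \<xi> :: "real ^ 'n"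
    using exp_ge_add_one_self[of "norm \<xi>"] by linarith
  have exp2: "(norm \<xi>)\<^sup>2 \<le> 2 * exp (norm \<xi>)" for \<xi> :: "real ^ 'n"
    using exp_lower_Taylor_quadratic[OF norm_ge_zero[of \<xi>]] norm_ge_zero[of \<xi>] by linarith
  have bD: "cmod (E \<xi> * cdot (vcomplex \<xi>) v)
      \<le> norm v * (cmod (g \<xi>) * exp ((norm z + 1) * norm \<xi>))" for \<xi> v
  proof -
    have "cmod (E \<xi> * cdot (vcomplex \<xi>) v) \<le> cmod (E \<xi>) * (norm \<xi> * norm v)"
      using norm_cdot_le[of "vcomplex \<xi>" v] by (simp add: norm_mult mult_left_mono)
    also have "\<dots> \<le> (cmod (g \<xi>) * exp (norm z * norm \<xi>)) * (exp (norm \<xi>) * norm v)"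
      by (intro mult_mono bE exp1) auto
    also have "\<dots> = norm v * (cmod (g \<xi>) * exp ((norm z + 1) * norm \<xi>))"
      by (simp add: ring_distribs exp_add mult_ac)
    finally show ?thesis .
  qed
  have intD: "integrable lborel (\<lambda>\<xi>. E \<xi> * cdot (vcomplex \<xi>) v)" for v
    by (rule Bochner_Integration.integrable_bound[OF integrable_mult_right[OF int[of "norm z + 1"], of "norm v"]])
      (use bD[of _ v] in \<open>auto simp: abs_mult\<close>)
  define D where "D v = (LINT \<xi>|lborel. E \<xi> * cdot (vcomplex \<xi>) v)" for v
  define K where "K = (LINT \<xi>|lborel. cmod (g \<xi>) * exp ((norm z + 2) * norm \<xi>))"
  have D_smult: "D (c *s v) = c * D v" for c v
    unfolding D_def integral_mult_right_zero[symmetric] by (simp add: cdot_simps mult_ac)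
  have "bounded_linear D"
  proof
    show "D (v + w) = D v + D w" for v w
      unfolding D_def using intD by (simp add: cdot_simps distrib_left)
    show "D (r *\<^sub>R v) = r *\<^sub>R D v" for r v
      using D_smult[of "complex_of_real r" v] by (simp add: smult_scaleR scaleR_conv_of_real)
    show "\<exists>K. \<forall>x. norm (D x) \<le> norm x * K"
    proof (intro exI allI)
      fix v
      show "norm (D v) \<le> norm v * (LINT \<xi>|lborel. cmod (g \<xi>) * exp ((norm z + 1) * norm \<xi>))"
        unfolding D_def integral_mult_right_zero[symmetric]
        by (rule Bochner_Integration.integral_norm_bound_integral[OF intD integrable_mult_right[OF int] bD])
    qed
  qed
  moreover have "cmod ((LINT \<xi>|lborel. g \<xi> * exp (cdot (vcomplex \<xi>) y)) - (LINT \<xi>|lborel. g \<xi> * exp (cdot (vcomplex \<xi>) z)) - D (y - z))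
        / norm (y - z) \<le> 2 * K * norm (y - z)"
    if yz: "y \<noteq> z" "dist y z < 1" for y
  proof -
    define h where "h = y - z"
    have h: "norm h \<le> 1" "h \<noteq> 0" using yz by (auto simp: h_def dist_norm)
    have eq: "g \<xi> * exp (cdot (vcomplex \<xi>) y) - E \<xi> - E \<xi> * cdot (vcomplex \<xi>) h
       = E \<xi> * (exp (cdot (vcomplex \<xi>) h) - 1 - cdot (vcomplex \<xi>) h)" for \<xi>
      unfolding E_def h_def by (simp add: cdot_simps exp_diff field_simps)
    have bnd: "cmod (E \<xi> * (exp (cdot (vcomplex \<xi>) h) - 1 - cdot (vcomplex \<xi>) h))
       \<le> 2 * (norm h)\<^sup>2 * (cmod (g \<xi>) * exp ((norm z + 2) * norm \<xi>))" for \<xi>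
    proof -
      define u where "u = cdot (vcomplex \<xi>) h"
      have u: "cmod u \<le> norm \<xi> * norm h" unfolding u_def using norm_cdot_le[of "vcomplex \<xi>" h] by simp
      also have "\<dots> \<le> norm \<xi> * 1" using h by (intro mult_left_mono) auto
      finally have "\<bar>Re u\<bar> \<le> norm \<xi>" using abs_Re_le_cmod[of u] by linarith
      have "cmod (exp u - 1 - u) \<le> exp \<bar>Re u\<bar> * (cmod u)\<^sup>2"
        using Taylor_exp[of u 1] by (simp add: algebra_simps numeral_2_eq_2)
      also have "\<dots> \<le> exp (norm \<xi>) * (norm \<xi> * norm h)\<^sup>2"
        using \<open>\<bar>Re u\<bar> \<le> norm \<xi>\<close> u by (intro mult_mono power_mono) auto
      also have "\<dots> \<le> exp (norm \<xi>) * ((2 * exp (norm \<xi>)) * (norm h)\<^sup>2)"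
        unfolding power_mult_distrib by (intro mult_left_mono mult_right_mono exp2) auto
      finally have "cmod (E \<xi> * (exp u - 1 - u)) \<le> (cmod (g \<xi>) * exp (norm z * norm \<xi>)) * (exp (norm \<xi>) * ((2 * exp (norm \<xi>)) * (norm h)\<^sup>2))"
        unfolding norm_mult by (intro mult_mono bE) auto
      also have "\<dots> = 2 * (norm h)\<^sup>2 * (cmod (g \<xi>) * (exp (norm z * norm \<xi>) * (exp (norm \<xi>) * exp (norm \<xi>))))"
        by (simp only: mult_ac)
      also have "exp (norm z * norm \<xi>) * (exp (norm \<xi>) * exp (norm \<xi>)) = exp ((norm z + 2) * norm \<xi>)"
        by (simp add: exp_add[symmetric] algebra_simps)
      finally show ?thesis unfolding u_def .
    qed
    have "(LINT \<xi>|lborel. g \<xi> * exp (cdot (vcomplex \<xi>) y)) - (LINT \<xi>|lborel. g \<xi> * exp (cdot (vcomplex \<xi>) z)) - D h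
       = (LINT \<xi>|lborel. E \<xi> * (exp (cdot (vcomplex \<xi>) h) - 1 - cdot (vcomplex \<xi>) h))"
      unfolding eq[symmetric] D_def using intE[of y] intE[of z] intD[of h] by (simp add: E_def)
    also have "cmod \<dots> \<le> (LINT \<xi>|lborel. 2 * (norm h)\<^sup>2 * (cmod (g \<xi>) * exp ((norm z + 2) * norm \<xi>)))"
    proof (rule Bochner_Integration.integral_norm_bound_integral[OF _ integrable_mult_right[OF int] bnd])
      show "integrable lborel (\<lambda>\<xi>. E \<xi> * (exp (cdot (vcomplex \<xi>) h) - 1 - cdot (vcomplex \<xi>) h))"
        unfolding eq[symmetric] using intE[of y] intE[of z] intD[of h] by (simp add: E_def)
    qed
    also have "\<dots> = 2 * K * norm h * norm h"
      unfolding K_def by (simp add: power2_eq_square)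
    finally show ?thesis using h unfolding h_def by (simp add: field_simps)
  qed
  moreover have "((\<lambda>y. 2 * K * norm (y - z)) \<longlongrightarrow> 0) (at z)"
    by (auto intro!: tendsto_eq_intros)
  ultimately have "((\<lambda>z. LINT \<xi>|lborel. g \<xi> * exp (cdot (vcomplex \<xi>) z)) has_derivative D) (at z)"
    by (intro has_derivativeI_sandwich[where e=1 and H="\<lambda>y. 2 * K * norm (y - z)"]) auto
  then show "\<exists>D. ((\<lambda>z. LINT \<xi>|lborel. g \<xi> * exp (cdot (vcomplex \<xi>) z)) has_derivative D) (at z)
      \<and> (\<forall>c v. D (c *s v) = c * D v)"
    using D_smult by blast
qed

text \<open>For real \<open>z\<close> this is completing the square; both sides are entire in \<open>z\<close>.\<close>

lemma Laplace_gaussian: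
  fixes z :: "complex ^ 'n"
  assumes a: "a > 0"
  shows "(LINT \<xi>|lborel. exp (- complex_of_real (a * (norm \<xi>)\<^sup>2) + cdot (vcomplex \<xi>) z))
     = complex_of_real (sqrt (pi / a) ^ CARD('n)) * exp (csq z / complex_of_real (4 * a))"
proof -
  define F where "F z = (LINT \<xi>|lborel. exp (- complex_of_real (a * (norm \<xi>)\<^sup>2)) * exp (cdot (vcomplex \<xi>) z))"
    for z :: "complex ^ 'n"
  define G where "G z = complex_of_real (sqrt (pi / a) ^ CARD('n)) * exp (complex_of_real (1 / (4 * a)) * csq z)"
    for z :: "complex ^ 'n"
  have "F z = G z"
  proof (rule entire_eq_if_eq_on_reals)
    show "entire F" unfolding F_def
    proof (rule entire_Laplace)
      fix R
      have "cmod (exp (- complex_of_real (a * (norm \<xi>)\<^sup>2))) * exp (R * norm \<xi>) = exp (R * norm \<xi> - a * (norm \<xi>)\<^sup>2)"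
        for \<xi> :: "real ^ 'n" by (simp add: exp_add[symmetric] Re_power2)
      then show "integrable lborel (\<lambda>\<xi>::real^'n. cmod (exp (- complex_of_real (a * (norm \<xi>)\<^sup>2))) * exp (R * norm \<xi>))"
        using integrable_gaussian_linear[OF a] by simp
    qed measurable
    show "entire G" unfolding G_def by (intro entire_cmult entire_exp entire_csq)
    fix y :: "real ^ 'n"
    define p where "p = (1 / (2 * a)) *\<^sub>R y"
    have h1: "- (a * (norm \<xi>)\<^sup>2) + \<xi> \<bullet> y = - a * (norm (- p + \<xi>))\<^sup>2 + (norm y)\<^sup>2 / (4 * a)" for \<xi>
    proof -
      have "(norm (- p + \<xi>))\<^sup>2 = (norm \<xi>)\<^sup>2 - (1 / a) * (\<xi> \<bullet> y) + (norm y)\<^sup>2 / (4 * a\<^sup>2)"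
        unfolding power2_norm_eq_inner p_def
        by (simp add: inner_diff_left inner_diff_right inner_commute power2_eq_square)
      then show ?thesis using a by (simp only:) (simp add: field_simps power2_eq_square)
    qed
    have e: "exp (- complex_of_real (a * (norm \<xi>)\<^sup>2)) * exp (cdot (vcomplex \<xi>) (vcomplex y))
       = complex_of_real (exp ((norm y)\<^sup>2 / (4 * a)) * exp (- a * (norm (- p + \<xi>))\<^sup>2))" for \<xi>
    proof -
      have "exp (- complex_of_real (a * (norm \<xi>)\<^sup>2)) * exp (cdot (vcomplex \<xi>) (vcomplex y))
        = complex_of_real (exp (- (a * (norm \<xi>)\<^sup>2) + \<xi> \<bullet> y))"
        unfolding cdot_vcomplex exp_add by (simp flip: exp_of_real)
      then show ?thesis unfolding h1 exp_add by (simp only: mult.commute)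
    qed
    have "F (vcomplex y) = complex_of_real (LINT \<xi>|lborel. exp ((norm y)\<^sup>2 / (4 * a)) * exp (- a * (norm (- p + \<xi>))\<^sup>2))"
      unfolding F_def e by (rule integral_complex_of_real)
    also have "(LINT \<xi>|lborel. exp ((norm y)\<^sup>2 / (4 * a)) * exp (- a * (norm (- p + \<xi>))\<^sup>2))
       = exp ((norm y)\<^sup>2 / (4 * a)) * (LINT \<xi>|lborel. exp (- a * (norm (- p + \<xi>))\<^sup>2))"
      by (rule integral_mult_right_zero)
    also have "(LINT \<xi>|lborel. exp (- a * (norm (- p + \<xi>))\<^sup>2)) = (LINT \<xi>|lborel. exp (- a * (norm (\<xi>::real^'n))\<^sup>2))"
      by (rule integral_lborel_translate) measurable
    also have "\<dots> = sqrt (pi / a) ^ CARD('n)"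
      using integral_gaussian[OF a, where 'a="real ^ 'n"] by simp
    finally show "F (vcomplex y) = G (vcomplex y)"
      unfolding G_def csq_vcomplex by (simp add: exp_of_real[symmetric])
  qed
  then show ?thesis unfolding F_def G_def by (simp add: exp_add[symmetric])
qed

section \<open>The Gaussian measure\<close>

lemma space_gauss_measure [simp]: "space gauss_measure = UNIV"
  by (simp add: gauss_measure_def)

lemma sets_gauss_measure [simp, measurable_cong]: "sets gauss_measure = sets borel"
  by (simp add: gauss_measure_def)

lemma borel_measurable_gauss_measure [simp]:
  "borel_measurable (gauss_measure :: (complex ^ 'n) measure) = borel_measurable borel"
  by (rule measurable_cong_sets) auto

lemma integrable_gauss_measure:
  fixes G :: "complex ^ 'n \<Rightarrow> 'b::{banach, second_countable_topology}"
  assumes [measurable]: "G \<in> borel_measurable borel"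
  shows "integrable gauss_measure G \<longleftrightarrow>
     integrable lborel (\<lambda>z. (exp (- (norm z)\<^sup>2 / 2) / (2 * pi) ^ CARD('n)) *\<^sub>R G z)"
  unfolding gauss_measure_def by (subst integrable_density) auto

lemma integral_gauss_measure:
  fixes G :: "complex ^ 'n \<Rightarrow> 'b::{banach, second_countable_topology}"
  assumes [measurable]: "G \<in> borel_measurable borel"
  shows "(LINT z|gauss_measure. G z) =
     (LINT z|lborel. (exp (- (norm z)\<^sup>2 / 2) / (2 * pi) ^ CARD('n)) *\<^sub>R G z)"
  unfolding gauss_measure_def by (subst integral_density) auto

lemma DIM_complex_vec: "DIM(complex ^ 'n) = 2 * CARD('n)"
  by simp

lemma prob_space_gauss_measure: "prob_space (gauss_measure :: (complex ^ 'n) measure)"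
proof
  have "emeasure (gauss_measure :: (complex ^ 'n) measure) (space gauss_measure)
     = (\<integral>\<^sup>+z. ennreal (1 / (2 * pi) ^ CARD('n)) * ennreal (exp (- (1/2) * (norm (z :: complex ^ 'n))\<^sup>2)) \<partial>lborel)"
    unfolding gauss_measure_def by (simp add: emeasure_density ennreal_mult[symmetric])
  also have "\<dots> = ennreal (1 / (2 * pi) ^ CARD('n)) * ennreal (sqrt (pi / (1/2)) ^ DIM(complex ^ 'n))"
    by (subst nn_integral_cmult) (simp_all only: nn_integral_gaussian[of "1/2"], auto)
  also have "sqrt (pi / (1/2)) ^ DIM(complex ^ 'n) = (2 * pi) ^ CARD('n)"
    unfolding DIM_complex_vec power_mult by (simp add: mult.commute)
  finally show "emeasure (gauss_measure :: (complex ^ 'n) measure) (space gauss_measure) = 1"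
    by (simp add: ennreal_mult[symmetric])
qed

lemma integrable_gauss_exp:
  assumes "\<alpha> < 1/2"
  shows "integrable gauss_measure (\<lambda>w :: complex ^ 'n. exp (\<alpha> * (norm w)\<^sup>2 + \<beta> * norm w))"
proof -
  have "integrable lborel (\<lambda>w :: complex ^ 'n. (1 / (2 * pi) ^ CARD('n)) * exp (\<beta> * norm w - (1/2 - \<alpha>) * (norm w)\<^sup>2))"
    using assms by (intro integrable_mult_right integrable_gaussian_linear) auto
  then show ?thesis
    by (subst integrable_gauss_measure) (simp_all add: exp_add[symmetric] algebra_simps)
qed

lemma square_integrable_gauss_bound:
  fixes F :: "complex ^ 'n \<Rightarrow> complex"
  assumes [measurable]: "F \<in> borel_measurable borel" and "\<alpha> < 1/4"
    and F: "\<And>w. cmod (F w) \<le> C * exp (\<alpha> * (norm w)\<^sup>2 + \<beta> * norm w)"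
  shows "square_integrable gauss_measure F"
  unfolding square_integrable_def
proof
  show "integrable gauss_measure (\<lambda>w. (cmod (F w))\<^sup>2)"
  proof (rule Bochner_Integration.integrable_bound)
    show "integrable gauss_measure (\<lambda>w :: complex ^ 'n. C\<^sup>2 * exp (2 * \<alpha> * (norm w)\<^sup>2 + 2 * \<beta> * norm w))"
      using assms by (intro integrable_mult_right integrable_gauss_exp) auto
    have "(cmod (F w))\<^sup>2 \<le> (C * exp (\<alpha> * (norm w)\<^sup>2 + \<beta> * norm w))\<^sup>2" for w
      by (intro power_mono F) auto
    also have "\<dots> w = C\<^sup>2 * exp (2 * \<alpha> * (norm w)\<^sup>2 + 2 * \<beta> * norm w)" for w
      unfolding power_mult_distrib by (simp add: power2_eq_square exp_add[symmetric] algebra_simps)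
    finally show "AE w in gauss_measure. norm ((cmod (F w))\<^sup>2) \<le>
        norm (C\<^sup>2 * exp (2 * \<alpha> * (norm w)\<^sup>2 + 2 * \<beta> * norm w))"
      by simp
  qed measurable
qed simp

section \<open>Unitary scalars preserve Lebesgue measure\<close>

lemma lborel_distr_orthogonal:
  fixes f :: "real ^ 'm::{finite,wellorder} \<Rightarrow> real ^ 'm::_"
  assumes f: "orthogonal_transformation f"
  shows "distr lborel borel f = lborel"
proof (rule lborel_eqI[symmetric])
  have cont: "continuous_on UNIV f"
    using f orthogonal_transformation_linear linear_conv_bounded_linear linear_continuous_on by blast
  then have [measurable]: "f \<in> borel_measurable borel" by (rule borel_measurable_continuous_onI)
  have g: "orthogonal_transformation (inv f)"
    using f by (rule orthogonal_transformation_inv)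
  fix l u :: "real ^ 'm::_" assume le: "\<And>b. b \<in> Basis \<Longrightarrow> l \<bullet> b \<le> u \<bullet> b"
  have vim: "f -` box l u = inv f ` box l u"
    using bij_vimage_eq_inv_image[of f] f orthogonal_transformation_bij by blast
  have bor: "f -` box l u \<in> sets borel"
    using measurable_sets_borel[of f borel "box l u"] by simp
  have lm: "box l u \<in> lmeasurable" by simp
  have "emeasure (distr lborel borel f) (box l u) = emeasure lborel (f -` box l u)"
    by (subst emeasure_distr) auto
  also have "\<dots> = emeasure lebesgue (f -` box l u)" using bor by simp
  also have "\<dots> = ennreal (measure lebesgue (inv f ` box l u))"
    unfolding vim using measurable_orthogonal_image[OF g lm]
    by (simp add: emeasure_eq_measure2 fmeasurableD2)
  also have "\<dots> = ennreal (measure lebesgue (box l u))"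
    using measure_orthogonal_image[OF g lm] by simp
  also have "\<dots> = (\<Prod>b\<in>Basis. (u - l) \<bullet> b)"
    using le by (simp add: measure_completion inner_diff_left)
  finally show "emeasure (distr lborel borel f) (box l u) = (\<Prod>b\<in>Basis. (u - l) \<bullet> b)" .
qed simp

text \<open>Such an isometry relabels the coordinates, so preimages of boxes are boxes with the same side lengths.\<close>

lemma lborel_distr_basis_isometry:
  fixes f :: "'a::euclidean_space \<Rightarrow> 'b::euclidean_space"
  assumes lin: "linear f" and inn: "\<And>x y. f x \<bullet> f y = x \<bullet> y" and bas: "f ` Basis = Basis"
  shows "distr lborel borel f = lborel"
proof (rule lborel_eqI[symmetric])
  have [measurable]: "f \<in> borel_measurable borel"
    using lin by (intro borel_measurable_continuous_onI linear_continuous_on)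
      (simp add: linear_conv_bounded_linear)
  have inj: "inj f"
  proof (rule injI)
    fix x y assume "f x = f y"
    then have "(x - y) \<bullet> (x - y) = 0"
      by (metis inn inner_diff_left inner_diff_right diff_self lin linear_diff inner_zero_left)
    then show "x = y" by simp
  qed
  fix l u :: 'b assume le: "\<And>b. b \<in> Basis \<Longrightarrow> l \<bullet> b \<le> u \<bullet> b"
  define l' where "l' = (\<Sum>b\<in>Basis. (l \<bullet> f b) *\<^sub>R b)"
  define u' where "u' = (\<Sum>b\<in>Basis. (u \<bullet> f b) *\<^sub>R b)"
  have l': "l' \<bullet> b = l \<bullet> f b" and u': "u' \<bullet> b = u \<bullet> f b" if "b \<in> Basis" for b
    using that by (simp_all add: l'_def u'_def inner_sum_left_Basis)
  have vim: "f -` box l u = box l' u'"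
    unfolding box_def bas[symmetric] by (auto simp: inn l' u')
  have "emeasure (distr lborel borel f) (box l u) = emeasure lborel (box l' u')"
    by (subst emeasure_distr) (auto simp: vim)
  also have "\<dots> = (\<Prod>b\<in>Basis. (u' - l') \<bullet> b)"
    using le bas by (subst emeasure_lborel_box) (auto simp: l' u')
  also have "(\<Prod>b\<in>Basis. (u' - l') \<bullet> b) = (\<Prod>b\<in>Basis. (u - l) \<bullet> f b)"
    by (intro prod.cong) (auto simp: inner_diff_left l' u')
  also have "\<dots> = (\<Prod>b\<in>Basis. (u - l) \<bullet> b)"
    using prod.reindex[of f Basis "\<lambda>b. (u - l) \<bullet> b"] inj bas by (simp add: inj_on_subset)
  finally show "emeasure (distr lborel borel f) (box l u) = (\<Prod>b\<in>Basis. (u - l) \<bullet> b)" by simp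
qed simp

text \<open>
  The change of variables theorem for matrices is transported along an orthonormal coordinate
  system; the index type \<open>'m\<close> only serves to name \<open>DIM('a)\<close> coordinates.\<close>

lemma lborel_distr_linear_isometry:
  fixes f :: "'a::euclidean_space \<Rightarrow> 'a"
  assumes lin: "linear f" and nf: "\<And>x. norm (f x) = norm x"
    and card: "CARD('m::{finite,wellorder}) = DIM('a)"
  shows "distr lborel borel f = lborel"
proof -
  obtain h where h: "bij_betw h (Basis :: 'a set) (UNIV :: 'm set)"
    using card finite_same_card_bij[of "Basis :: 'a set" "UNIV :: 'm set"] by auto
  define k where "k = inv_into Basis h"
  have k: "bij_betw k UNIV Basis" unfolding k_def by (rule bij_betw_inv_into[OF h])
  have hk: "h (k i) = i" for i
    unfolding k_def using h by (simp add: bij_betw_inv_into_right)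
  have kh: "k (h b) = b" if "b \<in> Basis" for b
    unfolding k_def using h that by (simp add: bij_betw_inv_into_left)
  have kB: "k i \<in> Basis" for i using k by (auto simp: bij_betw_def)
  define L where "L x = (\<Sum>b\<in>Basis. (x $ h b) *\<^sub>R b)" for x :: "real ^ 'm::_"
  define N where "N z = (\<chi> i. z \<bullet> k i)" for z :: 'a
  have Lb: "L x \<bullet> b = x $ h b" if "b \<in> Basis" for x b
    unfolding L_def using that by (simp add: inner_sum_left_Basis)
  have NL [simp]: "N (L x) = x" for x by (simp add: N_def vec_eq_iff Lb kB hk)
  have LN [simp]: "L (N z) = z" for z
    by (rule euclidean_eqI) (simp add: Lb N_def kh)
  have linL: "linear L"
    by (rule linearI) (simp_all add: L_def scaleR_add_left sum.distrib scaleR_sum_right)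
  have linN: "linear N"
    by (rule linearI) (simp_all add: N_def vec_eq_iff inner_add_left)
  have innL: "L x \<bullet> L y = x \<bullet> y" for x y
  proof -
    have "L x \<bullet> L y = (\<Sum>b\<in>Basis. x $ h b * y $ h b)"
      by (subst euclidean_inner) (simp add: Lb)
    also have "\<dots> = (\<Sum>i\<in>UNIV. x $ i * y $ i)"
      using sum.reindex_bij_betw[OF h, of "\<lambda>i. x $ i * y $ i"] .
    finally show ?thesis by (simp add: inner_vec_def)
  qed
  have Lk: "L (axis i 1) = k i" for i
  proof (rule euclidean_eqI)
    fix b :: 'a assume b: "b \<in> Basis"
    show "L (axis i 1) \<bullet> b = k i \<bullet> b"
      using b kB[of i] kh[OF b] hk[of i] by (auto simp: Lb axis_def inner_Basis)
  qed
  have "(Basis :: (real ^ 'm::_) set) = range (\<lambda>i. axis i 1)" by (auto simp: Basis_vec_def)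
  then have "L ` Basis = range (\<lambda>i. L (axis i 1))" by (metis image_image)
  then have basL: "L ` Basis = Basis"
    unfolding Lk bij_betw_imp_surj_on[OF k] .
  have nL: "norm (L x) = norm x" for x by (simp add: norm_eq_sqrt_inner innL)
  have nN: "norm (N z) = norm z" for z using nL[of "N z"] by simp
  define R where "R = N \<circ> f \<circ> L"
  have "linear R"
    unfolding R_def by (intro linear_compose linL lin linN)
  then have R: "orthogonal_transformation R"
    by (simp add: orthogonal_transformation R_def nL nN nf)
  have L: "distr lborel borel L = lborel"
    by (rule lborel_distr_basis_isometry[OF linL innL basL])
  have [measurable]: "L \<in> borel_measurable borel" "R \<in> borel_measurable borel" "f \<in> borel_measurable borel"
    using linL \<open>linear R\<close> lin
    by (auto intro!: borel_measurable_continuous_onI linear_continuous_on simp: linear_conv_bounded_linear)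
  have "distr lborel borel f = distr (distr lborel borel L) borel f" by (simp add: L)
  also have "\<dots> = distr lborel borel (f \<circ> L)"
    by (rule distr_distr) auto
  also have "f \<circ> L = L \<circ> R" by (auto simp: R_def)
  also have "distr lborel borel (L \<circ> R) = distr (distr lborel borel R) borel L"
    by (rule distr_distr[symmetric]) auto
  also have "\<dots> = lborel" by (simp add: lborel_distr_orthogonal[OF R] L)
  finally show ?thesis .
qed

lemma lborel_distr_unit_smult:
  assumes c: "cmod c = 1"
  shows "distr lborel borel (\<lambda>z :: complex ^ 'n. c *s z) = lborel"
proof (rule lborel_distr_linear_isometry[where 'm="'n bit0"])
  show "linear (\<lambda>z :: complex ^ 'n. c *s z)"
    using bounded_linear_smult by (rule bounded_linear.linear)
qed (simp_all add: c)

lemma gauss_measure_unit_smult: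
  assumes c: "cmod c = 1"
  shows "distr gauss_measure borel (\<lambda>z :: complex ^ 'n. c *s z) = gauss_measure"
proof -
  have "gauss_measure = density (distr lborel borel (\<lambda>z. c *s z))
      (\<lambda>z :: complex ^ 'n. ennreal (exp (- (norm z)\<^sup>2 / 2) / (2 * pi) ^ CARD('n)))"
    by (simp add: lborel_distr_unit_smult[OF c] gauss_measure_def)
  also have "\<dots> = distr gauss_measure borel (\<lambda>z. c *s z)"
    by (subst density_distr) (simp_all add: gauss_measure_def c)
  finally show ?thesis by simp
qed

lemma integrable_gauss_unit_smult:
  fixes G :: "complex ^ 'n \<Rightarrow> 'b::{banach, second_countable_topology}"
  assumes c: "cmod c = 1" and [measurable]: "G \<in> borel_measurable borel"
  shows "integrable gauss_measure (\<lambda>z. G (c *s z)) \<longleftrightarrow> integrable gauss_measure G"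
proof -
  have "integrable (distr gauss_measure borel (\<lambda>z. c *s z)) G \<longleftrightarrow> integrable gauss_measure (\<lambda>z. G (c *s z))"
    by (rule integrable_distr_eq) auto
  then show ?thesis by (simp add: gauss_measure_unit_smult[OF c])
qed

lemma integral_gauss_unit_smult:
  fixes G :: "complex ^ 'n \<Rightarrow> 'b::{banach, second_countable_topology}"
  assumes c: "cmod c = 1" and [measurable]: "G \<in> borel_measurable borel"
  shows "(LINT z|gauss_measure. G (c *s z)) = (LINT z|gauss_measure. G z)"
proof -
  have "(LINT z|distr gauss_measure borel (\<lambda>z. c *s z). G z) = (LINT z|gauss_measure. G (c *s z))"
    by (rule integral_distr) auto
  then show ?thesis by (simp add: gauss_measure_unit_smult[OF c])
qed

section \<open>Mean values and the reproducing kernel\<close>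

text \<open>This is Cauchy's integral formula at the centre of the unit circle.\<close>

lemma circle_mean_value:
  assumes g: "g holomorphic_on UNIV"
  shows "(LINT t|restrict_space lborel {0..1}. g (exp (2 * of_real pi * \<i> * of_real t))) = g 0"
proof -
  define h where "h t = g (exp (2 * of_real pi * \<i> * of_real t))" for t :: real
  have cont: "continuous_on {0..1} h"
    unfolding h_def
    by (intro continuous_on_compose2[OF holomorphic_on_imp_continuous_on[OF g]] continuous_intros) auto
  have "((\<lambda>w. g w / (w - 0)) has_contour_integral (2 * of_real pi * \<i> * g 0)) (circlepath 0 1)"
    by (rule Cauchy_integral_circlepath_simple) (use g holomorphic_on_subset in auto)
  then have "((\<lambda>t. 2 * of_real pi * \<i> * h t) has_integral (2 * of_real pi * \<i> * g 0)) {0..1}"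
    unfolding has_contour_integral_def
  proof (rule has_integral_eq[rotated])
    fix t :: real assume t: "t \<in> {0..1}"
    have vd: "vector_derivative (circlepath 0 1) (at t within {0..1})
        = 2 * of_real pi * \<i> * exp (2 * of_real pi * \<i> * of_real t)"
      using t by (subst vector_derivative_circlepath01) auto
    show "g (circlepath 0 1 t) / (circlepath 0 1 t - 0) * vector_derivative (circlepath 0 1) (at t within {0..1})
        = 2 * of_real pi * \<i> * h t"
      unfolding vd by (simp add: circlepath h_def)
  qed
  from has_integral_mult_right[OF this, of "1 / (2 * of_real pi * \<i>)"]
  have "(h has_integral g 0) {0..1}" by simp
  moreover have "set_integrable lborel {0..1} h"
    using cont by (rule borel_integrable_atLeastAtMost')
  ultimately have "(LINT t:{0..1}|lborel. h t) = g 0"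
    by (metis set_borel_integral_eq_integral(2) integral_unique)
  then show ?thesis
    unfolding h_def by (subst integral_restrict_space) (auto simp: set_lebesgue_integral_def)
qed

text \<open>
  Averaging the integral over the rotations \<open>z \<mapsto> exp (2 * pi * \<i> * t) *s z\<close>, which preserve the Gaussian
  measure, and exchanging the integrals reduces the mean value property to that on complex lines.\<close>

lemma gauss_mean_value:
  fixes G :: "complex ^ 'n \<Rightarrow> complex"
  assumes G: "entire G" and int: "integrable gauss_measure G"
  shows "(LINT z|gauss_measure. G z) = G 0"
proof -
  define \<Theta> where "\<Theta> = restrict_space (lborel :: real measure) {0..1}"
  define e where "e t = exp (2 * of_real pi * \<i> * of_real t)" for t :: real
  have e: "cmod (e t) = 1" for t unfolding e_def by simp
  have [measurable]: "G \<in> borel_measurable borel" using G by (rule entire_measurable)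
  interpret \<Theta>: finite_measure \<Theta>
    by standard (simp add: \<Theta>_def emeasure_restrict_space)
  interpret g: prob_space "gauss_measure :: (complex ^ 'n) measure" by (rule prob_space_gauss_measure)
  interpret pair_sigma_finite \<Theta> "gauss_measure :: (complex ^ 'n) measure" ..
  have "continuous_on UNIV (\<lambda>(t, z). G (e t *s z))"
    unfolding e_def split_beta vector_scalar_mult_def
    by (intro continuous_on_compose2[OF entire_continuous_on[OF G, of UNIV]] continuous_intros) auto
  then have "(\<lambda>(t, z). G (e t *s z)) \<in> borel_measurable (borel :: (real \<times> (complex ^ 'n)) measure)"
    by (rule borel_measurable_continuous_onI)
  then have m0: "(\<lambda>(t, z). G (e t *s z)) \<in> borel_measurable (borel \<Otimes>\<^sub>M borel)"
    unfolding borel_prod .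
  have m: "(\<lambda>(t, z). G (e t *s z)) \<in> borel_measurable (\<Theta> \<Otimes>\<^sub>M gauss_measure)"
  proof -
    have "(\<lambda>p. (fst p, snd p)) \<in> \<Theta> \<Otimes>\<^sub>M gauss_measure \<rightarrow>\<^sub>M borel \<Otimes>\<^sub>M (borel :: (complex ^ 'n) measure)"
      by (intro measurable_Pair measurable_compose[OF measurable_fst] measurable_compose[OF measurable_snd])
        (auto simp: \<Theta>_def intro: measurable_restrict_space1 cong: measurable_cong_sets)
    from measurable_compose[OF this m0] show ?thesis by (simp add: split_beta)
  qed
  have int2: "integrable (\<Theta> \<Otimes>\<^sub>M gauss_measure) (\<lambda>(t, z). G (e t *s z))"
  proof (rule Fubini_integrable[OF m])
    show "AE t in \<Theta>. integrable gauss_measure (\<lambda>z. (\<lambda>(t, z). G (e t *s z)) (t, z))"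
      using int by (simp add: integrable_gauss_unit_smult e)
    have "(LINT z|gauss_measure. norm (G (e t *s z))) = (LINT z|gauss_measure. norm (G z))" for t
      by (rule integral_gauss_unit_smult[OF e]) measurable
    then show "integrable \<Theta> (\<lambda>t. LINT z|gauss_measure. norm ((\<lambda>(t, z). G (e t *s z)) (t, z)))"
      by simp
  qed
  have "(LINT z|gauss_measure. G z) = (LINT t|\<Theta>. LINT z|gauss_measure. G (e t *s z))"
  proof -
    have "measure \<Theta> (space \<Theta>) = 1" by (simp add: \<Theta>_def measure_restrict_space)
    then show ?thesis by (simp add: integral_gauss_unit_smult e)
  qed
  also have "\<dots> = (LINT z|gauss_measure. LINT t|\<Theta>. G (e t *s z))"
    using Fubini_integral[OF int2] by simp
  also have "\<dots> = (LINT z|(gauss_measure :: (complex ^ 'n) measure). G 0)"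
    using circle_mean_value[OF entire_holomorphic_on_line[OF G, of 0]] by (simp add: \<Theta>_def e_def)
  also have "\<dots> = G 0" using g.prob_space by simp
  finally show ?thesis .
qed

text \<open>
  Translating the measure to \<open>z\<close> turns the kernel into a factor holomorphic in the integration
  variable and equal to 1 at the centre, so the mean value property applies.\<close>

lemma reproducing_kernel:
  fixes F :: "complex ^ 'n \<Rightarrow> complex"
  assumes F: "entire F" and int: "integrable gauss_measure (\<lambda>w. F w * exp (cdot z (vcnj w) / 2))"
  shows "(LINT w|gauss_measure. F w * exp (cdot z (vcnj w) / 2)) = F z"
proof -
  define G where "G u = F (z + u) * exp (- cdot u (vcnj z) / 2)" for u
  have G: "entire G"
    unfolding G_def using entire_affine[OF F, of z 1]
    by (intro entire_mult entire_exp) (auto intro!: entire_cmult[of "\<lambda>u. cdot u (vcnj z)" "-1/2", simplified] entire_cdot)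
  have [measurable]: "F \<in> borel_measurable borel" "G \<in> borel_measurable borel"
    using F G by (auto intro: entire_measurable)
  define \<rho> where "\<rho> w = exp (- (norm w)\<^sup>2 / 2) / (2 * pi) ^ CARD('n)" for w :: "complex ^ 'n"
  have [measurable]: "\<rho> \<in> borel_measurable borel" unfolding \<rho>_def by measurable
  have key: "\<rho> (z + u) *\<^sub>R (F (z + u) * exp (cdot z (vcnj (z + u)) / 2)) = \<rho> u *\<^sub>R G u" for u
  proof -
    have n: "complex_of_real ((norm (z + u))\<^sup>2) = complex_of_real ((norm z)\<^sup>2) + cdot z (vcnj u) + cdot u (vcnj z) + complex_of_real ((norm u)\<^sup>2)"
      unfolding cdot_vcnj_self[symmetric] by (simp add: cdot_simps)
    have "complex_of_real (exp (- (norm (z + u))\<^sup>2 / 2)) * exp (cdot z (vcnj (z + u)) / 2)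
       = exp (- complex_of_real ((norm (z + u))\<^sup>2) / 2 + cdot z (vcnj (z + u)) / 2)"
      unfolding exp_add exp_of_real[symmetric] by simp
    also have "\<dots> = exp (- complex_of_real ((norm u)\<^sup>2) / 2 + (- cdot u (vcnj z) / 2))"
      unfolding n vcnj_simps cdot_simps cdot_vcnj_self by (rule arg_cong[where f=exp]) (simp add: field_simps)
    also have "\<dots> = complex_of_real (exp (- (norm u)\<^sup>2 / 2)) * exp (- cdot u (vcnj z) / 2)"
      unfolding exp_add exp_of_real[symmetric] by simp
    finally show ?thesis
      unfolding \<rho>_def G_def scaleR_conv_of_real by (simp add: mult_ac)
  qed
  have mF [measurable]: "(\<lambda>w. \<rho> w *\<^sub>R (F w * exp (cdot z (vcnj w) / 2))) \<in> borel_measurable borel"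
    by measurable
  have "integrable gauss_measure G"
    using int integrable_lborel_translate[OF mF, of z]
    unfolding key by (simp add: integrable_gauss_measure \<rho>_def)
  have "(LINT w|gauss_measure. F w * exp (cdot z (vcnj w) / 2))
      = (LINT w|lborel. \<rho> w *\<^sub>R (F w * exp (cdot z (vcnj w) / 2)))"
    by (simp add: integral_gauss_measure \<rho>_def)
  also have "\<dots> = (LINT u|lborel. \<rho> u *\<^sub>R G u)"
    unfolding integral_lborel_translate[OF mF, of z, symmetric] key ..
  also have "\<dots> = (LINT u|gauss_measure. G u)" by (simp add: integral_gauss_measure \<rho>_def)
  also have "\<dots> = G 0" by (rule gauss_mean_value[OF G]) fact
  finally show ?thesis by (simp add: G_def cdot_simps)
qed

lemma norm_exp_kernel_le: "cmod (exp (cdot z (vcnj w) / 2)) \<le> exp ((norm z / 2) * norm w)"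
proof -
  have "z \<bullet> w \<le> norm z * norm w" by (rule norm_cauchy_schwarz)
  then show ?thesis by (simp add: Re_cdot_vcnj)
qed

lemma square_integrable_kernel:
  "square_integrable gauss_measure (\<lambda>w. exp (cdot z (vcnj w) / 2))"
  by (rule square_integrable_gauss_bound[where \<alpha>=0 and C=1 and \<beta>="norm z / 2"])
    (use norm_exp_kernel_le[of z] in auto)

lemma cnj_exp_kernel: "cnj (exp (cdot w (vcnj z) / 2)) = exp (cdot z (vcnj w) / 2)"
  by (simp add: exp_cnj cnj_cdot cdot_commute[of z])

text \<open>The kernel is entire in its other variable, so the reproducing property computes its own norm.\<close>

lemma integral_norm_kernel:
  "norm_sq gauss_measure (\<lambda>w. exp (cdot z (vcnj w) / 2)) = exp ((norm z)\<^sup>2 / 2)"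
proof -
  have e: "entire (\<lambda>w. exp (cdot w (vcnj z) / 2))"
    using entire_exp[OF entire_cmult[OF entire_cdot, of "1/2" "vcnj z"]] by simp
  have eq: "complex_of_real ((cmod (exp (cdot z (vcnj w) / 2)))\<^sup>2)
      = exp (cdot w (vcnj z) / 2) * exp (cdot z (vcnj w) / 2)" for w
    unfolding complex_norm_square cnj_exp_kernel by (rule mult.commute)
  have "complex_of_real (norm_sq gauss_measure (\<lambda>w. exp (cdot z (vcnj w) / 2)))
     = (LINT w|gauss_measure. exp (cdot w (vcnj z) / 2) * exp (cdot z (vcnj w) / 2))"
    unfolding integral_complex_of_real[symmetric] eq ..
  also have "\<dots> = exp (cdot z (vcnj z) / 2)"
  proof (rule reproducing_kernel[OF e])
    show "integrable gauss_measure (\<lambda>w. exp (cdot w (vcnj z) / 2) * exp (cdot z (vcnj w) / 2))"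
      unfolding eq[symmetric] complex_of_real_integrable_eq
      using square_integrable_kernel[of z] by (simp add: square_integrable_def)
  qed
  also have "\<dots> = complex_of_real (exp ((norm z)\<^sup>2 / 2))"
    unfolding cdot_vcnj_self exp_of_real[symmetric] by simp
  finally show ?thesis using of_real_eq_iff by blast
qed

lemma fock_spaceD:
  assumes "F \<in> fock_space"
  shows "entire F" "square_integrable gauss_measure F"
  using assms by (auto simp: fock_space_def square_integrable_def entire_measurable)

lemma fock_spaceI: "entire F \<Longrightarrow> square_integrable gauss_measure F \<Longrightarrow> F \<in> fock_space"
  by (simp add: fock_space_def square_integrable_def)

lemma fock_norm_sq: "(fock_norm F)\<^sup>2 = norm_sq gauss_measure F"
  by (simp add: fock_norm_def integral_nonneg_AE)

lemma fock_norm_nonneg: "fock_norm F \<ge> 0"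
  by (simp add: fock_norm_def integral_nonneg_AE)

lemma fock_reproducing:
  assumes "F \<in> fock_space"
  shows "(LINT w|gauss_measure. F w * exp (cdot z (vcnj w) / 2)) = F z"
  using fock_spaceD[OF assms]
  by (intro reproducing_kernel square_integrable_mult_integrable square_integrable_kernel)

lemma fock_pointwise_bound:
  assumes "F \<in> fock_space"
  shows "cmod (F z) \<le> fock_norm F * exp ((norm z)\<^sup>2 / 4)"
proof (rule power2_le_imp_le)
  have "(cmod (F z))\<^sup>2 \<le> (fock_norm F)\<^sup>2 * exp ((norm z)\<^sup>2 / 2)"
    using Cauchy_Schwarz_integral[OF fock_spaceD(2)[OF assms] square_integrable_kernel, of z]
    unfolding fock_reproducing[OF assms] integral_norm_kernel fock_norm_sq .
  then show "(cmod (F z))\<^sup>2 \<le> (fock_norm F * exp ((norm z)\<^sup>2 / 4))\<^sup>2"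
    by (simp add: power_mult_distrib exp_double[symmetric])
qed (simp add: fock_norm_nonneg)

section \<open>Exchanging integrals and limits\<close>

lemma cnj_integral: "cnj (LINT x|M. f x) = (LINT x|M. cnj (f x))"
  by simp

lemma integrable_pair_dominated:
  fixes h :: "'a \<times> 'b \<Rightarrow> 'c::{banach, second_countable_topology}"
  assumes "sigma_finite_measure M" "sigma_finite_measure N"
    and f: "integrable M f" and g: "integrable N g"
    and h: "h \<in> borel_measurable (M \<Otimes>\<^sub>M N)" and le: "\<And>x y. norm (h (x, y)) \<le> f x * g y"
  shows "integrable (M \<Otimes>\<^sub>M N) h"
proof -
  interpret M: sigma_finite_measure M by fact
  interpret N: sigma_finite_measure N by fact
  interpret pair_sigma_finite M N ..
  have [measurable]: "f \<in> borel_measurable M" "g \<in> borel_measurable N" using f g by auto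
  have "integrable (M \<Otimes>\<^sub>M N) (\<lambda>(x, y). f x * g y :: real)"
  proof (rule Fubini_integrable)
    show "integrable M (\<lambda>x. LINT y|N. norm ((\<lambda>(x, y). f x * g y) (x, y)))"
      using f by (simp add: abs_mult)
    show "AE x in M. integrable N (\<lambda>y. (\<lambda>(x, y). f x * g y) (x, y))"
      using g by simp
  qed measurable
  then show ?thesis
  proof (rule Bochner_Integration.integrable_bound[OF _ h])
    show "AE p in M \<Otimes>\<^sub>M N. norm (h p) \<le> norm ((\<lambda>(x, y). f x * g y) p)"
      using le by (intro AE_I2) (auto simp: split_beta intro: order_trans[OF _ abs_ge_self])
  qed
qed

lemma integral_exchange_dominated:
  fixes h :: "'a \<Rightarrow> 'b \<Rightarrow> 'c::{banach, second_countable_topology}"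
  assumes M: "sigma_finite_measure M" and N: "sigma_finite_measure N"
    and "integrable M f" "integrable N g"
    and "(\<lambda>(x, y). h x y) \<in> borel_measurable (M \<Otimes>\<^sub>M N)" and "\<And>x y. norm (h x y) \<le> f x * g y"
  shows "(LINT x|M. LINT y|N. h x y) = (LINT y|N. LINT x|M. h x y)"
proof -
  interpret M: sigma_finite_measure M by fact
  interpret N: sigma_finite_measure N by fact
  interpret pair_sigma_finite M N ..
  have "integrable (M \<Otimes>\<^sub>M N) (\<lambda>(x, y). h x y)"
    by (rule integrable_pair_dominated[OF assms(1-5)]) (use assms(6) in auto)
  from Fubini_integral[OF this] show ?thesis by simp
qed

lemma square_integrable_Fatou:
  assumes f: "\<And>k. square_integrable M (f k)" and C: "\<And>k. norm_sq M (f k) \<le> C"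
    and lim: "\<And>x. (\<lambda>k. f k x) \<longlonglongrightarrow> g x" and g [measurable]: "g \<in> borel_measurable M"
  shows "square_integrable M g" "norm_sq M g \<le> C"
proof -
  have [measurable]: "f k \<in> borel_measurable M" for k using f by measurable
  have C0: "C \<ge> 0" by (rule order_trans[OF _ C[of 0]]) (simp add: integral_nonneg_AE)
  have "(\<integral>\<^sup>+x. ennreal ((cmod (g x))\<^sup>2) \<partial>M) = (\<integral>\<^sup>+x. liminf (\<lambda>k. ennreal ((cmod (f k x))\<^sup>2)) \<partial>M)"
  proof (rule nn_integral_cong)
    fix x
    have "(\<lambda>k. ennreal ((cmod (f k x))\<^sup>2)) \<longlonglongrightarrow> ennreal ((cmod (g x))\<^sup>2)"
      by (intro tendsto_ennrealI tendsto_power tendsto_norm lim)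
    then show "ennreal ((cmod (g x))\<^sup>2) = liminf (\<lambda>k. ennreal ((cmod (f k x))\<^sup>2))"
      by (metis lim_imp_Liminf trivial_limit_sequentially)
  qed
  also have "\<dots> \<le> liminf (\<lambda>k. \<integral>\<^sup>+x. ennreal ((cmod (f k x))\<^sup>2) \<partial>M)"
    by (rule nn_integral_liminf) measurable
  also have "\<dots> \<le> ennreal C"
  proof (rule Liminf_le)
    show "\<forall>\<^sub>F k in sequentially. (\<integral>\<^sup>+x. ennreal ((cmod (f k x))\<^sup>2) \<partial>M) \<le> ennreal C"
      using C f by (simp add: nn_integral_eq_integral square_integrable_def ennreal_leI)
  qed simp
  finally have le: "(\<integral>\<^sup>+x. ennreal ((cmod (g x))\<^sup>2) \<partial>M) \<le> ennreal C" .
  then have int: "integrable M (\<lambda>x. (cmod (g x))\<^sup>2)"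
    by (intro integrableI_nonneg) (auto simp: order_le_less_trans[OF _ ennreal_less_top])
  then show "square_integrable M g" by (simp add: square_integrable_def)
  have "ennreal (norm_sq M g) \<le> ennreal C"
    using le by (simp add: nn_integral_eq_integral[OF int])
  then show "norm_sq M g \<le> C" using C0 by simp
qed

section \<open>The Bargmann transform\<close>

definition bkernel :: "complex ^ 'n \<Rightarrow> real ^ 'n \<Rightarrow> complex" where
  "bkernel z \<xi> = exp (- complex_of_real ((norm \<xi>)\<^sup>2 / 2) + cdot (vcomplex \<xi>) z - csq z / 4)"

text \<open>The usual normalising constant is left out: this is the square root of \<open>sqrt pi ^ CARD('n)\<close> times the unitary
  Bargmann transform.\<close>

definition bargmann :: "(real ^ 'n \<Rightarrow> complex) \<Rightarrow> complex ^ 'n \<Rightarrow> complex" where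
  "bargmann u z = (LINT \<xi>|lborel. u \<xi> * bkernel z \<xi>)"

definition bargmann_adj :: "(complex ^ 'n \<Rightarrow> complex) \<Rightarrow> real ^ 'n \<Rightarrow> complex" where
  "bargmann_adj G \<xi> = (LINT w|gauss_measure. G w * cnj (bkernel w \<xi>))"

lemma measurable_bkernel [measurable (raw)]:
  assumes [measurable]: "f \<in> borel_measurable M" "g \<in> borel_measurable M"
  shows "(\<lambda>x. bkernel (f x) (g x)) \<in> borel_measurable M"
  unfolding bkernel_def by measurable

lemma norm_bkernel_le:
  "cmod (bkernel z \<xi>) \<le> exp ((norm z)\<^sup>2 / 4) * exp (norm z * norm \<xi> - (1/2) * (norm \<xi>)\<^sup>2)"
proof -
  have "\<bar>Re (cdot (vcomplex \<xi>) z)\<bar> \<le> norm \<xi> * norm z"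
    using abs_Re_le_cmod norm_cdot_le[of "vcomplex \<xi>" z] by (metis norm_vcomplex order_trans)
  moreover have "\<bar>Re (csq z)\<bar> \<le> (norm z)\<^sup>2"
    using abs_Re_le_cmod norm_csq_le order_trans by blast
  ultimately have "Re (- complex_of_real ((norm \<xi>)\<^sup>2 / 2) + cdot (vcomplex \<xi>) z - csq z / 4)
      \<le> (norm z)\<^sup>2 / 4 + (norm z * norm \<xi> - (1/2) * (norm \<xi>)\<^sup>2)"
    by (simp add: mult.commute del: of_real_divide of_real_power)
  then show ?thesis unfolding bkernel_def exp_add[symmetric] by simp
qed

lemma square_integrable_gaussian_bound:
  fixes u :: "real ^ 'n \<Rightarrow> complex"
  assumes "u \<in> borel_measurable borel" and "a > 0"
    and "\<And>\<xi>. cmod (u \<xi>) \<le> C * exp (R * norm \<xi> - a * (norm \<xi>)\<^sup>2)"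
  shows "square_integrable lborel u"
proof (rule square_integrable_bound[where g="\<lambda>\<xi>. complex_of_real (exp (R * norm \<xi> - a * (norm \<xi>)\<^sup>2))"])
  have "(cmod (complex_of_real (exp (R * norm \<xi> - a * (norm \<xi>)\<^sup>2))))\<^sup>2
      = exp ((2 * R) * norm \<xi> - (2 * a) * (norm \<xi>)\<^sup>2)" for \<xi> :: "real ^ 'n"
    by (simp add: exp_double[symmetric] algebra_simps)
  then show "square_integrable lborel (\<lambda>\<xi>::real^'n. complex_of_real (exp (R * norm \<xi> - a * (norm \<xi>)\<^sup>2)))"
    unfolding square_integrable_def using integrable_gaussian_linear[of "2 * a" "2 * R"] assms(2)
    by (simp del: norm_of_real)
qed (use assms in auto)

lemma square_integrable_bkernel: "square_integrable lborel (bkernel z)"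
  by (rule square_integrable_gaussian_bound[OF _ _ norm_bkernel_le]) auto

lemma integrable_bargmann:
  "square_integrable lborel u \<Longrightarrow> integrable lborel (\<lambda>\<xi>. u \<xi> * bkernel z \<xi>)"
  by (intro square_integrable_mult_integrable square_integrable_bkernel)

text \<open>
  All terms that involve only \<open>z\<close> or only \<open>w\<close> agree on both sides; the mixed term of the square cancels
  against the exponent of the reproducing kernel.\<close>

lemma bkernel_mult_cnj:
  "bkernel z \<xi> * cnj (bkernel w \<xi>)
     = exp (- csq (vcomplex \<xi> - (1/2) *s (z + vcnj w))) * exp (cdot z (vcnj w) / 2)"
proof -
  have "bkernel z \<xi> * cnj (bkernel w \<xi>)
     = exp (- complex_of_real ((norm \<xi>)\<^sup>2) + cdot (vcomplex \<xi>) (z + vcnj w) - (csq z + csq (vcnj w)) / 4)"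
    unfolding bkernel_def exp_cnj exp_add[symmetric]
    by (rule arg_cong[where f=exp]) (simp add: cnj_cdot cnj_csq cdot_simps field_simps)
  also have "\<dots> = exp (- csq (vcomplex \<xi> - (1/2) *s (z + vcnj w)) + cdot z (vcnj w) / 2)"
    by (rule arg_cong[where f=exp])
      (simp add: csq_diff csq_smult csq_add csq_vcomplex cdot_simps field_simps power2_eq_square)
  finally show ?thesis unfolding exp_add .
qed

lemma bkernel_0: "bkernel 0 \<xi> = complex_of_real (exp (- (norm \<xi>)\<^sup>2 / 2))"
  by (simp add: bkernel_def cdot_simps csq_def flip: exp_of_real)

lemma exp_csq_eq_bkernel:
  "exp (- csq (vcomplex \<xi> - (1/2) *s z)) = complex_of_real (exp (- (norm \<xi>)\<^sup>2 / 2)) * bkernel z \<xi>"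
  using bkernel_mult_cnj[of z \<xi> 0] by (simp add: bkernel_0 cdot_simps mult.commute)

lemma integral_bkernel_mult_cnj:
  fixes z w :: "complex ^ 'n"
  shows "(LINT \<xi>|lborel. bkernel z \<xi> * cnj (bkernel w \<xi>))
     = complex_of_real (sqrt pi ^ CARD('n)) * exp (cdot z (vcnj w) / 2)"
proof -
  define y where "y = z + vcnj w"
  have e: "bkernel z \<xi> * cnj (bkernel w \<xi>)
      = exp (- complex_of_real (1 * (norm \<xi>)\<^sup>2) + cdot (vcomplex \<xi>) y) * (exp (- csq y / 4) * exp (cdot z (vcnj w) / 2))"
    for \<xi> :: "real ^ 'n"
    unfolding bkernel_mult_cnj y_def[symmetric] mult.assoc[symmetric] exp_add[symmetric]
    by (rule arg_cong[where f=exp])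
      (simp add: csq_diff csq_smult csq_vcomplex cdot_simps field_simps power2_eq_square)
  have "(LINT \<xi>|lborel. bkernel z \<xi> * cnj (bkernel w \<xi>))
      = complex_of_real (sqrt (pi / 1) ^ CARD('n)) * exp (csq y / complex_of_real (4 * 1)) * (exp (- csq y / 4) * exp (cdot z (vcnj w) / 2))"
    unfolding e integral_mult_left_zero Laplace_gaussian[OF zero_less_one] ..
  also have "\<dots> = complex_of_real (sqrt pi ^ CARD('n)) * exp (cdot z (vcnj w) / 2)"
    by (simp add: exp_minus)
  finally show ?thesis .
qed

lemma entire_bargmann:
  fixes u :: "real ^ 'n \<Rightarrow> complex"
  assumes u: "square_integrable lborel u"
  shows "entire (bargmann u)"
proof -
  have [measurable]: "u \<in> borel_measurable borel" using u by (simp add: square_integrable_def)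
  define g where "g \<xi> = u \<xi> * complex_of_real (exp (- (norm \<xi>)\<^sup>2 / 2))" for \<xi>
  have [measurable]: "g \<in> borel_measurable borel" unfolding g_def by measurable
  have "entire (\<lambda>z. LINT \<xi>|lborel. g \<xi> * exp (cdot (vcomplex \<xi>) z))"
  proof (rule entire_Laplace)
    fix R
    have "square_integrable lborel (\<lambda>\<xi> :: real ^ 'n. complex_of_real (exp (R * norm \<xi> - (1/2) * (norm \<xi>)\<^sup>2)))"
      by (rule square_integrable_gaussian_bound[where C=1 and a="1/2" and R=R]) auto
    note int = integrable_norm[OF square_integrable_mult_integrable[OF u this]]
    have "cmod (g \<xi>) * exp (R * norm \<xi>)
        = cmod (u \<xi> * complex_of_real (exp (R * norm \<xi> - (1/2) * (norm \<xi>)\<^sup>2)))" for \<xi>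
      by (simp add: g_def norm_mult mult.assoc exp_add[symmetric] add.commute)
    then show "integrable lborel (\<lambda>\<xi>. cmod (g \<xi>) * exp (R * norm \<xi>))" using int by simp
  qed measurable
  then have "entire (\<lambda>z. exp (- (1/4) * csq z) * (LINT \<xi>|lborel. g \<xi> * exp (cdot (vcomplex \<xi>) z)))"
    by (intro entire_mult entire_exp entire_cmult entire_csq)
  moreover have "bargmann u z = exp (- (1/4) * csq z) * (LINT \<xi>|lborel. g \<xi> * exp (cdot (vcomplex \<xi>) z))" for z
  proof -
    have "u \<xi> * bkernel z \<xi> = exp (- (1/4) * csq z) * (g \<xi> * exp (cdot (vcomplex \<xi>) z))" for \<xi>
    proof -
      have "bkernel z \<xi> = complex_of_real (exp (- (norm \<xi>)\<^sup>2 / 2)) * exp (cdot (vcomplex \<xi>) z) * exp (- (1/4) * csq z)"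
        unfolding bkernel_def exp_of_real[symmetric] exp_add[symmetric] by (rule arg_cong[where f=exp]) simp
      then show ?thesis by (simp only: g_def mult_ac)
    qed
    then show ?thesis unfolding bargmann_def by simp
  qed
  then have "bargmann u = (\<lambda>z. exp (- (1/4) * csq z) * (LINT \<xi>|lborel. g \<xi> * exp (cdot (vcomplex \<xi>) z)))"
    by (rule ext)
  ultimately show ?thesis by (simp only:)
qed

lemma cnj_bargmann: "cnj (bargmann u z) = (LINT \<xi>|lborel. cnj (u \<xi>) * cnj (bkernel z \<xi>))"
  unfolding bargmann_def cnj_integral complex_cnj_mult ..

lemma bargmann_bkernel_cnj:
  fixes z w :: "complex ^ 'n"
  shows "cnj (bargmann (\<lambda>\<xi>. cnj (bkernel z \<xi>)) w) = complex_of_real (sqrt pi ^ CARD('n)) * exp (cdot z (vcnj w) / 2)"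
  unfolding cnj_bargmann integral_bkernel_mult_cnj[symmetric] complex_cnj_cnj ..

lemma bargmann_pointwise_bound:
  fixes u :: "real ^ 'n \<Rightarrow> complex"
  assumes u: "square_integrable lborel u"
  shows "(cmod (bargmann u z))\<^sup>2
    \<le> norm_sq lborel u * (sqrt pi ^ CARD('n) * exp ((norm z)\<^sup>2 / 2))"
proof -
  have "complex_of_real (norm_sq lborel (bkernel z))
      = (LINT \<xi>|lborel. bkernel z \<xi> * cnj (bkernel z \<xi>))"
    unfolding complex_norm_square[symmetric] by (rule integral_complex_of_real[symmetric])
  also have "\<dots> = complex_of_real (sqrt pi ^ CARD('n) * exp ((norm z)\<^sup>2 / 2))"
    unfolding integral_bkernel_mult_cnj cdot_vcnj_self by (simp flip: exp_of_real)
  finally have "norm_sq lborel (bkernel z) = sqrt pi ^ CARD('n) * exp ((norm z)\<^sup>2 / 2)"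
    using of_real_eq_iff by blast
  with Cauchy_Schwarz_integral[OF u square_integrable_bkernel, of z]
  show ?thesis by (simp add: bargmann_def)
qed

subsection \<open>The adjoint on compactly supported functions\<close>

text \<open>For these functions every integral below converges absolutely, as the kernels are bounded by a fixed
  integrable function of the other variable on the support.\<close>

locale compactly_supported =
  fixes G :: "complex ^ 'n \<Rightarrow> complex" and R :: real
  assumes sqG: "square_integrable gauss_measure G" and R0: "R \<ge> 0"
    and supp: "\<And>w. norm w > R \<Longrightarrow> G w = 0"
begin

lemma measurable_G [measurable]: "G \<in> borel_measurable borel"
  using sqG by (simp add: square_integrable_def)

lemma integrable_G: "integrable gauss_measure (\<lambda>w. cmod (G w))"
proof -
  interpret prob_space "gauss_measure :: (complex ^ 'n) measure" by (rule prob_space_gauss_measure)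
  have "square_integrable gauss_measure (\<lambda>w :: complex ^ 'n. 1)" by (simp add: square_integrable_def)
  from integrable_norm[OF square_integrable_mult_integrable[OF sqG this]] show ?thesis by simp
qed

lemma bkernel_bound:
  "cmod (G w) * cmod (bkernel w \<xi>) \<le> cmod (G w) * (exp (R\<^sup>2 / 4) * exp (R * norm \<xi> - (1/2) * (norm \<xi>)\<^sup>2))"
proof (cases "norm w > R")
  case False
  then have "exp ((norm w)\<^sup>2 / 4) * exp (norm w * norm \<xi> - (1/2) * (norm \<xi>)\<^sup>2)
      \<le> exp (R\<^sup>2 / 4) * exp (R * norm \<xi> - (1/2) * (norm \<xi>)\<^sup>2)"
    by (intro mult_mono) (auto intro!: mult_right_mono power_mono)
  with norm_bkernel_le[of w \<xi>] show ?thesis by (intro mult_left_mono) (auto intro: order_trans)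
qed (simp add: supp)

lemma exp_kernel_bound:
  "cmod (G w) * cmod (exp (cdot z (vcnj w) / 2)) \<le> cmod (G w) * exp ((R / 2) * norm z)"
proof (cases "norm w > R")
  case False
  have "(norm z / 2) * norm w \<le> (R / 2) * norm z"
    using False by (simp add: mult.commute mult_right_mono)
  then show ?thesis using norm_exp_kernel_le[of z w] by (intro mult_left_mono) (auto intro: order_trans)
qed (simp add: supp)

lemma bargmann_duality:
  assumes u: "square_integrable lborel u"
  shows "(LINT w|gauss_measure. G w * cnj (bargmann u w)) = (LINT \<xi>|lborel. bargmann_adj G \<xi> * cnj (u \<xi>))"
proof -
  have [measurable]: "u \<in> borel_measurable borel" using u by (simp add: square_integrable_def)
  interpret g: prob_space "gauss_measure :: (complex ^ 'n) measure" by (rule prob_space_gauss_measure)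
  have "square_integrable lborel (\<lambda>\<xi> :: real ^ 'n. complex_of_real (exp (R\<^sup>2 / 4) * exp (R * norm \<xi> - (1/2) * (norm \<xi>)\<^sup>2)))"
    by (rule square_integrable_gaussian_bound[where C="exp (R\<^sup>2 / 4)" and a="1/2" and R=R]) (auto simp: norm_mult)
  from integrable_norm[OF square_integrable_mult_integrable[OF u this]]
  have iu: "integrable lborel (\<lambda>\<xi>. cmod (u \<xi>) * (exp (R\<^sup>2 / 4) * exp (R * norm \<xi> - (1/2) * (norm \<xi>)\<^sup>2)))"
    by (simp add: norm_mult)
  have "(LINT w|gauss_measure. G w * cnj (bargmann u w))
      = (LINT w|gauss_measure. LINT \<xi>|lborel. G w * cnj (bkernel w \<xi>) * cnj (u \<xi>))"
    unfolding cnj_bargmann integral_mult_right_zero[symmetric] by (simp only: mult_ac)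
  also have "\<dots> = (LINT \<xi>|lborel. LINT w|gauss_measure. G w * cnj (bkernel w \<xi>) * cnj (u \<xi>))"
  proof (rule integral_exchange_dominated[OF g.sigma_finite_measure_axioms lborel.sigma_finite_measure_axioms integrable_G iu])
    show "cmod (G w * cnj (bkernel w \<xi>) * cnj (u \<xi>)) \<le> cmod (G w) * (cmod (u \<xi>) * (exp (R\<^sup>2 / 4) * exp (R * norm \<xi> - (1/2) * (norm \<xi>)\<^sup>2)))"
      for w \<xi>
      using mult_left_mono[OF bkernel_bound[of w \<xi>] norm_ge_zero[of "u \<xi>"]] by (simp add: norm_mult mult_ac)
  qed (simp add: split_beta, measurable)
  also have "\<dots> = (LINT \<xi>|lborel. bargmann_adj G \<xi> * cnj (u \<xi>))"
    unfolding bargmann_adj_def by simp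
  finally show ?thesis .
qed

lemma integrable_adj: "integrable gauss_measure (\<lambda>w. G w * cnj (bkernel w \<xi>))"
proof (rule Bochner_Integration.integrable_bound)
  show "integrable gauss_measure (\<lambda>w. cmod (G w) * (exp (R\<^sup>2 / 4) * exp (R * norm \<xi> - (1/2) * (norm \<xi>)\<^sup>2)))"
    by (intro integrable_mult_left integrable_G)
qed (use bkernel_bound in \<open>auto simp: norm_mult abs_mult\<close>)

lemma square_integrable_adj: "square_integrable lborel (bargmann_adj G)"
proof (rule square_integrable_gaussian_bound)
  interpret g: prob_space "gauss_measure :: (complex ^ 'n) measure" by (rule prob_space_gauss_measure)
  show "bargmann_adj G \<in> borel_measurable borel"
    unfolding bargmann_adj_def[abs_def] by (rule g.borel_measurable_lebesgue_integral) measurable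
  fix \<xi> :: "real ^ 'n"
  have "cmod (bargmann_adj G \<xi>) \<le> (LINT w|gauss_measure. cmod (G w) * (exp (R\<^sup>2 / 4) * exp (R * norm \<xi> - (1/2) * (norm \<xi>)\<^sup>2)))"
    unfolding bargmann_adj_def
    by (rule Bochner_Integration.integral_norm_bound_integral[OF integrable_adj])
      (use bkernel_bound in \<open>auto simp: norm_mult intro: integrable_G\<close>)
  then show "cmod (bargmann_adj G \<xi>) \<le> ((LINT w|gauss_measure. cmod (G w)) * exp (R\<^sup>2 / 4)) * exp (R * norm \<xi> - (1/2) * (norm \<xi>)\<^sup>2)"
    by (simp add: mult_ac)
qed simp

text \<open>Integration against the reproducing kernel, that is, the orthogonal projection onto the Fock space.\<close>

definition proj :: "complex ^ 'n \<Rightarrow> complex" where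
  "proj w = (LINT z|gauss_measure. G z * exp (cdot w (vcnj z) / 2))"

text \<open>Duality with \<open>u = cnj \<circ> bkernel w\<close>, whose Bargmann transform is a multiple of a reproducing kernel.\<close>

lemma bargmann_of_adj:
  "bargmann (bargmann_adj G) w = complex_of_real (sqrt pi ^ CARD('n)) * proj w"
proof -
  have u: "square_integrable lborel (\<lambda>\<xi>. cnj (bkernel w \<xi>))"
    by (intro square_integrable_cnj square_integrable_bkernel)
  have "bargmann (bargmann_adj G) w = (LINT z|gauss_measure. G z * cnj (bargmann (\<lambda>\<xi>. cnj (bkernel w \<xi>)) z))"
    unfolding bargmann_duality[OF u] by (simp add: bargmann_def)
  also have "\<dots> = complex_of_real (sqrt pi ^ CARD('n)) * proj w"
    unfolding bargmann_bkernel_cnj proj_def integral_mult_right_zero[symmetric] by (simp add: mult_ac)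
  finally show ?thesis .
qed

lemma proj_fock: "proj \<in> fock_space"
proof -
  have int: "integrable gauss_measure (\<lambda>z. G z * exp (cdot w (vcnj z) / 2))" for w
    by (rule Bochner_Integration.integrable_bound[OF integrable_mult_left[OF integrable_G, of "exp ((R / 2) * norm w)"]])
      (use exp_kernel_bound in \<open>auto simp: norm_mult abs_mult\<close>)
  have le: "cmod (proj w) \<le> (LINT z|gauss_measure. cmod (G z)) * exp ((R / 2) * norm w)" for w
    unfolding proj_def integral_mult_left_zero[symmetric]
    by (rule Bochner_Integration.integral_norm_bound_integral[OF int integrable_mult_left[OF integrable_G]])
      (use exp_kernel_bound in \<open>auto simp: norm_mult\<close>)
  have c: "complex_of_real (sqrt pi ^ CARD('n)) \<noteq> 0" by simp
  have "proj = (\<lambda>w. (1 / complex_of_real (sqrt pi ^ CARD('n))) * bargmann (bargmann_adj G) w)"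
    unfolding bargmann_of_adj using c by (simp add: fun_eq_iff)
  then have e: "entire proj" using entire_cmult[OF entire_bargmann[OF square_integrable_adj]] by metis
  moreover have "square_integrable gauss_measure proj"
    by (rule square_integrable_gauss_bound[where \<alpha>=0 and \<beta>="R/2"])
      (use le entire_measurable[OF e] in auto)
  ultimately show ?thesis by (rule fock_spaceI)
qed

text \<open>
  The first identity uses that \<open>proj\<close>, being in the Fock space, is reproduced by the kernel; with the
  Cauchy-Schwarz inequality it bounds \<open>proj\<close> by \<open>G\<close>.\<close>

lemma proj_norm:
  shows "complex_of_real (norm_sq gauss_measure proj) = (LINT w|gauss_measure. proj w * cnj (G w))"
    and "norm_sq gauss_measure proj \<le> norm_sq gauss_measure G"
proof -
  interpret g: prob_space "gauss_measure :: (complex ^ 'n) measure" by (rule prob_space_gauss_measure)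
  have [measurable]: "proj \<in> borel_measurable borel"
    using fock_spaceD(1)[OF proj_fock] by (rule entire_measurable)
  have sp: "square_integrable gauss_measure proj" by (rule fock_spaceD(2)[OF proj_fock])
  have "square_integrable gauss_measure (\<lambda>w :: complex ^ 'n. complex_of_real (exp ((R / 2) * norm w)))"
    by (rule square_integrable_gauss_bound[where \<alpha>=0 and \<beta>="R/2" and C=1]) auto
  from integrable_norm[OF square_integrable_mult_integrable[OF sp this]]
  have ip: "integrable gauss_measure (\<lambda>w. cmod (proj w) * exp ((R / 2) * norm w))"
    by (simp add: norm_mult)
  have "complex_of_real (norm_sq gauss_measure proj)
     = (LINT w|gauss_measure. proj w * cnj (proj w))"
    unfolding complex_norm_square[symmetric] by (rule integral_complex_of_real[symmetric])
  also have "\<dots> = (LINT w|gauss_measure. LINT z|gauss_measure. proj w * (cnj (G z) * exp (cdot z (vcnj w) / 2)))"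
  proof -
    have "cnj (proj w) = (LINT z|gauss_measure. cnj (G z) * exp (cdot z (vcnj w) / 2))" for w
      unfolding proj_def cnj_integral complex_cnj_mult cnj_exp_kernel ..
    then show ?thesis by simp
  qed
  also have "\<dots> = (LINT z|gauss_measure. LINT w|gauss_measure. proj w * (cnj (G z) * exp (cdot z (vcnj w) / 2)))"
  proof (rule integral_exchange_dominated[OF g.sigma_finite_measure_axioms g.sigma_finite_measure_axioms ip integrable_G])
    fix w z :: "complex ^ 'n"
    have "cmod (exp (cdot z (vcnj w) / 2)) = cmod (exp (cdot w (vcnj z) / 2))"
      by (simp add: Re_cdot_vcnj inner_commute)
    then show "cmod (proj w * (cnj (G z) * exp (cdot z (vcnj w) / 2)))
        \<le> cmod (proj w) * exp ((R / 2) * norm w) * cmod (G z)"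
      using mult_left_mono[OF exp_kernel_bound[of z w] norm_ge_zero[of "proj w"]]
      by (simp only: norm_mult complex_mod_cnj mult_ac)
  qed (simp add: split_beta, measurable)
  also have "\<dots> = (LINT z|gauss_measure. cnj (G z) * (LINT w|gauss_measure. proj w * exp (cdot z (vcnj w) / 2)))"
    unfolding integral_mult_right_zero[symmetric] by (simp add: mult_ac)
  also have "\<dots> = (LINT z|gauss_measure. proj z * cnj (G z))"
    unfolding fock_reproducing[OF proj_fock] by (simp add: mult.commute)
  finally show *: "complex_of_real (norm_sq gauss_measure proj) = (LINT w|gauss_measure. proj w * cnj (G w))" .
  define A where "A = norm_sq gauss_measure proj"
  define B where "B = norm_sq gauss_measure G"
  have A0: "A \<ge> 0" "B \<ge> 0" unfolding A_def B_def by (simp_all add: integral_nonneg_AE)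
  have "(cmod (complex_of_real A))\<^sup>2 \<le> A * B"
    using Cauchy_Schwarz_integral[OF sp square_integrable_cnj[OF sqG]]
    unfolding * [folded A_def] by (simp add: A_def B_def)
  then have "A * A \<le> B * A" using A0 by (simp add: power2_eq_square mult.commute)
  then have "A \<le> B" using A0 by (cases "A = 0") (auto simp: mult_le_cancel_right)
  then show "norm_sq gauss_measure proj \<le> norm_sq gauss_measure G"
    by (simp add: A_def B_def)
qed

text \<open>By duality the left hand side is the inner product of \<open>G\<close> with \<open>bargmann (bargmann_adj G)\<close>, a multiple of
  \<open>proj\<close>.\<close>

lemma adj_bounded:
  "norm_sq lborel (bargmann_adj G) \<le> sqrt pi ^ CARD('n) * norm_sq gauss_measure G"
proof -
  have "complex_of_real (norm_sq lborel (bargmann_adj G))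
     = (LINT \<xi>|lborel. bargmann_adj G \<xi> * cnj (bargmann_adj G \<xi>))"
    unfolding complex_norm_square[symmetric] by (rule integral_complex_of_real[symmetric])
  also have "\<dots> = (LINT w|gauss_measure. G w * cnj (bargmann (bargmann_adj G) w))"
    by (rule bargmann_duality[OF square_integrable_adj, symmetric])
  also have "\<dots> = complex_of_real (sqrt pi ^ CARD('n)) * cnj (LINT w|gauss_measure. proj w * cnj (G w))"
    unfolding bargmann_of_adj cnj_integral integral_mult_right_zero[symmetric]
    by (simp only: complex_cnj_mult complex_cnj_cnj complex_cnj_complex_of_real mult_ac)
  also have "\<dots> = complex_of_real (sqrt pi ^ CARD('n) * norm_sq gauss_measure proj)"
    unfolding proj_norm(1)[symmetric] by simp
  finally have "norm_sq lborel (bargmann_adj G) = sqrt pi ^ CARD('n) * norm_sq gauss_measure proj"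
    using of_real_eq_iff by blast
  then show ?thesis using proj_norm(2) by (simp add: mult_left_mono)
qed

end


section \<open>Boundedness and surjectivity of the Bargmann transform\<close>

text \<open>
  The bound passes from the adjoint to the transform by testing \<open>bargmann u\<close> against its own truncation to a
  ball, and then to the limit of large balls by Fatou's lemma.\<close>

lemma bargmann_bounded:
  fixes u :: "real ^ 'n \<Rightarrow> complex"
  assumes u: "square_integrable lborel u"
  shows "square_integrable gauss_measure (bargmann u)"
    and "norm_sq gauss_measure (bargmann u) \<le> sqrt pi ^ CARD('n) * norm_sq lborel u"
proof -
  interpret g: prob_space "gauss_measure :: (complex ^ 'n) measure" by (rule prob_space_gauss_measure)
  have [measurable]: "bargmann u \<in> borel_measurable borel"
    using entire_bargmann[OF u] by (rule entire_measurable)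
  define U where "U = norm_sq lborel u"
  have U0: "U \<ge> 0" unfolding U_def by (simp add: integral_nonneg_AE)
  define G where "G k w = (if norm w \<le> real k then bargmann u w else 0)" for k and w :: "complex ^ 'n"
  have [measurable]: "G k \<in> borel_measurable borel" for k unfolding G_def by measurable
  have sqG: "square_integrable gauss_measure (G k)" for k
    unfolding square_integrable_def
  proof
    show "integrable gauss_measure (\<lambda>w. (cmod (G k w))\<^sup>2)"
    proof (rule g.integrable_const_bound)
      have "(cmod (G k w))\<^sup>2 \<le> U * (sqrt pi ^ CARD('n) * exp ((real k)\<^sup>2 / 2))" for w
      proof (cases "norm w \<le> real k")
        case True
        have "(cmod (G k w))\<^sup>2 \<le> U * (sqrt pi ^ CARD('n) * exp ((norm w)\<^sup>2 / 2))"
          using bargmann_pointwise_bound[OF u, of w] True by (simp add: G_def U_def)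
        also have "\<dots> \<le> U * (sqrt pi ^ CARD('n) * exp ((real k)\<^sup>2 / 2))"
          using True U0 by (intro mult_left_mono) (auto intro!: power_mono)
        finally show ?thesis .
      qed (use U0 in \<open>simp add: G_def\<close>)
      then show "AE w in gauss_measure. norm ((cmod (G k w))\<^sup>2) \<le> U * (sqrt pi ^ CARD('n) * exp ((real k)\<^sup>2 / 2))"
        by simp
    qed simp
  qed simp
  have le: "norm_sq gauss_measure (G k) \<le> sqrt pi ^ CARD('n) * U" for k
  proof -
    interpret compactly_supported "G k" "real k"
      by standard (use sqG in \<open>auto simp: G_def\<close>)
    define A where "A = norm_sq gauss_measure (G k)"
    have A0: "A \<ge> 0" unfolding A_def by (simp add: integral_nonneg_AE)
    have "complex_of_real A = (LINT w|gauss_measure. G k w * cnj (bargmann u w))"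
      unfolding A_def integral_complex_of_real[symmetric]
      by (intro Bochner_Integration.integral_cong refl, subst complex_norm_square) (simp add: G_def)
    also have "\<dots> = (LINT \<xi>|lborel. bargmann_adj (G k) \<xi> * cnj (u \<xi>))"
      by (rule bargmann_duality[OF u])
    finally have "(cmod (complex_of_real A))\<^sup>2 \<le> norm_sq lborel (bargmann_adj (G k)) * U"
      using Cauchy_Schwarz_integral[OF square_integrable_adj square_integrable_cnj[OF u]] by (simp add: U_def)
    also have "\<dots> \<le> (sqrt pi ^ CARD('n) * A) * U"
      unfolding A_def by (intro mult_right_mono adj_bounded U0)
    finally have "A * A \<le> (sqrt pi ^ CARD('n) * U) * A" by (simp add: power2_eq_square mult_ac)
    then have "A \<le> sqrt pi ^ CARD('n) * U"
      using A0 U0 by (cases "A = 0") (auto simp: mult_le_cancel_right)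
    then show ?thesis by (simp add: A_def)
  qed
  have lim: "(\<lambda>k. G k w) \<longlonglongrightarrow> bargmann u w" for w
  proof (rule tendsto_eventually)
    show "\<forall>\<^sub>F k in sequentially. G k w = bargmann u w"
      using eventually_ge_at_top[of "nat \<lceil>norm w\<rceil>"]
      by eventually_elim (simp add: G_def order_trans[OF real_nat_ceiling_ge])
  qed
  show "square_integrable gauss_measure (bargmann u)"
    and "norm_sq gauss_measure (bargmann u) \<le> sqrt pi ^ CARD('n) * norm_sq lborel u"
    using square_integrable_Fatou[where f=G and M=gauss_measure and g="bargmann u", OF sqG le lim] by (auto simp: U_def)
qed

text \<open>
  The adjoint of the Bargmann transform on all of \<open>L\<^sup>2\<close>: its defining integral need not converge, so it
  is obtained as an \<open>L\<^sup>2\<close> limit over truncations of \<open>F\<close> that approach \<open>F\<close> geometrically fast.\<close>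

lemma bargmann_dual:
  fixes F :: "complex ^ 'n \<Rightarrow> complex"
  assumes F: "square_integrable gauss_measure F"
  obtains f where "square_integrable lborel f"
    "norm_sq lborel f \<le> sqrt pi ^ CARD('n) * norm_sq gauss_measure F"
    "\<And>u. square_integrable lborel u \<Longrightarrow>
      (LINT w|gauss_measure. F w * cnj (bargmann u w)) = (LINT \<xi>|lborel. f \<xi> * cnj (u \<xi>))"
proof -
  define N where "N = sqrt pi ^ CARD('n)"
  have N0: "N \<ge> 0" unfolding N_def by simp
  have [measurable]: "F \<in> borel_measurable borel" using F by (simp add: square_integrable_def)
  have iF: "integrable gauss_measure (\<lambda>w. (cmod (F w))\<^sup>2)" using F by (simp add: square_integrable_def)
  \<comment> \<open>The tails of \<open>F\<close>; the truncations are \<open>F - T n\<close>.\<close>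
  define T where "T n w = (if norm w > real n then F w else 0)" for n and w :: "complex ^ 'n"
  have [measurable]: "T n \<in> borel_measurable borel" for n unfolding T_def by measurable
  have sT: "square_integrable gauss_measure (T n)" for n
    by (rule square_integrable_bound[OF F, where C=1]) (auto simp: T_def)
  have "(\<lambda>n. LINT w|gauss_measure. (cmod (T n w))\<^sup>2) \<longlonglongrightarrow> (LINT w|(gauss_measure :: (complex ^ 'n) measure). 0 :: real)"
  proof (rule integral_dominated_convergence[where w="\<lambda>w. (cmod (F w))\<^sup>2"])
    have "(\<lambda>n. (cmod (T n w))\<^sup>2) \<longlonglongrightarrow> 0" for w
    proof (rule tendsto_eventually)
      show "\<forall>\<^sub>F n in sequentially. (cmod (T n w))\<^sup>2 = 0"
        using eventually_ge_at_top[of "nat \<lceil>norm w\<rceil>"]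
        by eventually_elim (simp add: T_def not_less order_trans[OF real_nat_ceiling_ge])
    qed
    then show "AE w in gauss_measure. (\<lambda>n. (cmod (T n w))\<^sup>2) \<longlonglongrightarrow> 0" by simp
  qed (use iF in \<open>auto simp: T_def\<close>)
  then have lim0: "(\<lambda>n. LINT w|gauss_measure. (cmod (T n w))\<^sup>2) \<longlonglongrightarrow> 0" by simp
  have "\<exists>n. norm_sq gauss_measure (T n) \<le> (1/4) ^ k" for k :: nat
  proof -
    have "(1/4::real) ^ k > 0" by simp
    from order_tendstoD(2)[OF lim0 this]
    obtain n where "\<forall>m\<ge>n. norm_sq gauss_measure (T m) < (1/4) ^ k"
      unfolding eventually_sequentially by blast
    then show ?thesis by (intro exI[of _ n] less_imp_le) simp
  qed
  then obtain r where r: "\<And>k. norm_sq gauss_measure (T (r k)) \<le> (1/4) ^ k"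
    by metis
  define G where "G k w = F w - T (r k) w" for k w
  have [measurable]: "G k \<in> borel_measurable borel" for k unfolding G_def by measurable
  have sG: "square_integrable gauss_measure (G k)" for k
    unfolding G_def by (intro square_integrable_diff F sT)
  have cs: "compactly_supported (G k) (real (r k))" for k
    by standard (use sG in \<open>auto simp: G_def T_def\<close>)
  have csd: "compactly_supported (\<lambda>w. G (Suc k) w - G k w) (max (real (r k)) (real (r (Suc k))))" for k
  proof
    show "square_integrable gauss_measure (\<lambda>w. G (Suc k) w - G k w)"
      by (intro square_integrable_diff sG)
  qed (auto simp: G_def T_def)
  define f where "f k = bargmann_adj (G k)" for k
  have sf: "square_integrable lborel (f k)" for k
    unfolding f_def by (rule compactly_supported.square_integrable_adj[OF cs])
  have diff: "f (Suc k) \<xi> - f k \<xi> = bargmann_adj (\<lambda>w. G (Suc k) w - G k w) \<xi>" for k \<xi>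
    unfolding f_def bargmann_adj_def
    using compactly_supported.integrable_adj[OF cs]
    by (simp add: left_diff_distrib)
  have fast: "norm_sq lborel (\<lambda>\<xi>. f (Suc k) \<xi> - f k \<xi>) \<le> (N * 4) * (1/4) ^ k" for k
  proof -
    have "(cmod (G (Suc k) w - G k w))\<^sup>2 \<le> 2 * (cmod (T (r k) w))\<^sup>2 + 2 * (cmod (T (r (Suc k)) w))\<^sup>2" for w
    proof -
      have "(cmod (G (Suc k) w - G k w))\<^sup>2 \<le> (cmod (T (r k) w) + cmod (T (r (Suc k)) w))\<^sup>2"
        using norm_triangle_ineq4[of "T (r k) w" "T (r (Suc k)) w"] by (intro power_mono) (auto simp: G_def)
      then show ?thesis
        using sum_squares_bound[of "cmod (T (r k) w)" "cmod (T (r (Suc k)) w)"] by (simp add: power2_sum)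
    qed
    then have "norm_sq gauss_measure (\<lambda>w. G (Suc k) w - G k w)
        \<le> (LINT w|gauss_measure. 2 * (cmod (T (r k) w))\<^sup>2 + 2 * (cmod (T (r (Suc k)) w))\<^sup>2)"
      using sT sG square_integrable_diff[OF sG sG]
      by (intro integral_mono) (auto simp: square_integrable_def)
    also have "\<dots> = 2 * norm_sq gauss_measure (T (r k)) + 2 * norm_sq gauss_measure (\<lambda>w. T (r (Suc k)) w)"
      using sT by (simp add: square_integrable_def)
    also have "\<dots> \<le> 2 * (1/4) ^ k + 2 * (1/4) ^ Suc k"
      using r[of k] r[of "Suc k"] by linarith
    also have "\<dots> \<le> 4 * (1/4) ^ k" by simp
    finally have "norm_sq gauss_measure (\<lambda>w. G (Suc k) w - G k w) \<le> 4 * (1/4) ^ k" .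
    from order_trans[OF compactly_supported.adj_bounded[OF csd] mult_left_mono[OF this N0[unfolded N_def]]]
    show ?thesis unfolding diff N_def by (simp add: mult.assoc)
  qed
  obtain g H where g: "square_integrable lborel g" and H: "integrable lborel H"
    and fH: "\<And>k. AE \<xi> in lborel. (cmod (f k \<xi>))\<^sup>2 \<le> H \<xi>"
    and fg: "AE \<xi> in lborel. (\<lambda>k. f k \<xi>) \<longlonglongrightarrow> g \<xi>"
    using square_integrable_fast_Cauchy_limit[OF sf fast] by blast
  have [measurable]: "g \<in> borel_measurable borel" using g by (simp add: square_integrable_def)
  have [measurable]: "f k \<in> borel_measurable borel" for k using sf by (simp add: square_integrable_def)
  have norm_g: "norm_sq lborel g \<le> N * norm_sq gauss_measure F"
  proof (rule LIMSEQ_le_const2)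
    show "(\<lambda>k. LINT \<xi>|lborel. (cmod (f k \<xi>))\<^sup>2) \<longlonglongrightarrow> norm_sq lborel g"
    proof (rule integral_dominated_convergence[where w=H])
      show "AE \<xi> in lborel. (\<lambda>k. (cmod (f k \<xi>))\<^sup>2) \<longlonglongrightarrow> (cmod (g \<xi>))\<^sup>2"
        using fg by eventually_elim (intro tendsto_power tendsto_norm)
    qed (use H fH in auto)
    show "\<exists>K. \<forall>k\<ge>K. norm_sq lborel (f k) \<le> N * norm_sq gauss_measure F"
    proof (intro exI allI impI)
      fix k
      have "norm_sq lborel (f k) \<le> N * norm_sq gauss_measure (G k)"
        unfolding f_def N_def by (rule compactly_supported.adj_bounded[OF cs])
      also have "\<dots> \<le> N * norm_sq gauss_measure F"
        using sG iF by (intro mult_left_mono N0 integral_mono) (auto simp: square_integrable_def G_def T_def)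
      finally show "norm_sq lborel (f k) \<le> N * norm_sq gauss_measure F" .
    qed
  qed
  have dual: "(LINT w|gauss_measure. F w * cnj (bargmann u w)) = (LINT \<xi>|lborel. g \<xi> * cnj (u \<xi>))"
    if u: "square_integrable lborel u" for u
  proof -
    have [measurable]: "u \<in> borel_measurable borel" using u by (simp add: square_integrable_def)
    have sB: "square_integrable gauss_measure (\<lambda>w. cnj (bargmann u w))"
      by (intro square_integrable_cnj bargmann_bounded u)
    have "(\<lambda>k. LINT \<xi>|lborel. f k \<xi> * cnj (u \<xi>)) \<longlonglongrightarrow> (LINT \<xi>|lborel. g \<xi> * cnj (u \<xi>))"
    proof (rule integral_dominated_convergence[where w="\<lambda>\<xi>. H \<xi> + (cmod (u \<xi>))\<^sup>2"])
      show "AE \<xi> in lborel. (\<lambda>k. f k \<xi> * cnj (u \<xi>)) \<longlonglongrightarrow> g \<xi> * cnj (u \<xi>)"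
        using fg by eventually_elim (intro tendsto_mult tendsto_const)
      show "integrable lborel (\<lambda>\<xi>. H \<xi> + (cmod (u \<xi>))\<^sup>2)" using H u by (simp add: square_integrable_def)
      show "AE \<xi> in lborel. norm (f k \<xi> * cnj (u \<xi>)) \<le> H \<xi> + (cmod (u \<xi>))\<^sup>2" for k
        using fH[of k]
      proof eventually_elim
        case (elim \<xi>)
        have "0 \<le> cmod (f k \<xi>) * cmod (u \<xi>)" by simp
        then show ?case
          using elim sum_squares_bound[of "cmod (f k \<xi>)" "cmod (u \<xi>)"]
          by (simp only: norm_mult complex_mod_cnj)
      qed
    qed measurable
    moreover have "(\<lambda>k. LINT \<xi>|lborel. f k \<xi> * cnj (u \<xi>)) \<longlonglongrightarrow> (LINT w|gauss_measure. F w * cnj (bargmann u w))"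
    proof -
      have eq: "(LINT \<xi>|lborel. f k \<xi> * cnj (u \<xi>)) = (LINT w|gauss_measure. F w * cnj (bargmann u w)) - (LINT w|gauss_measure. T (r k) w * cnj (bargmann u w))" for k
        unfolding f_def compactly_supported.bargmann_duality[OF cs u, symmetric]
        using square_integrable_mult_integrable[OF F sB] square_integrable_mult_integrable[OF sT sB]
        by (simp add: G_def left_diff_distrib)
      have "(\<lambda>k. LINT w|gauss_measure. T (r k) w * cnj (bargmann u w)) \<longlonglongrightarrow> 0"
      proof (rule Lim_null_comparison)
        define B where "B = norm_sq gauss_measure (\<lambda>w. cnj (bargmann u w))"
        have B0: "B \<ge> 0" unfolding B_def by (simp add: integral_nonneg_AE)
        have "norm (LINT w|gauss_measure. T (r k) w * cnj (bargmann u w)) \<le> (1/2) ^ k * sqrt B" for k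
        proof (rule power2_le_imp_le)
          have "(cmod (LINT w|gauss_measure. T (r k) w * cnj (bargmann u w)))\<^sup>2 \<le> (1/4) ^ k * B"
            by (rule order_trans[OF Cauchy_Schwarz_integral[OF sT sB]])
              (unfold B_def[symmetric], intro mult_right_mono r B0)
          also have "(1/4) ^ k * B = ((1/2) ^ k * sqrt B)\<^sup>2"
            using B0 by (simp add: power_mult_distrib power2_eq_square[of "(1/2) ^ k"] flip: power_mult_distrib[of "1/2" "1/2" k])
          finally show "(cmod (LINT w|gauss_measure. T (r k) w * cnj (bargmann u w)))\<^sup>2 \<le> ((1/2) ^ k * sqrt B)\<^sup>2" .
        qed (use B0 in simp)
        then show "\<forall>\<^sub>F k in sequentially. norm (LINT w|gauss_measure. T (r k) w * cnj (bargmann u w)) \<le> (1/2) ^ k * sqrt B"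
          by simp
        show "(\<lambda>k. (1/2) ^ k * sqrt B) \<longlonglongrightarrow> 0"
          by (intro tendsto_mult_left_zero LIMSEQ_realpow_zero) auto
      qed
      from tendsto_diff[OF tendsto_const this] show ?thesis unfolding eq by simp
    qed
    ultimately show ?thesis using LIMSEQ_unique by blast
  qed
  show thesis using that[OF g norm_g[unfolded N_def] dual] .
qed

text \<open>Up to a constant, the transform of \<open>cnj \<circ> bkernel z\<close> is the reproducing kernel at \<open>z\<close>.\<close>

lemma bargmann_inverse:
  fixes F :: "complex ^ 'n \<Rightarrow> complex"
  assumes F: "F \<in> fock_space" and f: "square_integrable lborel f"
    and dual: "\<And>u. square_integrable lborel u \<Longrightarrow>
      (LINT w|gauss_measure. F w * cnj (bargmann u w)) = (LINT \<xi>|lborel. f \<xi> * cnj (u \<xi>))"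
  shows "bargmann f z = complex_of_real (sqrt pi ^ CARD('n)) * F z"
proof -
  have "bargmann f z = (LINT w|gauss_measure. F w * cnj (bargmann (\<lambda>\<xi>. cnj (bkernel z \<xi>)) w))"
    by (subst dual) (simp_all add: square_integrable_cnj square_integrable_bkernel bargmann_def)
  also have "\<dots> = complex_of_real (sqrt pi ^ CARD('n)) * (LINT w|gauss_measure. F w * exp (cdot z (vcnj w) / 2))"
    unfolding bargmann_bkernel_cnj integral_mult_right_zero[symmetric] by (simp add: mult_ac)
  finally show ?thesis by (simp add: fock_reproducing[OF F])
qed

lemma bargmann_surj:
  fixes F :: "complex ^ 'n \<Rightarrow> complex"
  assumes F: "F \<in> fock_space"
  obtains f where "square_integrable lborel f" "bargmann f = F"
proof -
  obtain f where f: "square_integrable lborel f"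
    and dual: "\<And>u. square_integrable lborel u \<Longrightarrow>
      (LINT w|gauss_measure. F w * cnj (bargmann u w)) = (LINT \<xi>|lborel. f \<xi> * cnj (u \<xi>))"
    using bargmann_dual[OF fock_spaceD(2)[OF F]] by blast
  define c where "c = complex_of_real (sqrt pi ^ CARD('n))"
  have c: "c \<noteq> 0" unfolding c_def by simp
  have "bargmann (\<lambda>\<xi>. (1 / c) * f \<xi>) z = F z" for z
  proof -
    have "bargmann (\<lambda>\<xi>. (1 / c) * f \<xi>) z = (1 / c) * bargmann f z"
      unfolding bargmann_def integral_mult_right_zero[symmetric] by (simp only: mult.assoc)
    then show ?thesis using bargmann_inverse[OF F f dual, of z] c by (simp add: c_def)
  qed
  then show thesis using that[OF square_integrable_cmult[OF f]] by blast
qed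

section \<open>Bounded multipliers give bounded operators\<close>

lemma multiplier_kernel:
  assumes "\<And>z. \<phi> z = (LINT \<xi>|lborel. m \<xi> * exp (- csq (vcomplex \<xi> - (1/2) *s z)))"
  shows "\<phi> (z + vcnj w) * exp (cdot z (vcnj w) / 2)
     = (LINT \<xi>|lborel. (m \<xi> * bkernel z \<xi>) * cnj (bkernel w \<xi>))"
  unfolding assms integral_mult_left_zero[symmetric] mult.assoc bkernel_mult_cnj ..

text \<open>
  The kernel of the operator at \<open>z\<close> is the conjugate of the transform of the square integrable function
  \<open>cnj (m \<xi> * bkernel z \<xi>)\<close>, so the defining integral converges on the whole Fock space and the operator
  is multiplication by \<open>m\<close> seen through the Bargmann transform.\<close>

lemma S_tilde_op_bounded:
  fixes \<phi> :: "complex ^ 'n \<Rightarrow> complex"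
  assumes m: "m \<in> L_infinity"
    and \<phi>: "\<And>z. \<phi> z = (LINT \<xi>|lborel. m \<xi> * exp (- csq (vcomplex \<xi> - (1/2) *s z)))"
  shows "bounded_on_fock (S_tilde_op \<phi>)"
proof -
  define N where "N = sqrt pi ^ CARD('n)"
  have N: "N > 0" unfolding N_def by simp
  obtain C where [measurable]: "m \<in> borel_measurable borel" and C: "AE \<xi> in lborel. cmod (m \<xi>) \<le> C"
    using m by (auto simp: L_infinity_def)
  have mult: "square_integrable lborel (\<lambda>\<xi>. m \<xi> * f \<xi>)" if f: "square_integrable lborel f" for f
  proof (rule square_integrable_bound[OF f])
    show "(\<lambda>\<xi>. m \<xi> * f \<xi>) \<in> borel_measurable lborel" using f by measurable
    show "AE \<xi> in lborel. cmod (m \<xi> * f \<xi>) \<le> C * cmod (f \<xi>)"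
      using C by eventually_elim (simp add: norm_mult mult_right_mono)
  qed
  define u where "u z \<xi> = cnj (m \<xi> * bkernel z \<xi>)" for z \<xi>
  have su: "square_integrable lborel (u z)" for z
    unfolding u_def by (intro square_integrable_cnj mult square_integrable_bkernel)
  have kernel: "\<phi> (z + vcnj w) * exp (cdot z (vcnj w) / 2) = cnj (bargmann (u z) w)" for z w
    unfolding multiplier_kernel[OF \<phi>] cnj_bargmann u_def complex_cnj_cnj ..
  have S: "S_tilde_op \<phi> F z = (LINT w|gauss_measure. F w * cnj (bargmann (u z) w))" for F z
    unfolding S_tilde_op_def mult.assoc kernel ..
  have int: "integrable gauss_measure (\<lambda>w. F w * cnj (bargmann (u z) w))" if "F \<in> fock_space" for F z
    by (intro square_integrable_mult_integrable square_integrable_cnj bargmann_bounded su fock_spaceD that)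
  have key: "S_tilde_op \<phi> F \<in> fock_space \<and> fock_norm (S_tilde_op \<phi> F) \<le> (N * \<bar>C\<bar>) * fock_norm F"
    if F: "F \<in> fock_space" for F
  proof -
    obtain f where f: "square_integrable lborel f"
      and nf: "norm_sq lborel f \<le> N * norm_sq gauss_measure F"
      and dual: "\<And>u. square_integrable lborel u \<Longrightarrow>
        (LINT w|gauss_measure. F w * cnj (bargmann u w)) = (LINT \<xi>|lborel. f \<xi> * cnj (u \<xi>))"
      using bargmann_dual[OF fock_spaceD(2)[OF F]] unfolding N_def by blast
    have "S_tilde_op \<phi> F z = bargmann (\<lambda>\<xi>. m \<xi> * f \<xi>) z" for z
    proof -
      have "S_tilde_op \<phi> F z = (LINT \<xi>|lborel. f \<xi> * cnj (u z \<xi>))"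
        unfolding S by (rule dual[OF su])
      then show ?thesis unfolding bargmann_def u_def complex_cnj_cnj by (simp only: mult_ac)
    qed
    then have eq: "S_tilde_op \<phi> F = bargmann (\<lambda>\<xi>. m \<xi> * f \<xi>)" by (rule ext)
    note sm = mult[OF f]
    have "norm_sq lborel (\<lambda>\<xi>. m \<xi> * f \<xi>) \<le> (LINT \<xi>|lborel. C\<^sup>2 * (cmod (f \<xi>))\<^sup>2)"
    proof (rule integral_mono_AE)
      show "AE \<xi> in lborel. (cmod (m \<xi> * f \<xi>))\<^sup>2 \<le> C\<^sup>2 * (cmod (f \<xi>))\<^sup>2"
        using C by eventually_elim (simp add: norm_mult power_mult_distrib mult_right_mono power_mono)
    qed (use f sm in \<open>auto simp: square_integrable_def\<close>)
    also have "\<dots> \<le> C\<^sup>2 * (N * norm_sq gauss_measure F)"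
      using nf by (simp add: mult_left_mono)
    finally have "N * norm_sq lborel (\<lambda>\<xi>. m \<xi> * f \<xi>) \<le> N * (C\<^sup>2 * (N * norm_sq gauss_measure F))"
      using N by simp
    from order_trans[OF bargmann_bounded(2)[OF sm, folded N_def] this]
    have "(fock_norm (S_tilde_op \<phi> F))\<^sup>2 \<le> ((N * \<bar>C\<bar>) * fock_norm F)\<^sup>2"
      unfolding fock_norm_sq power_mult_distrib power2_abs eq
      by (simp add: power2_eq_square mult_ac)
    then have "fock_norm (S_tilde_op \<phi> F) \<le> (N * \<bar>C\<bar>) * fock_norm F"
      by (rule power2_le_imp_le) (use N in \<open>simp add: fock_norm_nonneg\<close>)
    moreover have "S_tilde_op \<phi> F \<in> fock_space"
      unfolding eq by (intro fock_spaceI entire_bargmann bargmann_bounded sm)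
    ultimately show ?thesis by blast
  qed
  have "S_tilde_op \<phi> (\<lambda>z. a * F z + b * G z) = (\<lambda>z. a * S_tilde_op \<phi> F z + b * S_tilde_op \<phi> G z)"
    if "F \<in> fock_space" "G \<in> fock_space" for F G a b
    unfolding S using int[OF that(1)] int[OF that(2)] by (simp add: distrib_right mult.assoc)
  then have "bounded_linear_operator_on_fock (S_tilde_op \<phi>)"
    unfolding bounded_linear_operator_on_fock_def using key by blast
  then show ?thesis unfolding bounded_on_fock_def by blast
qed

section \<open>Holomorphic polynomials and exponentials of polynomials\<close>

text \<open>Different indices may carry the same exponents; their coefficients are collected.\<close>

lemma hol_polynomialI:
  fixes e :: "'i \<Rightarrow> 'n::finite \<Rightarrow> nat"
  assumes I: "finite I"
  shows "hol_polynomial (\<lambda>z. \<Sum>i\<in>I. c i * (\<Prod>j\<in>UNIV. (z $ j) ^ e i j))"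
  unfolding hol_polynomial_def
proof (intro exI conjI ext)
  show "finite (e ` I)" using I by simp
  fix z :: "complex ^ 'n"
  have "(\<Sum>i\<in>I. c i * (\<Prod>j\<in>UNIV. (z $ j) ^ e i j))
      = (\<Sum>\<alpha>\<in>e ` I. \<Sum>i\<in>{i \<in> I. e i = \<alpha>}. c i * (\<Prod>j\<in>UNIV. (z $ j) ^ e i j))"
    by (rule sum.image_gen[OF I])
  also have "\<dots> = (\<Sum>\<alpha>\<in>e ` I. (\<Sum>i\<in>{i \<in> I. e i = \<alpha>}. c i) * (\<Prod>j\<in>UNIV. (z $ j) ^ \<alpha> j))"
    by (intro sum.cong refl) (simp add: sum_distrib_right)
  finally show "(\<Sum>i\<in>I. c i * (\<Prod>j\<in>UNIV. (z $ j) ^ e i j))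
      = (\<Sum>\<alpha>\<in>e ` I. (\<Sum>i\<in>{i \<in> I. e i = \<alpha>}. c i) * (\<Prod>j\<in>UNIV. (z $ j) ^ \<alpha> j))" .
qed

lemma hol_polynomial_const: "hol_polynomial (\<lambda>z. c)"
  using hol_polynomialI[of "{()}" "\<lambda>_. c" "\<lambda>_ _. 0"] by simp

lemma hol_polynomial_coord: "hol_polynomial (\<lambda>z. z $ j)"
proof -
  have "(\<Prod>k\<in>UNIV. (z $ k) ^ (if k = j then 1 else 0)) = z $ j" for z :: "complex ^ 'a"
    by (simp add: if_distrib[where f="\<lambda>p. _ ^ p"] cong: if_cong)
  then show ?thesis
    using hol_polynomialI[of "{()}" "\<lambda>_. 1" "\<lambda>_ k. if k = j then 1 else 0"] by simp
qed

lemma hol_polynomial_add: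
  assumes "hol_polynomial P" "hol_polynomial Q" shows "hol_polynomial (\<lambda>z. P z + Q z)"
proof -
  obtain A a where A: "finite A" "P = (\<lambda>z. \<Sum>\<alpha>\<in>A. a \<alpha> * (\<Prod>j\<in>UNIV. (z $ j) ^ \<alpha> j))"
    using assms(1) unfolding hol_polynomial_def by blast
  obtain B b where B: "finite B" "Q = (\<lambda>z. \<Sum>\<alpha>\<in>B. b \<alpha> * (\<Prod>j\<in>UNIV. (z $ j) ^ \<alpha> j))"
    using assms(2) unfolding hol_polynomial_def by blast
  have "hol_polynomial (\<lambda>z. \<Sum>i\<in>A <+> B. case_sum a b i * (\<Prod>j\<in>UNIV. (z $ j) ^ case_sum (\<lambda>\<alpha>. \<alpha>) (\<lambda>\<alpha>. \<alpha>) i j))"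
    by (rule hol_polynomialI) (use A B in auto)
  then show ?thesis using A B by (simp add: sum.Plus)
qed

lemma hol_polynomial_mult:
  assumes "hol_polynomial P" "hol_polynomial Q" shows "hol_polynomial (\<lambda>z. P z * Q z)"
proof -
  obtain A a where A: "finite A" "P = (\<lambda>z. \<Sum>\<alpha>\<in>A. a \<alpha> * (\<Prod>j\<in>UNIV. (z $ j) ^ \<alpha> j))"
    using assms(1) unfolding hol_polynomial_def by blast
  obtain B b where B: "finite B" "Q = (\<lambda>z. \<Sum>\<alpha>\<in>B. b \<alpha> * (\<Prod>j\<in>UNIV. (z $ j) ^ \<alpha> j))"
    using assms(2) unfolding hol_polynomial_def by blast
  have *: "hol_polynomial (\<lambda>z. \<Sum>i\<in>A \<times> B. (a (fst i) * b (snd i)) * (\<Prod>j\<in>UNIV. (z $ j) ^ (fst i j + snd i j)))"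
    by (rule hol_polynomialI) (use A B in auto)
  have "P z * Q z = (\<Sum>i\<in>A \<times> B. (a (fst i) * b (snd i)) * (\<Prod>j\<in>UNIV. (z $ j) ^ (fst i j + snd i j)))" for z
    unfolding A(2) B(2) sum_product sum.cartesian_product
    by (intro sum.cong refl) (simp add: power_add prod.distrib mult_ac split_beta)
  then show ?thesis using * by simp
qed

lemma hol_polynomial_sum:
  assumes "finite I" "\<And>i. i \<in> I \<Longrightarrow> hol_polynomial (P i)"
  shows "hol_polynomial (\<lambda>z. \<Sum>i\<in>I. P i z)"
  using assms
proof (induction I)
  case empty then show ?case by (simp add: hol_polynomial_const)
next
  case (insert i I)
  then have "hol_polynomial (\<lambda>z. P i z + (\<Sum>i\<in>I. P i z))" by (intro hol_polynomial_add) auto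
  then show ?case using insert by simp
qed

lemma hol_polynomial_power: "hol_polynomial P \<Longrightarrow> hol_polynomial (\<lambda>z. P z ^ k)"
  by (induction k) (simp_all add: hol_polynomial_const hol_polynomial_mult)

lemma entire_sum: "finite I \<Longrightarrow> (\<And>i. i \<in> I \<Longrightarrow> entire (F i)) \<Longrightarrow> entire (\<lambda>z. \<Sum>i\<in>I. F i z)"
  by (induction I rule: finite_induct) (simp_all add: entire_const entire_add)

lemma entire_prod: "finite I \<Longrightarrow> (\<And>i. i \<in> I \<Longrightarrow> entire (F i)) \<Longrightarrow> entire (\<lambda>z. \<Prod>i\<in>I. F i z)"
  by (induction I rule: finite_induct) (simp_all add: entire_const entire_mult)

lemma entire_power: "entire F \<Longrightarrow> entire (\<lambda>z. F z ^ k)"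
  by (induction k) (simp_all add: entire_const entire_mult)

lemma entire_coord: "entire (\<lambda>z. z $ j)"
proof -
  have "z $ j = cdot z (axis j 1)" for z :: "complex ^ 'a"
    by (simp add: cdot_def axis_def if_distrib[where f="\<lambda>x. _ * x"] cong: if_cong)
  then show ?thesis using entire_cdot[of "axis j 1"] by simp
qed

lemma hol_polynomial_entire: assumes "hol_polynomial P" shows "entire P"
proof -
  obtain A a where A: "finite A" "P = (\<lambda>z. \<Sum>\<alpha>\<in>A. a \<alpha> * (\<Prod>j\<in>UNIV. (z $ j) ^ \<alpha> j))"
    using assms unfolding hol_polynomial_def by blast
  show ?thesis unfolding A(2)
    by (intro entire_sum entire_prod entire_cmult entire_power entire_coord A(1) finite)
qed

lemma hol_polynomial_csq_affine: "hol_polynomial (\<lambda>z. c * csq (a - d *s z))"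
proof -
  have "c * csq (a - d *s z) = c * (\<Sum>j\<in>UNIV. (a $ j + (- d) * z $ j) * (a $ j + (- d) * z $ j))" for z
    by (simp add: csq_def cdot_def)
  then show ?thesis
    by (simp only:) (intro hol_polynomial_mult hol_polynomial_sum hol_polynomial_add
        hol_polynomial_const hol_polynomial_coord finite)
qed

lemma norm_exp_partial_sum_le: "cmod (\<Sum>j<k. q ^ j / fact j) \<le> exp (cmod q)"
proof -
  have s: "(\<lambda>j. cmod q ^ j / fact j) sums exp (cmod q)"
    using exp_converges[of "cmod q"] by (simp add: field_simps)
  have "cmod (\<Sum>j<k. q ^ j / fact j) \<le> (\<Sum>j<k. cmod q ^ j / fact j)"
    by (rule order_trans[OF norm_sum]) (simp add: norm_divide norm_power)
  also have "\<dots> \<le> (\<Sum>j. cmod q ^ j / fact j)"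
    by (rule sum_le_suminf) (use s in \<open>auto simp: sums_iff\<close>)
  finally show ?thesis using s by (simp add: sums_iff)
qed

lemma exp_partial_sums_limit: "(\<lambda>k. \<Sum>j<k. q ^ j / fact j) \<longlonglongrightarrow> exp (q :: complex)"
  using exp_converges[of q] unfolding sums_def by (simp add: scaleR_conv_of_real field_simps)

lemma fock_shift_bound:
  assumes "\<phi> \<in> fock_space"
  shows "cmod (\<phi> (z + vcnj w) * exp (cdot z (vcnj w) / 2))
     \<le> (fock_norm \<phi> * exp ((norm z)\<^sup>2 / 4)) * exp ((1/4) * (norm w)\<^sup>2 + norm z * norm w)"
proof -
  have "(norm (z + vcnj w))\<^sup>2 \<le> (norm z + norm w)\<^sup>2"
    using norm_triangle_ineq[of z "vcnj w"] by (intro power_mono) auto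
  then have "exp ((norm (z + vcnj w))\<^sup>2 / 4) \<le> exp ((norm z + norm w)\<^sup>2 / 4)" by simp
  with fock_pointwise_bound[OF assms, of "z + vcnj w"]
  have "cmod (\<phi> (z + vcnj w)) \<le> fock_norm \<phi> * exp ((norm z + norm w)\<^sup>2 / 4)"
    using fock_norm_nonneg[of \<phi>] by (meson mult_left_mono order_trans)
  then have "cmod (\<phi> (z + vcnj w) * exp (cdot z (vcnj w) / 2))
     \<le> (fock_norm \<phi> * exp ((norm z + norm w)\<^sup>2 / 4)) * exp ((norm z / 2) * norm w)"
    unfolding norm_mult by (intro mult_mono norm_exp_kernel_le) (auto simp: fock_norm_nonneg)
  also have "\<dots> = (fock_norm \<phi> * exp ((norm z)\<^sup>2 / 4)) * exp ((1/4) * (norm w)\<^sup>2 + norm z * norm w)"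
    unfolding mult.assoc exp_add[symmetric]
    by (rule arg_cong[where f="\<lambda>y. fock_norm \<phi> * exp y"]) (simp add: power2_sum field_simps)
  finally show ?thesis .
qed

text \<open>
  A bounded extension is only known on polynomials. For an exponential of a polynomial growing slower than
  the Gaussian weight the Taylor polynomials converge in the Fock space and are dominated in the defining
  integral, so the extension is still given by that integral.\<close>

lemma extension_on_exponentials:
  fixes \<phi> :: "complex ^ 'n \<Rightarrow> complex"
  assumes \<phi>: "\<phi> \<in> fock_space" and T: "bounded_linear_operator_on_fock T"
    and TP: "\<And>P. hol_polynomial P \<Longrightarrow> T P = S_tilde_op \<phi> P"
    and Q: "hol_polynomial Q" and \<alpha>: "\<alpha> < 1/4"
    and Qle: "\<And>w. cmod (Q w) \<le> \<alpha> * (norm w)\<^sup>2 + \<beta> * norm w + \<gamma>"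
  shows "(\<lambda>z. exp (Q z)) \<in> fock_space" "T (\<lambda>z. exp (Q z)) = S_tilde_op \<phi> (\<lambda>z. exp (Q z))"
proof -
  define F where "F z = exp (Q z)" for z
  define P where "P k z = (\<Sum>j<k. Q z ^ j / fact j)" for k z
  define E where "E w = exp \<gamma> * exp (\<alpha> * (norm w)\<^sup>2 + \<beta> * norm w)" for w :: "complex ^ 'n"
  have eE: "exp (cmod (Q w)) \<le> E w" for w
    using Qle[of w] by (simp add: E_def exp_add[symmetric] algebra_simps)
  have FE: "cmod (F w) \<le> E w" for w
    using eE[of w] complex_Re_le_cmod[of "Q w"] unfolding F_def by (simp add: order_trans[rotated])
  have PE: "cmod (P k w) \<le> E w" for k w
    using order_trans[OF norm_exp_partial_sum_le eE] by (simp add: P_def)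
  have PF: "(\<lambda>k. P k w) \<longlonglongrightarrow> F w" for w
    unfolding P_def F_def by (rule exp_partial_sums_limit)
  have polP: "hol_polynomial (P k)" for k
  proof -
    have "hol_polynomial (\<lambda>z. \<Sum>j<k. (1 / fact j) * Q z ^ j)"
      by (intro hol_polynomial_sum hol_polynomial_mult hol_polynomial_const hol_polynomial_power Q finite_lessThan)
    then show ?thesis by (simp add: P_def[abs_def])
  qed
  have eP: "entire (P k)" for k using polP by (rule hol_polynomial_entire)
  have eF: "entire F" unfolding F_def[abs_def] by (intro entire_exp hol_polynomial_entire Q)
  have [measurable]: "P k \<in> borel_measurable borel" "F \<in> borel_measurable borel" "\<phi> \<in> borel_measurable borel" for k
    using eP eF fock_spaceD(1)[OF \<phi>] by (auto intro: entire_measurable)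
  have [measurable]: "E \<in> borel_measurable borel" unfolding E_def by measurable
  have fF: "F \<in> fock_space"
    by (rule fock_spaceI[OF eF square_integrable_gauss_bound[where C="exp \<gamma>" and \<alpha>=\<alpha> and \<beta>=\<beta>]])
      (use \<alpha> FE in \<open>auto simp: E_def\<close>)
  have fP: "P k \<in> fock_space" for k
    by (rule fock_spaceI[OF eP square_integrable_gauss_bound[where C="exp \<gamma>" and \<alpha>=\<alpha> and \<beta>=\<beta>]])
      (use \<alpha> PE in \<open>auto simp: E_def\<close>)
  define D where "D k z = 1 * F z + (-1) * P k z" for k z
  have eD: "entire (D k)" for k unfolding D_def[abs_def] by (intro entire_add entire_cmult eF eP)
  have DE: "cmod (D k w) \<le> 2 * E w" for k w
    using FE[of w] PE[of k w] norm_triangle_ineq4[of "F w" "P k w"] by (simp add: D_def)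
  have fD: "D k \<in> fock_space" for k
    by (rule fock_spaceI[OF eD square_integrable_gauss_bound[where C="2 * exp \<gamma>" and \<alpha>=\<alpha> and \<beta>=\<beta>]])
      (use \<alpha> DE entire_measurable[OF eD] in \<open>auto simp: E_def mult.assoc\<close>)
  have "(\<lambda>k. LINT w|gauss_measure. (cmod (D k w))\<^sup>2) \<longlonglongrightarrow> (LINT w|(gauss_measure :: (complex ^ 'n) measure). 0 :: real)"
  proof (rule integral_dominated_convergence[where w="\<lambda>w. (2 * E w)\<^sup>2"])
    have "(\<lambda>k. (cmod (D k w))\<^sup>2) \<longlonglongrightarrow> (cmod (1 * F w + (-1) * F w))\<^sup>2" for w
      unfolding D_def by (intro tendsto_intros PF)
    then show "AE w in gauss_measure. (\<lambda>k. (cmod (D k w))\<^sup>2) \<longlonglongrightarrow> 0" by simp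
    have "(2 * E w)\<^sup>2 = (2 * exp \<gamma>)\<^sup>2 * exp ((2 * \<alpha>) * (norm w)\<^sup>2 + (2 * \<beta>) * norm w)" for w
      by (simp add: E_def power_mult_distrib exp_double[symmetric] algebra_simps)
    then show "integrable gauss_measure (\<lambda>w. (2 * E w)\<^sup>2)"
      using \<alpha> by (simp only:) (intro integrable_mult_right integrable_gauss_exp, simp)
    show "AE w in gauss_measure. norm ((cmod (D k w))\<^sup>2) \<le> (2 * E w)\<^sup>2" for k
    proof (rule AE_I2)
      fix w
      have "(cmod (D k w))\<^sup>2 \<le> (2 * E w)\<^sup>2" by (rule power_mono[OF DE norm_ge_zero])
      then show "norm ((cmod (D k w))\<^sup>2) \<le> (2 * E w)\<^sup>2" by (simp only: real_norm_def abs_power2)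
    qed
  qed (use entire_measurable[OF eD] in measurable)
  then have "(\<lambda>k. sqrt (norm_sq gauss_measure (D k))) \<longlonglongrightarrow> 0"
    using tendsto_real_sqrt by fastforce
  then have normD: "(\<lambda>k. fock_norm (D k)) \<longlonglongrightarrow> 0" by (simp add: fock_norm_def)
  obtain C where C: "\<And>F. F \<in> fock_space \<Longrightarrow> fock_norm (T F) \<le> C * fock_norm F"
    using T unfolding bounded_linear_operator_on_fock_def by blast
  have TF: "T F \<in> fock_space" if "F \<in> fock_space" for F
    using T that unfolding bounded_linear_operator_on_fock_def by blast
  have "T F z = S_tilde_op \<phi> F z" for z
  proof -
    have TD: "T (D k) z = T F z - T (P k) z" for k
    proof -
      have "T (D k) = (\<lambda>z. 1 * T F z + (-1) * T (P k) z)"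
        using T fF fP unfolding bounded_linear_operator_on_fock_def D_def[abs_def] by blast
      then show ?thesis by simp
    qed
    have "(\<lambda>k. T F z - T (P k) z) \<longlonglongrightarrow> 0"
    proof (rule Lim_null_comparison)
      show "\<forall>\<^sub>F k in sequentially. norm (T F z - T (P k) z) \<le> (C * fock_norm (D k)) * exp ((norm z)\<^sup>2 / 4)"
      proof (rule always_eventually, rule allI)
        fix k
        have "norm (T F z - T (P k) z) \<le> fock_norm (T (D k)) * exp ((norm z)\<^sup>2 / 4)"
          unfolding TD[symmetric] by (rule fock_pointwise_bound[OF TF[OF fD]])
        also have "\<dots> \<le> (C * fock_norm (D k)) * exp ((norm z)\<^sup>2 / 4)"
          by (intro mult_right_mono C fD) simp
        finally show "norm (T F z - T (P k) z) \<le> (C * fock_norm (D k)) * exp ((norm z)\<^sup>2 / 4)" .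
      qed
      show "(\<lambda>k. (C * fock_norm (D k)) * exp ((norm z)\<^sup>2 / 4)) \<longlonglongrightarrow> 0"
        using tendsto_mult_left_zero[OF tendsto_mult_right_zero[OF normD]] .
    qed
    from tendsto_diff[OF tendsto_const[of "T F z"] this]
    have 1: "(\<lambda>k. T (P k) z) \<longlonglongrightarrow> T F z" by simp
    have "(\<lambda>k. LINT w|gauss_measure. P k w * \<phi> (z + vcnj w) * exp (cdot z (vcnj w) / 2))
       \<longlonglongrightarrow> (LINT w|gauss_measure. F w * \<phi> (z + vcnj w) * exp (cdot z (vcnj w) / 2))"
    proof (rule integral_dominated_convergence)
      show "AE w in gauss_measure. (\<lambda>k. P k w * \<phi> (z + vcnj w) * exp (cdot z (vcnj w) / 2))
         \<longlonglongrightarrow> F w * \<phi> (z + vcnj w) * exp (cdot z (vcnj w) / 2)"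
        by (intro AE_I2 tendsto_mult PF tendsto_const)
      define A where "A = fock_norm \<phi> * exp ((norm z)\<^sup>2 / 4)"
      show "integrable gauss_measure (\<lambda>w. (exp \<gamma> * A) * exp ((\<alpha> + 1/4) * (norm w)\<^sup>2 + (\<beta> + norm z) * norm w))"
        using \<alpha> by (intro integrable_mult_right integrable_gauss_exp) simp
      show "AE w in gauss_measure. norm (P k w * \<phi> (z + vcnj w) * exp (cdot z (vcnj w) / 2))
         \<le> (exp \<gamma> * A) * exp ((\<alpha> + 1/4) * (norm w)\<^sup>2 + (\<beta> + norm z) * norm w)" for k
      proof (rule AE_I2)
        fix w
        have "norm (P k w * \<phi> (z + vcnj w) * exp (cdot z (vcnj w) / 2))
          \<le> E w * (A * exp ((1/4) * (norm w)\<^sup>2 + norm z * norm w))"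
          unfolding mult.assoc norm_mult[of "P k w"] unfolding A_def
          by (intro mult_mono PE fock_shift_bound[OF \<phi>]) (auto simp: E_def)
        also have "\<dots> = (exp \<gamma> * A) * exp ((\<alpha> + 1/4) * (norm w)\<^sup>2 + (\<beta> + norm z) * norm w)"
          by (simp add: E_def exp_add[symmetric] algebra_simps)
        finally show "norm (P k w * \<phi> (z + vcnj w) * exp (cdot z (vcnj w) / 2))
         \<le> (exp \<gamma> * A) * exp ((\<alpha> + 1/4) * (norm w)\<^sup>2 + (\<beta> + norm z) * norm w)" .
      qed
    qed measurable
    then have "(\<lambda>k. T (P k) z) \<longlonglongrightarrow> S_tilde_op \<phi> F z"
      unfolding TP[OF polP] S_tilde_op_def .
    with 1 show ?thesis by (rule LIMSEQ_unique)
  qed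
  then show "(\<lambda>z. exp (Q z)) \<in> fock_space" "T (\<lambda>z. exp (Q z)) = S_tilde_op \<phi> (\<lambda>z. exp (Q z))"
    using fF by (auto simp: F_def[abs_def])
qed

section \<open>Functions with nonnegative Gaussian averages\<close>

lemma integral_lborel_affine:
  fixes f :: "'a::euclidean_space \<Rightarrow> 'b::{banach, second_countable_topology}"
  assumes [measurable]: "f \<in> borel_measurable borel" and t: "t > 0"
  shows "(LINT x|lborel. f x) = t ^ DIM('a) *\<^sub>R (LINT y|lborel. f (a + t *\<^sub>R y))"
proof -
  have "lborel = density (distr lborel borel (\<lambda>x::'a. a + t *\<^sub>R x)) (\<lambda>_. ennreal (t ^ DIM('a)))"
    using lborel_affine[of t a] t by simp
  then have "(LINT x|lborel. f x)
      = (LINT x|density (distr lborel borel (\<lambda>x::'a. a + t *\<^sub>R x)) (\<lambda>_. ennreal (t ^ DIM('a))). f x)"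
    by metis
  also have "\<dots> = (LINT x|distr lborel borel (\<lambda>x::'a. a + t *\<^sub>R x). t ^ DIM('a) *\<^sub>R f x)"
    using t by (subst integral_density) auto
  also have "\<dots> = (LINT y|lborel. t ^ DIM('a) *\<^sub>R f (a + t *\<^sub>R y))"
    by (subst integral_distr) auto
  finally show ?thesis by simp
qed

text \<open>
  Integrating the hypothesis against \<open>h\<close> and exchanging the integrals replaces \<open>h\<close> by its average over a
  Gaussian of width \<open>t\<close>; these averages tend to a multiple of \<open>h\<close> as \<open>t\<close> tends to 0.\<close>

lemma Gaussian_averages_test:
  fixes r :: "'a::euclidean_space \<Rightarrow> real"
  assumes r: "integrable lborel r"
    and pos: "\<And>x t. t > 0 \<Longrightarrow> 0 \<le> (LINT \<xi>|lborel. r \<xi> * exp (- (norm (x - \<xi>))\<^sup>2 / t\<^sup>2))"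
    and cont: "continuous_on UNIV h" and h01: "\<And>x. 0 \<le> h x" "\<And>x. h x \<le> 1" and ih: "integrable lborel h"
  shows "0 \<le> (LINT \<xi>|lborel. r \<xi> * h \<xi>)"
proof -
  have [measurable]: "r \<in> borel_measurable borel" using borel_measurable_integrable[OF r] by simp
  have [measurable]: "h \<in> borel_measurable borel" using cont by (rule borel_measurable_continuous_onI)
  define W where "W = (LINT y|lborel. exp (- 1 * (norm (y::'a))\<^sup>2))"
  have W: "W > 0" unfolding W_def by (subst integral_gaussian) auto
  have iW: "integrable lborel (\<lambda>y::'a. exp (- 1 * (norm y)\<^sup>2))" by (rule integrable_gaussian) simp
  define K where "K t \<xi> = (LINT y|lborel. h (\<xi> + t *\<^sub>R y) * exp (- 1 * (norm y)\<^sup>2))" for t \<xi>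
  have iK: "integrable lborel (\<lambda>y. h (\<xi> + t *\<^sub>R y) * exp (- 1 * (norm y)\<^sup>2))" for t \<xi>
    by (rule Bochner_Integration.integrable_bound[OF iW])
      (use h01 in \<open>auto simp: abs_mult mult_left_le_one_le\<close>)
  have K01: "\<bar>K t \<xi>\<bar> \<le> W" for t \<xi>
  proof -
    have "K t \<xi> \<ge> 0" unfolding K_def by (intro integral_nonneg_AE AE_I2 mult_nonneg_nonneg h01) simp
    moreover have "K t \<xi> \<le> W" unfolding K_def W_def
      by (rule integral_mono[OF iK iW]) (use h01 in \<open>simp add: mult_left_le_one_le\<close>)
    ultimately show ?thesis by simp
  qed
  have mK [measurable]: "K t \<in> borel_measurable borel" for t
    unfolding K_def[abs_def] by (rule lborel.borel_measurable_lebesgue_integral) measurable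
  have nonneg: "0 \<le> (LINT \<xi>|lborel. r \<xi> * K t \<xi>)" if t: "t > 0" for t
  proof -
    have "0 \<le> (LINT x|lborel. LINT \<xi>|lborel. h x * (r \<xi> * exp (- (norm (x - \<xi>))\<^sup>2 / t\<^sup>2)))"
      unfolding integral_mult_right_zero
      by (intro integral_nonneg_AE AE_I2 mult_nonneg_nonneg h01 pos[OF t])
    also have "\<dots> = (LINT \<xi>|lborel. LINT x|lborel. h x * (r \<xi> * exp (- (norm (x - \<xi>))\<^sup>2 / t\<^sup>2)))"
    proof (rule integral_exchange_dominated[OF lborel.sigma_finite_measure_axioms lborel.sigma_finite_measure_axioms ih integrable_abs[OF r]])
      show "norm (h x * (r \<xi> * exp (- (norm (x - \<xi>))\<^sup>2 / t\<^sup>2))) \<le> h x * \<bar>r \<xi>\<bar>" for x \<xi>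
        using h01[of x] by (simp add: abs_mult mult_left_mono mult_left_le)
    qed (simp add: split_beta, measurable)
    also have "\<dots> = (LINT \<xi>|lborel. t ^ DIM('a) * (r \<xi> * K t \<xi>))"
    proof (intro Bochner_Integration.integral_cong refl)
      fix \<xi>
      have "(LINT x|lborel. h x * (r \<xi> * exp (- (norm (x - \<xi>))\<^sup>2 / t\<^sup>2)))
          = t ^ DIM('a) *\<^sub>R (LINT y|lborel. h (\<xi> + t *\<^sub>R y) * (r \<xi> * exp (- (norm ((\<xi> + t *\<^sub>R y) - \<xi>))\<^sup>2 / t\<^sup>2)))"
        by (rule integral_lborel_affine[OF _ t]) measurable
      also have "(\<lambda>y. h (\<xi> + t *\<^sub>R y) * (r \<xi> * exp (- (norm ((\<xi> + t *\<^sub>R y) - \<xi>))\<^sup>2 / t\<^sup>2)))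
          = (\<lambda>y. r \<xi> * (h (\<xi> + t *\<^sub>R y) * exp (- 1 * (norm y)\<^sup>2)))"
        using t by (simp add: fun_eq_iff power_mult_distrib)
      finally show "(LINT x|lborel. h x * (r \<xi> * exp (- (norm (x - \<xi>))\<^sup>2 / t\<^sup>2))) = t ^ DIM('a) * (r \<xi> * K t \<xi>)"
        by (simp add: K_def)
    qed
    also have "\<dots> = t ^ DIM('a) * (LINT \<xi>|lborel. r \<xi> * K t \<xi>)" by simp
    finally have "0 \<le> t ^ DIM('a) * (LINT \<xi>|lborel. r \<xi> * K t \<xi>)" .
    moreover have p: "0 < t ^ DIM('a)" using t by simp
    ultimately show ?thesis
      using mult_le_cancel_left_pos[OF p, of 0 "LINT \<xi>|lborel. r \<xi> * K t \<xi>"]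
      by (simp only: mult_zero_right)
  qed
  have limK: "(\<lambda>k. K (1 / real (Suc k)) \<xi>) \<longlonglongrightarrow> h \<xi> * W" for \<xi>
  proof -
    have "(\<lambda>k. K (1 / real (Suc k)) \<xi>) \<longlonglongrightarrow> (LINT y|lborel. h \<xi> * exp (- 1 * (norm (y::'a))\<^sup>2))"
      unfolding K_def
    proof (rule integral_dominated_convergence[OF _ _ iW])
      have "(\<lambda>k. h (\<xi> + (1 / real (Suc k)) *\<^sub>R y)) \<longlonglongrightarrow> h \<xi>" for y
      proof (rule isCont_tendsto_compose[where g=h and l=\<xi>])
        show "isCont h \<xi>" using cont by (simp add: continuous_on_eq_continuous_at)
        have "(\<lambda>k. \<xi> + (1 / real (Suc k)) *\<^sub>R y) \<longlonglongrightarrow> \<xi> + 0 *\<^sub>R y"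
          using LIMSEQ_inverse_real_of_nat by (intro tendsto_intros) (simp add: inverse_eq_divide)
        then show "(\<lambda>k. \<xi> + (1 / real (Suc k)) *\<^sub>R y) \<longlonglongrightarrow> \<xi>" by simp
      qed
      then show "AE y in lborel. (\<lambda>k. h (\<xi> + (1 / real (Suc k)) *\<^sub>R y) * exp (- 1 * (norm y)\<^sup>2)) \<longlonglongrightarrow> h \<xi> * exp (- 1 * (norm y)\<^sup>2)"
        by (intro AE_I2 tendsto_mult tendsto_const)
      show "AE y in lborel. norm (h (\<xi> + (1 / real (Suc k)) *\<^sub>R y) * exp (- 1 * (norm y)\<^sup>2)) \<le> exp (- 1 * (norm y)\<^sup>2)" for k
        using h01 by (intro AE_I2) (simp add: abs_mult mult_left_le_one_le)
    qed measurable
    then show ?thesis unfolding W_def by simp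
  qed
  have "(\<lambda>k. LINT \<xi>|lborel. r \<xi> * K (1 / real (Suc k)) \<xi>) \<longlonglongrightarrow> (LINT \<xi>|lborel. r \<xi> * (h \<xi> * W))"
  proof (rule integral_dominated_convergence[where w="\<lambda>\<xi>. \<bar>r \<xi>\<bar> * W"])
    show "integrable lborel (\<lambda>\<xi>. \<bar>r \<xi>\<bar> * W)" using r by simp
    show "AE \<xi> in lborel. (\<lambda>k. r \<xi> * K (1 / real (Suc k)) \<xi>) \<longlonglongrightarrow> r \<xi> * (h \<xi> * W)"
      by (intro AE_I2 tendsto_mult tendsto_const limK)
    show "AE \<xi> in lborel. norm (r \<xi> * K (1 / real (Suc k)) \<xi>) \<le> \<bar>r \<xi>\<bar> * W" for k
      using K01 by (intro AE_I2) (simp add: abs_mult mult_left_mono)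
  qed measurable
  then have "0 \<le> (LINT \<xi>|lborel. r \<xi> * (h \<xi> * W))"
    by (rule LIMSEQ_le_const) (use nonneg in auto)
  also have "\<dots> = (LINT \<xi>|lborel. r \<xi> * h \<xi>) * W"
    unfolding mult.assoc[symmetric] by simp
  finally show ?thesis using W by (simp add: zero_le_mult_iff)
qed

text \<open>
  The indicator of \<open>{\<xi>. r \<xi> < 0}\<close> is an almost everywhere limit of continuous functions, which become
  integrable test functions after multiplication by a positive weight.\<close>

lemma AE_nonneg_if_Gaussian_averages_nonneg:
  fixes r :: "'a::euclidean_space \<Rightarrow> real"
  assumes r: "integrable lborel r"
    and pos: "\<And>x t. t > 0 \<Longrightarrow> 0 \<le> (LINT \<xi>|lborel. r \<xi> * exp (- (norm (x - \<xi>))\<^sup>2 / t\<^sup>2))"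
  shows "AE \<xi> in lborel. 0 \<le> r \<xi>"
proof -
  have [measurable]: "r \<in> borel_measurable borel" using borel_measurable_integrable[OF r] by simp
  define A where "A = {\<xi>. r \<xi> < 0}"
  have A [measurable]: "A \<in> sets borel" unfolding A_def by measurable
  define w where "w \<xi> = exp (- 1 * (norm \<xi>)\<^sup>2)" for \<xi> :: 'a
  have w: "w \<xi> > 0" "w \<xi> \<le> 1" for \<xi> by (simp_all add: w_def)
  have cw: "continuous_on UNIV w" unfolding w_def by (intro continuous_intros)
  have iw: "integrable lborel w" unfolding w_def by (rule integrable_gaussian) simp
  have [measurable]: "w \<in> borel_measurable borel" using cw by (rule borel_measurable_continuous_onI)
  have "(\<lambda>x. indicator A x :: real) \<in> borel_measurable (lebesgue_on UNIV)"
    by (simp add: lebesgue_on_UNIV_eq) (intro borel_measurable_indicator, simp)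
  then have "(\<lambda>x. indicator A x :: real) measurable_on UNIV"
    by (subst measurable_on_iff_borel_measurable) auto
  then obtain N g where N: "negligible N" and g: "\<And>n. continuous_on UNIV (g n :: 'a \<Rightarrow> real)"
    and lim: "\<And>x. x \<notin> N \<Longrightarrow> (\<lambda>n. g n x) \<longlonglongrightarrow> indicator A x"
    unfolding measurable_on_def by auto
  have AEN: "AE x in lborel. x \<notin> N"
  proof -
    have "AE x in lebesgue. x \<notin> N"
      using N by (intro AE_not_in) (simp add: negligible_iff_null_sets)
    then show ?thesis by (simp add: AE_completion_iff)
  qed
  define h where "h n x = max 0 (min 1 (g n x)) * w x" for n x
  have ch: "continuous_on UNIV (h n)" for n
    unfolding h_def by (intro continuous_intros g cw)
  have h01: "0 \<le> h n x" "h n x \<le> w x" for n x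
    using w[of x] by (auto simp: h_def mult_le_cancel_right1)
  have [measurable]: "h n \<in> borel_measurable borel" for n using ch by (rule borel_measurable_continuous_onI)
  have ih: "integrable lborel (h n)" for n
    by (rule Bochner_Integration.integrable_bound[OF iw]) (auto simp: h01 less_imp_le[OF w(1)])
  have nn: "0 \<le> (LINT \<xi>|lborel. r \<xi> * h n \<xi>)" for n
    by (rule Gaussian_averages_test[OF r pos ch _ _ ih]) (use h01 w order_trans in blast)+
  have "(\<lambda>n. LINT \<xi>|lborel. r \<xi> * h n \<xi>) \<longlonglongrightarrow> (LINT \<xi>|lborel. r \<xi> * (indicator A \<xi> * w \<xi>))"
  proof (rule integral_dominated_convergence[OF _ _ integrable_abs[OF r]])
    show "AE \<xi> in lborel. (\<lambda>n. r \<xi> * h n \<xi>) \<longlonglongrightarrow> r \<xi> * (indicator A \<xi> * w \<xi>)"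
      using AEN
    proof eventually_elim
      case (elim \<xi>)
      have "(\<lambda>n. r \<xi> * h n \<xi>) \<longlonglongrightarrow> r \<xi> * (max 0 (min 1 (indicator A \<xi>)) * w \<xi>)"
        unfolding h_def by (intro tendsto_intros lim elim)
      then show ?case by (simp split: split_indicator)
    qed
    show "AE \<xi> in lborel. norm (r \<xi> * h n \<xi>) \<le> \<bar>r \<xi>\<bar>" for n
    proof (rule AE_I2)
      fix \<xi>
      have "\<bar>h n \<xi>\<bar> \<le> 1" using h01[of n \<xi>] w[of \<xi>] by simp
      then show "norm (r \<xi> * h n \<xi>) \<le> \<bar>r \<xi>\<bar>" by (simp add: abs_mult mult_left_le)
    qed
  qed measurable
  then have ge: "0 \<le> (LINT \<xi>|lborel. r \<xi> * (indicator A \<xi> * w \<xi>))"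
    by (rule LIMSEQ_le_const) (use nn in auto)
  have le: "r \<xi> * (indicator A \<xi> * w \<xi>) \<le> 0" for \<xi>
    using w[of \<xi>] by (auto simp: A_def mult_le_0_iff split: split_indicator)
  have int: "integrable lborel (\<lambda>\<xi>. r \<xi> * (indicator A \<xi> * w \<xi>))"
    by (rule Bochner_Integration.integrable_bound[OF r])
      (use w in \<open>auto simp: abs_mult mult_left_le less_imp_le split: split_indicator\<close>)
  have "(LINT \<xi>|lborel. - (r \<xi> * (indicator A \<xi> * w \<xi>))) = 0"
    using ge integral_nonneg_AE[of "\<lambda>\<xi>. - (r \<xi> * (indicator A \<xi> * w \<xi>))" lborel] le by simp
  then have "AE \<xi> in lborel. - (r \<xi> * (indicator A \<xi> * w \<xi>)) = 0"
    by (subst (asm) integral_nonneg_eq_0_iff_AE) (use int le in auto)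
  then show ?thesis
  proof eventually_elim
    case (elim \<xi>)
    show ?case
    proof (rule ccontr)
      assume "\<not> 0 \<le> r \<xi>"
      then have "\<xi> \<in> A" "r \<xi> \<noteq> 0" by (auto simp: A_def)
      with elim w[of \<xi>] show False by simp
    qed
  qed
qed

lemma AE_norm_le_if_Gaussian_averages_le:
  fixes v :: "'a::euclidean_space \<Rightarrow> complex" and E :: "'a \<Rightarrow> real"
  assumes v: "integrable lborel v" and E: "integrable lborel E"
    and le: "\<And>x t. t > 0 \<Longrightarrow> cmod (LINT \<xi>|lborel. v \<xi> * complex_of_real (exp (- (norm (x - \<xi>))\<^sup>2 / t\<^sup>2)))
      \<le> (LINT \<xi>|lborel. E \<xi> * exp (- (norm (x - \<xi>))\<^sup>2 / t\<^sup>2))"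
  shows "AE \<xi> in lborel. cmod (v \<xi>) \<le> 2 * E \<xi>"
proof -
  have dir: "AE \<xi> in lborel. Re (c * v \<xi>) \<le> E \<xi>" if c: "cmod c = 1" for c
  proof -
    have iR: "integrable lborel (\<lambda>\<xi>. Re (c * v \<xi>))" using v by (intro integrable_Re integrable_mult_right)
    have "AE \<xi> in lborel. 0 \<le> E \<xi> - Re (c * v \<xi>)"
    proof (rule AE_nonneg_if_Gaussian_averages_nonneg)
      show "integrable lborel (\<lambda>\<xi>. E \<xi> - Re (c * v \<xi>))" using E iR by simp
      fix x :: 'a and t :: real assume t: "t > 0"
      define e where "e \<xi> = exp (- (norm (x - \<xi>))\<^sup>2 / t\<^sup>2)" for \<xi>
      have e: "0 \<le> e \<xi>" "e \<xi> \<le> 1" for \<xi> by (simp_all add: e_def)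
      have [measurable]: "e \<in> borel_measurable borel" unfolding e_def by measurable
      have ive: "integrable lborel (\<lambda>\<xi>. v \<xi> * complex_of_real (e \<xi>))"
        by (rule Bochner_Integration.integrable_bound[OF v])
          (use e v borel_measurable_integrable[OF v] in \<open>auto simp: norm_mult mult_left_le\<close>)
      have iEe: "integrable lborel (\<lambda>\<xi>. E \<xi> * e \<xi>)"
        by (rule Bochner_Integration.integrable_bound[OF E])
          (use e borel_measurable_integrable[OF E] in \<open>auto simp: abs_mult mult_left_le\<close>)
      have ire: "integrable lborel (\<lambda>\<xi>. Re (c * (v \<xi> * complex_of_real (e \<xi>))))"
        using ive by (intro integrable_Re integrable_mult_right)
      have "Re (c * (LINT \<xi>|lborel. v \<xi> * complex_of_real (e \<xi>))) \<le> (LINT \<xi>|lborel. E \<xi> * e \<xi>)"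
        using le[OF t, of x] complex_Re_le_cmod[of "c * (LINT \<xi>|lborel. v \<xi> * complex_of_real (e \<xi>))"] c
        by (simp add: norm_mult e_def)
      moreover have "Re (c * (LINT \<xi>|lborel. v \<xi> * complex_of_real (e \<xi>)))
          = (LINT \<xi>|lborel. Re (c * (v \<xi> * complex_of_real (e \<xi>))))"
        using ive by (subst integral_Re) (auto simp: integrable_mult_right)
      ultimately have "0 \<le> (LINT \<xi>|lborel. E \<xi> * e \<xi> - Re (c * (v \<xi> * complex_of_real (e \<xi>))))"
        using iEe ire by simp
      also have "(\<lambda>\<xi>. E \<xi> * e \<xi> - Re (c * (v \<xi> * complex_of_real (e \<xi>)))) = (\<lambda>\<xi>. (E \<xi> - Re (c * v \<xi>)) * e \<xi>)"
        by (simp add: fun_eq_iff algebra_simps)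
      finally show "0 \<le> (LINT \<xi>|lborel. (E \<xi> - Re (c * v \<xi>)) * exp (- (norm (x - \<xi>))\<^sup>2 / t\<^sup>2))"
        by (simp add: e_def)
    qed
    then show ?thesis by simp
  qed
  have "AE \<xi> in lborel. Re (v \<xi>) \<le> E \<xi>" "AE \<xi> in lborel. - Re (v \<xi>) \<le> E \<xi>"
    "AE \<xi> in lborel. - Im (v \<xi>) \<le> E \<xi>" "AE \<xi> in lborel. Im (v \<xi>) \<le> E \<xi>"
    using dir[of 1] dir[of "-1"] dir[of "\<i>"] dir[of "- \<i>"] by simp_all
  then show ?thesis
  proof eventually_elim
    case (elim \<xi>)
    then show ?case using cmod_le[of "v \<xi>"] by linarith
  qed
qed

section \<open>Gaussian test functions\<close>

text \<open>
  Up to a constant \<open>testfun x \<eta>\<close> is the Bargmann transform of \<open>exp (- (norm \<xi>)\<^sup>2 / 2 - (norm (x - \<xi>))\<^sup>2 / \<eta>)\<close>,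
  which for small \<open>\<eta>\<close> is concentrated at \<open>x\<close>. Up to another constant it is the superposition with weights
  \<open>testweight x \<eta> s\<close> of the reproducing kernels at the imaginary points \<open>\<i> *s vcomplex s\<close>.\<close>

definition testfun :: "real ^ 'n \<Rightarrow> real \<Rightarrow> complex ^ 'n \<Rightarrow> complex" where
  "testfun x \<eta> z = exp (complex_of_real (- 1 / (1 + \<eta>)) * csq (vcomplex x - (1/2) *s z))"

definition testweight :: "real ^ 'n \<Rightarrow> real \<Rightarrow> real ^ 'n \<Rightarrow> complex" where
  "testweight x \<eta> s = exp (- complex_of_real (((1 + \<eta>) / 4) * (norm s)\<^sup>2) + \<i> * complex_of_real (s \<bullet> x))"

lemma measurable_testweight [measurable]: "testweight x \<eta> \<in> borel_measurable borel"
  unfolding testweight_def by measurable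

lemma norm_testweight: "cmod (testweight x \<eta> s) = exp (- ((1 + \<eta>) / 4) * (norm s)\<^sup>2)"
  by (simp add: testweight_def Re_power2 del: of_real_power)

lemma testfun_superposition:
  fixes x :: "real ^ 'n"
  assumes \<eta>: "\<eta> > 0"
  shows "complex_of_real (sqrt (pi / ((1 + \<eta>) / 4)) ^ CARD('n)) * testfun x \<eta> z
     = (LINT s|lborel. testweight x \<eta> s * exp (cdot z (vcnj (\<i> *s vcomplex s)) / 2))"
proof -
  have a: "(1 + \<eta>) / 4 > 0" using \<eta> by simp
  define v where "v = \<i> *s (vcomplex x - (1/2) *s z)"
  have e: "testweight x \<eta> s * exp (cdot z (vcnj (\<i> *s vcomplex s)) / 2)
     = exp (- complex_of_real (((1 + \<eta>) / 4) * (norm s)\<^sup>2) + cdot (vcomplex s) v)" for s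
    unfolding testweight_def exp_add[symmetric] v_def
    by (rule arg_cong[where f=exp]) (simp add: cdot_simps cdot_vcomplex cdot_commute[of z] algebra_simps)
  have "csq v / complex_of_real (4 * ((1 + \<eta>) / 4)) = complex_of_real (- 1 / (1 + \<eta>)) * csq (vcomplex x - (1/2) *s z)"
  proof -
    have "csq v = - csq (vcomplex x - (1/2) *s z)" unfolding v_def csq_smult by simp
    moreover have "4 * ((1 + \<eta>) / 4) = 1 + \<eta>" by simp
    ultimately show ?thesis by (simp only:) simp
  qed
  then show ?thesis unfolding e Laplace_gaussian[OF a] testfun_def by simp
qed

lemma bkernel_superposition:
  fixes x :: "real ^ 'n"
  assumes \<eta>: "\<eta> > 0"
  shows "(LINT s|lborel. testweight x \<eta> s * cnj (bkernel (\<i> *s vcomplex s) \<xi>))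
     = complex_of_real (sqrt (pi / (\<eta> / 4)) ^ CARD('n) * exp (- (norm \<xi>)\<^sup>2 / 2) * exp (- (norm (x - \<xi>))\<^sup>2 / \<eta>))"
proof -
  have a: "\<eta> / 4 > 0" using \<eta> by simp
  define v where "v = \<i> *s vcomplex (x - \<xi>)"
  have vd: "vcomplex (x - \<xi>) = vcomplex x - vcomplex \<xi>" by (simp add: vcomplex_def vec_eq_iff)
  have e: "testweight x \<eta> s * cnj (bkernel (\<i> *s vcomplex s) \<xi>)
     = exp (- complex_of_real ((\<eta> / 4) * (norm s)\<^sup>2) + cdot (vcomplex s) v) * complex_of_real (exp (- (norm \<xi>)\<^sup>2 / 2))" for s
    unfolding testweight_def bkernel_def exp_cnj exp_of_real[symmetric] exp_add[symmetric] v_def vd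
    by (rule arg_cong[where f=exp])
      (simp add: cnj_cdot cnj_csq csq_smult csq_vcomplex cdot_simps cdot_vcomplex inner_commute[of \<xi> s] field_simps)
  have "csq v / complex_of_real (4 * (\<eta> / 4)) = complex_of_real (- (norm (x - \<xi>))\<^sup>2 / \<eta>)"
    by (simp add: v_def csq_smult csq_vcomplex)
  from this[THEN arg_cong[where f=exp]]
  have E: "exp (csq v / complex_of_real (4 * (\<eta> / 4))) = complex_of_real (exp (- (norm (x - \<xi>))\<^sup>2 / \<eta>))"
    unfolding exp_of_real .
  show ?thesis
    unfolding e integral_mult_left_zero Laplace_gaussian[OF a] E of_real_mult[symmetric]
    by (simp only: mult_ac)
qed

lemma norm_bkernel_imag: "cmod (bkernel (\<i> *s vcomplex s) \<xi>) = exp (- (norm \<xi>)\<^sup>2 / 2) * exp ((norm s)\<^sup>2 / 4)"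
proof -
  have "Re (- complex_of_real ((norm \<xi>)\<^sup>2 / 2) + cdot (vcomplex \<xi>) (\<i> *s vcomplex s) - csq (\<i> *s vcomplex s) / 4)
      = - (norm \<xi>)\<^sup>2 / 2 + (norm s)\<^sup>2 / 4"
    unfolding csq_smult csq_vcomplex cdot_smult_right cdot_vcomplex
    by (simp del: of_real_power of_real_divide of_real_mult)
  then show ?thesis unfolding bkernel_def exp_add[symmetric] by simp
qed

lemma testfun_bound:
  assumes "\<eta> > 0"
  shows "cmod (complex_of_real (- 1 / (1 + \<eta>)) * csq (vcomplex x - (1/2) *s w))
    \<le> (1 / (4 * (1 + \<eta>))) * (norm w)\<^sup>2 + (norm x / (1 + \<eta>)) * norm w + (norm x)\<^sup>2 / (1 + \<eta>)"
proof -
  have "norm (vcomplex x - (1/2) *s w) \<le> norm x + norm w / 2"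
    using norm_triangle_ineq4[of "vcomplex x" "(1/2) *s w"] by simp
  then have "(norm (vcomplex x - (1/2) *s w))\<^sup>2 \<le> (norm x + norm w / 2)\<^sup>2"
    by (intro power_mono) auto
  then have "cmod (csq (vcomplex x - (1/2) *s w)) \<le> (norm x + norm w / 2)\<^sup>2"
    using norm_csq_le order_trans by blast
  then have "cmod (csq (vcomplex x - (1/2) *s w)) / (1 + \<eta>) \<le> (norm x + norm w / 2)\<^sup>2 / (1 + \<eta>)"
    using assms by (intro divide_right_mono) auto
  also have "\<dots> = (1 / (4 * (1 + \<eta>))) * (norm w)\<^sup>2 + (norm x / (1 + \<eta>)) * norm w + (norm x)\<^sup>2 / (1 + \<eta>)"
  proof -
    have "(norm x + norm w / 2)\<^sup>2 = (norm w)\<^sup>2 / 4 + norm x * norm w + (norm x)\<^sup>2"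
      by (simp add: power2_eq_square algebra_simps)
    then show ?thesis by (simp add: add_divide_distrib)
  qed
  finally have "cmod (csq (vcomplex x - (1/2) *s w)) / (1 + \<eta>)
    \<le> (1 / (4 * (1 + \<eta>))) * (norm w)\<^sup>2 + (norm x / (1 + \<eta>)) * norm w + (norm x)\<^sup>2 / (1 + \<eta>)" .
  moreover have "cmod (complex_of_real (- 1 / (1 + \<eta>))) = 1 / (1 + \<eta>)"
    using assms by (subst norm_of_real) simp
  ultimately show ?thesis unfolding norm_mult by simp
qed

lemma exp_mult_norm_split:
  fixes a b :: real
  assumes "\<kappa> > 0"
  shows "exp ((a / 2) * b) \<le> exp ((\<kappa> / 4) * a\<^sup>2) * exp ((1 / (4 * \<kappa>)) * b\<^sup>2)"
proof -
  have "0 \<le> (\<kappa> * a - b)\<^sup>2 / (4 * \<kappa>)" using assms by simp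
  also have "\<dots> = (\<kappa> / 4) * a\<^sup>2 + (1 / (4 * \<kappa>)) * b\<^sup>2 - (a / 2) * b"
    using assms by (simp add: power2_diff power2_eq_square field_simps)
  finally show ?thesis unfolding exp_add[symmetric] by simp
qed

text \<open>
  The test function is a superposition of reproducing kernels, so its inner product with \<open>H\<close> is the same
  superposition of the values of \<open>H\<close> at imaginary points.\<close>

lemma inner_testfun:
  fixes H :: "complex ^ 'n \<Rightarrow> complex"
  assumes \<eta>: "\<eta> > 0" and H: "entire H"
    and bound: "\<And>w. cmod (H w) \<le> A * exp ((1/4) * (norm w)\<^sup>2 + \<beta> * norm w)"
  shows "complex_of_real (sqrt (pi / ((1 + \<eta>) / 4)) ^ CARD('n)) * (LINT w|gauss_measure. H w * cnj (testfun x \<eta> w))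
     = (LINT s|lborel. cnj (testweight x \<eta> s) * H (\<i> *s vcomplex s))"
proof -
  interpret g: prob_space "gauss_measure :: (complex ^ 'n) measure" by (rule prob_space_gauss_measure)
  have [measurable]: "H \<in> borel_measurable borel" using H by (rule entire_measurable)
  define c where "c = complex_of_real (sqrt (pi / ((1 + \<eta>) / 4)) ^ CARD('n))"
  \<comment> \<open>In the splitting of \<open>exp (norm s / 2 * norm w)\<close>, \<open>\<kappa> > 1\<close> keeps the growth in \<open>w\<close> below the Gaussian weight
    and \<open>\<kappa> < 1 + \<eta>\<close> keeps the decay of \<open>testweight\<close> in \<open>s\<close>.\<close>
  define \<kappa> where "\<kappa> = 1 + \<eta> / 2"
  have \<kappa>: "\<kappa> > 1" using \<eta> by (simp add: \<kappa>_def)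
  define f where "f w = A * exp ((1/4 + 1 / (4 * \<kappa>)) * (norm w)\<^sup>2 + \<beta> * norm w)" for w :: "complex ^ 'n"
  define q where "q s = exp (- (\<eta> / 8) * (norm s)\<^sup>2)" for s :: "real ^ 'n"
  have "1/4 + 1 / (4 * \<kappa>) < 1/2" using \<kappa> by (simp add: field_simps)
  then have f: "integrable gauss_measure f" unfolding f_def by (intro integrable_mult_right integrable_gauss_exp)
  have q: "integrable lborel q" unfolding q_def using \<eta> by (intro integrable_gaussian) simp
  have A0: "A \<ge> 0" using order_trans[OF norm_ge_zero bound[of 0]] by simp
  have conj: "c * cnj (testfun x \<eta> w) = (LINT s|lborel. cnj (testweight x \<eta> s) * exp (cdot (\<i> *s vcomplex s) (vcnj w) / 2))" for w
  proof -
    have "c * cnj (testfun x \<eta> w) = cnj (c * testfun x \<eta> w)" by (simp add: c_def)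
    also have "\<dots> = (LINT s|lborel. cnj (testweight x \<eta> s * exp (cdot w (vcnj (\<i> *s vcomplex s)) / 2)))"
      unfolding c_def testfun_superposition[OF \<eta>] by (rule cnj_integral)
    finally show ?thesis unfolding complex_cnj_mult cnj_exp_kernel .
  qed
  have "c * (LINT w|gauss_measure. H w * cnj (testfun x \<eta> w))
      = (LINT w|gauss_measure. LINT s|lborel. H w * (cnj (testweight x \<eta> s) * exp (cdot (\<i> *s vcomplex s) (vcnj w) / 2)))"
    unfolding integral_mult_right_zero mult.left_commute[of c] conj[symmetric]
    by (simp only: integral_mult_right_zero[symmetric] mult.left_commute)
  also have "\<dots> = (LINT s|lborel. LINT w|gauss_measure. H w * (cnj (testweight x \<eta> s) * exp (cdot (\<i> *s vcomplex s) (vcnj w) / 2)))"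
  proof (rule integral_exchange_dominated[OF g.sigma_finite_measure_axioms lborel.sigma_finite_measure_axioms f q])
    fix w :: "complex ^ 'n" and s :: "real ^ 'n"
    have k: "cmod (exp (cdot (\<i> *s vcomplex s) (vcnj w) / 2)) \<le> exp ((\<kappa> / 4) * (norm s)\<^sup>2) * exp ((1 / (4 * \<kappa>)) * (norm w)\<^sup>2)"
      using order_trans[OF norm_exp_kernel_le exp_mult_norm_split, of \<kappa> "\<i> *s vcomplex s" w] \<kappa> by simp
    have "cmod (H w * (cnj (testweight x \<eta> s) * exp (cdot (\<i> *s vcomplex s) (vcnj w) / 2)))
       \<le> (A * exp ((1/4) * (norm w)\<^sup>2 + \<beta> * norm w)) * (exp (- ((1 + \<eta>) / 4) * (norm s)\<^sup>2) * (exp ((\<kappa> / 4) * (norm s)\<^sup>2) * exp ((1 / (4 * \<kappa>)) * (norm w)\<^sup>2)))"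
      unfolding norm_mult complex_mod_cnj norm_testweight using A0
      by (intro mult_mono bound k mult_left_mono) auto
    also have "\<dots> = A * exp ((1/4) * (norm w)\<^sup>2 + \<beta> * norm w + (- ((1 + \<eta>) / 4) * (norm s)\<^sup>2 + ((\<kappa> / 4) * (norm s)\<^sup>2 + (1 / (4 * \<kappa>)) * (norm w)\<^sup>2)))"
      by (simp only: exp_add mult.assoc)
    also have "\<dots> = A * exp ((1/4 + 1 / (4 * \<kappa>)) * (norm w)\<^sup>2 + \<beta> * norm w + - (\<eta> / 8) * (norm s)\<^sup>2)"
      by (rule arg_cong[where f="\<lambda>y. A * exp y"]) (simp add: \<kappa>_def algebra_simps add_divide_distrib)
    also have "\<dots> = f w * q s" by (simp only: f_def q_def exp_add mult.assoc)
    finally show "cmod (H w * (cnj (testweight x \<eta> s) * exp (cdot (\<i> *s vcomplex s) (vcnj w) / 2))) \<le> f w * q s" .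
  qed (simp add: split_beta, measurable)
  also have "\<dots> = (LINT s|lborel. cnj (testweight x \<eta> s) * H (\<i> *s vcomplex s))"
  proof (intro Bochner_Integration.integral_cong refl)
    fix s :: "real ^ 'n"
    define y where "y = \<i> *s vcomplex s"
    have "integrable gauss_measure (\<lambda>w. H w * exp (cdot y (vcnj w) / 2))"
    proof (rule Bochner_Integration.integrable_bound)
      show "integrable gauss_measure (\<lambda>w. exp ((\<kappa> / 4) * (norm y)\<^sup>2) * f w)" using f by simp
      have "cmod (H w * exp (cdot y (vcnj w) / 2)) \<le> (A * exp ((1/4) * (norm w)\<^sup>2 + \<beta> * norm w)) * (exp ((\<kappa> / 4) * (norm y)\<^sup>2) * exp ((1 / (4 * \<kappa>)) * (norm w)\<^sup>2))" for w
        unfolding norm_mult using A0 \<kappa>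
        by (intro mult_mono bound order_trans[OF norm_exp_kernel_le exp_mult_norm_split]) auto
      also have "\<dots> w = exp ((\<kappa> / 4) * (norm y)\<^sup>2) * f w" for w
        by (simp add: f_def exp_add ring_distribs mult_ac)
      finally show "AE w in gauss_measure. norm (H w * exp (cdot y (vcnj w) / 2)) \<le> norm (exp ((\<kappa> / 4) * (norm y)\<^sup>2) * f w)"
        by (intro AE_I2) (simp add: order_trans[OF _ abs_ge_self])
    qed measurable
    from reproducing_kernel[OF H this]
    show "(LINT w|gauss_measure. H w * (cnj (testweight x \<eta> s) * exp (cdot (\<i> *s vcomplex s) (vcnj w) / 2)))
        = cnj (testweight x \<eta> s) * H (\<i> *s vcomplex s)"
      unfolding y_def mult.left_commute[of "H _"] by simp
  qed
  finally show ?thesis unfolding c_def .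
qed

section \<open>Bounded operators have bounded multipliers\<close>

text \<open>At imaginary points the kernel grows like \<open>exp ((norm s)\<^sup>2 / 4)\<close>, which \<open>testweight\<close> overcomes because \<open>\<eta> > 0\<close>.\<close>

lemma Fubini_bkernel_superposition:
  fixes V :: "real ^ 'n \<Rightarrow> complex"
  assumes \<eta>: "\<eta> > 0" and [measurable]: "V \<in> borel_measurable borel"
    and V: "integrable lborel (\<lambda>\<xi>. cmod (V \<xi>) * exp (- (norm \<xi>)\<^sup>2 / 2))"
  shows "(LINT s|lborel. testweight x \<eta> s * (LINT \<xi>|lborel. V \<xi> * cnj (bkernel (\<i> *s vcomplex s) \<xi>)))
     = complex_of_real (sqrt (pi / (\<eta> / 4)) ^ CARD('n))
        * (LINT \<xi>|lborel. V \<xi> * complex_of_real (exp (- (norm \<xi>)\<^sup>2 / 2) * exp (- (norm (x - \<xi>))\<^sup>2 / \<eta>)))"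
proof -
  have q: "integrable lborel (\<lambda>s :: real ^ 'n. exp (- (\<eta> / 4) * (norm s)\<^sup>2))"
    using \<eta> by (intro integrable_gaussian) simp
  have "(LINT s|lborel. testweight x \<eta> s * (LINT \<xi>|lborel. V \<xi> * cnj (bkernel (\<i> *s vcomplex s) \<xi>)))
     = (LINT s|lborel. LINT \<xi>|lborel. testweight x \<eta> s * (V \<xi> * cnj (bkernel (\<i> *s vcomplex s) \<xi>)))"
    unfolding integral_mult_right_zero ..
  also have "\<dots> = (LINT \<xi>|lborel. LINT s|lborel. testweight x \<eta> s * (V \<xi> * cnj (bkernel (\<i> *s vcomplex s) \<xi>)))"
  proof (rule integral_exchange_dominated[OF lborel.sigma_finite_measure_axioms lborel.sigma_finite_measure_axioms q V])
    fix s \<xi> :: "real ^ 'n"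
    have "cmod (testweight x \<eta> s * (V \<xi> * cnj (bkernel (\<i> *s vcomplex s) \<xi>)))
       = (exp (- ((1 + \<eta>) / 4) * (norm s)\<^sup>2) * exp ((norm s)\<^sup>2 / 4)) * (cmod (V \<xi>) * exp (- (norm \<xi>)\<^sup>2 / 2))"
      unfolding norm_mult complex_mod_cnj norm_testweight norm_bkernel_imag by (simp only: mult_ac)
    also have "exp (- ((1 + \<eta>) / 4) * (norm s)\<^sup>2) * exp ((norm s)\<^sup>2 / 4) = exp (- (\<eta> / 4) * (norm s)\<^sup>2)"
      unfolding exp_add[symmetric] by (rule arg_cong[where f=exp]) (simp add: field_simps)
    finally show "norm (testweight x \<eta> s * (V \<xi> * cnj (bkernel (\<i> *s vcomplex s) \<xi>)))
       \<le> exp (- (\<eta> / 4) * (norm s)\<^sup>2) * (cmod (V \<xi>) * exp (- (norm \<xi>)\<^sup>2 / 2))" by simp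
  qed (simp add: split_beta, measurable)
  also have "\<dots> = (LINT \<xi>|lborel. V \<xi> * (LINT s|lborel. testweight x \<eta> s * cnj (bkernel (\<i> *s vcomplex s) \<xi>)))"
    unfolding integral_mult_right_zero[symmetric] by (simp only: mult.left_commute)
  also have "\<dots> = complex_of_real (sqrt (pi / (\<eta> / 4)) ^ CARD('n))
        * (LINT \<xi>|lborel. V \<xi> * complex_of_real (exp (- (norm \<xi>)\<^sup>2 / 2) * exp (- (norm (x - \<xi>))\<^sup>2 / \<eta>)))"
    unfolding bkernel_superposition[OF \<eta>] integral_mult_right_zero[symmetric] of_real_mult
    by (simp only: mult_ac)
  finally show ?thesis .
qed

lemma integrable_mult_gauss_weight:
  fixes u :: "real ^ 'n \<Rightarrow> complex"
  assumes "square_integrable lborel u"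
  shows "integrable lborel (\<lambda>\<xi>. cmod (u \<xi>) * exp (- (norm \<xi>)\<^sup>2 / 2))"
  using integrable_norm[OF integrable_bargmann[OF assms, of 0]] by (simp add: bkernel_0 norm_mult)

lemma entire_shifted_kernel:
  assumes "entire \<phi>" shows "entire (\<lambda>w. cnj (\<phi> (z + vcnj w) * exp (cdot z (vcnj w) / 2)))"
proof -
  have "entire (\<lambda>u. \<phi> (z + 1 *s u) * exp ((1/2) * cdot u z))"
    by (rule entire_mult[OF entire_affine[OF assms] entire_exp[OF entire_cmult[OF entire_cdot]]])
  then have "entire (\<lambda>u. \<phi> (z + u) * exp (cdot z u / 2))" by (simp add: cdot_commute[of _ z])
  from entire_conjugate[OF this] show ?thesis .
qed

lemma bargmann_as_multiplier:
  "bargmann f z = (LINT \<xi>|lborel. (f \<xi> * complex_of_real (exp ((norm \<xi>)\<^sup>2 / 2))) * exp (- csq (vcomplex \<xi> - (1/2) *s z)))"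
proof -
  have "f \<xi> * bkernel z \<xi> = (f \<xi> * complex_of_real (exp ((norm \<xi>)\<^sup>2 / 2))) * exp (- csq (vcomplex \<xi> - (1/2) *s z))" for \<xi>
  proof -
    have "complex_of_real (exp ((norm \<xi>)\<^sup>2 / 2)) * complex_of_real (exp (- (norm \<xi>)\<^sup>2 / 2)) = 1"
      unfolding of_real_mult[symmetric] exp_add[symmetric] by simp
    then show ?thesis unfolding exp_csq_eq_bkernel by (simp add: mult.assoc[symmetric])
  qed
  then show ?thesis unfolding bargmann_def by (simp only:)
qed

text \<open>
  On a test function the operator with symbol \<open>bargmann f\<close> acts as multiplication, on the side of
  \<open>L\<^sup>2\<close>, by the formal multiplier \<open>f \<xi> * exp ((norm \<xi>)\<^sup>2 / 2)\<close>. The factor \<open>exp (- (norm \<xi>)\<^sup>2 / 2)\<close> that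
  comes from the test function compensates the growth of this multiplier, so that the integrals may be exchanged.\<close>

lemma S_tilde_op_testfun:
  fixes f :: "real ^ 'n \<Rightarrow> complex" and x :: "real ^ 'n"
  assumes \<eta>: "\<eta> > 0" and f: "square_integrable lborel f" and \<phi>: "bargmann f \<in> fock_space"
  shows "complex_of_real (sqrt (pi / ((1 + \<eta>) / 4)) ^ CARD('n)) * S_tilde_op (bargmann f) (testfun x \<eta>) z
     = complex_of_real (sqrt (pi / (\<eta> / 4)) ^ CARD('n)) * bargmann (\<lambda>\<xi>. f \<xi> * complex_of_real (exp (- (norm (x - \<xi>))\<^sup>2 / \<eta>))) z"
proof -
  have [measurable]: "f \<in> borel_measurable borel" using f by (simp add: square_integrable_def)
  define c where "c = complex_of_real (sqrt (pi / ((1 + \<eta>) / 4)) ^ CARD('n))"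
  have cc: "cnj c = c" by (simp add: c_def)
  define H where "H w = cnj (bargmann f (z + vcnj w) * exp (cdot z (vcnj w) / 2))" for w
  have H: "entire H" unfolding H_def by (rule entire_shifted_kernel[OF fock_spaceD(1)[OF \<phi>]])
  have Hb: "cmod (H w) \<le> (fock_norm (bargmann f) * exp ((norm z)\<^sup>2 / 4)) * exp ((1/4) * (norm w)\<^sup>2 + norm z * norm w)" for w
    unfolding H_def complex_mod_cnj by (rule fock_shift_bound[OF \<phi>])
  define V where "V \<xi> = (f \<xi> * complex_of_real (exp ((norm \<xi>)\<^sup>2 / 2))) * bkernel z \<xi>" for \<xi>
  have [measurable]: "V \<in> borel_measurable borel" unfolding V_def by measurable
  have cancel: "complex_of_real (exp ((norm \<xi>)\<^sup>2 / 2)) * complex_of_real (exp (- (norm \<xi>)\<^sup>2 / 2)) = 1" for \<xi> :: "real ^ 'n"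
    unfolding of_real_mult[symmetric] exp_add[symmetric] by simp
  have "cmod (V \<xi>) * exp (- (norm \<xi>)\<^sup>2 / 2) = cmod (f \<xi> * bkernel z \<xi>)" for \<xi>
    using arg_cong[OF cancel[of \<xi>], of cmod] by (simp add: V_def norm_mult mult_ac)
  then have iV: "integrable lborel (\<lambda>\<xi>. cmod (V \<xi>) * exp (- (norm \<xi>)\<^sup>2 / 2))"
    using integrable_norm[OF integrable_bargmann[OF f, of z]] by simp
  have Hs: "cnj (H (\<i> *s vcomplex s)) = (LINT \<xi>|lborel. V \<xi> * cnj (bkernel (\<i> *s vcomplex s) \<xi>))" for s
    unfolding H_def complex_cnj_cnj V_def by (rule multiplier_kernel[OF bargmann_as_multiplier])
  have "c * S_tilde_op (bargmann f) (testfun x \<eta>) z = cnj (c * (LINT w|gauss_measure. H w * cnj (testfun x \<eta> w)))"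
    unfolding S_tilde_op_def complex_cnj_mult cc cnj_integral H_def complex_cnj_cnj by (simp only: mult_ac)
  also have "\<dots> = (LINT s|lborel. testweight x \<eta> s * cnj (H (\<i> *s vcomplex s)))"
    unfolding c_def inner_testfun[OF \<eta> H Hb] cnj_integral complex_cnj_mult complex_cnj_cnj ..
  also have "\<dots> = complex_of_real (sqrt (pi / (\<eta> / 4)) ^ CARD('n))
        * (LINT \<xi>|lborel. V \<xi> * complex_of_real (exp (- (norm \<xi>)\<^sup>2 / 2) * exp (- (norm (x - \<xi>))\<^sup>2 / \<eta>)))"
    unfolding Hs by (rule Fubini_bkernel_superposition[OF \<eta> _ iV]) measurable
  also have "(LINT \<xi>|lborel. V \<xi> * complex_of_real (exp (- (norm \<xi>)\<^sup>2 / 2) * exp (- (norm (x - \<xi>))\<^sup>2 / \<eta>)))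
      = bargmann (\<lambda>\<xi>. f \<xi> * complex_of_real (exp (- (norm (x - \<xi>))\<^sup>2 / \<eta>))) z"
    unfolding bargmann_def
  proof (intro Bochner_Integration.integral_cong refl)
    fix \<xi> :: "real ^ 'n"
    have "V \<xi> * complex_of_real (exp (- (norm \<xi>)\<^sup>2 / 2) * exp (- (norm (x - \<xi>))\<^sup>2 / \<eta>))
       = (complex_of_real (exp ((norm \<xi>)\<^sup>2 / 2)) * complex_of_real (exp (- (norm \<xi>)\<^sup>2 / 2)))
          * (f \<xi> * complex_of_real (exp (- (norm (x - \<xi>))\<^sup>2 / \<eta>)) * bkernel z \<xi>)"
      unfolding V_def of_real_mult by (simp only: mult_ac)
    then show "V \<xi> * complex_of_real (exp (- (norm \<xi>)\<^sup>2 / 2) * exp (- (norm (x - \<xi>))\<^sup>2 / \<eta>))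
       = f \<xi> * complex_of_real (exp (- (norm (x - \<xi>))\<^sup>2 / \<eta>)) * bkernel z \<xi>"
      unfolding cancel by simp
  qed
  finally show ?thesis unfolding c_def .
qed

text \<open>
  One test function contributes the Gaussian factor through the action of the operator, the other one through
  the inner product; together they halve the squared width.\<close>

lemma quadratic_form_testfun:
  fixes f :: "real ^ 'n \<Rightarrow> complex" and x :: "real ^ 'n"
  assumes \<eta>: "\<eta> > 0" and f: "square_integrable lborel f" and \<phi>: "bargmann f \<in> fock_space"
  shows "(complex_of_real (sqrt (pi / ((1 + \<eta>) / 4)) ^ CARD('n)))\<^sup>2
      * (LINT w|gauss_measure. S_tilde_op (bargmann f) (testfun x \<eta>) w * cnj (testfun x \<eta> w))
    = (complex_of_real (sqrt (pi / (\<eta> / 4)) ^ CARD('n)))\<^sup>2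
      * (LINT \<xi>|lborel. (f \<xi> * complex_of_real (exp (- (norm \<xi>)\<^sup>2 / 2))) * complex_of_real (exp (- (norm (x - \<xi>))\<^sup>2 / (\<eta> / 2))))"
proof -
  have [measurable]: "f \<in> borel_measurable borel" using f by (simp add: square_integrable_def)
  define c where "c = complex_of_real (sqrt (pi / ((1 + \<eta>) / 4)) ^ CARD('n))"
  define d where "d = complex_of_real (sqrt (pi / (\<eta> / 4)) ^ CARD('n))"
  define g where "g \<xi> = f \<xi> * complex_of_real (exp (- (norm (x - \<xi>))\<^sup>2 / \<eta>))" for \<xi>
  have [measurable]: "g \<in> borel_measurable borel" unfolding g_def by measurable
  have g: "square_integrable lborel g"
    by (rule square_integrable_bound[OF f, where C=1])
      (use \<eta> in \<open>auto simp: g_def norm_mult mult_left_le\<close>)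
  define U where "U = bargmann g"
  have U: "entire U" unfolding U_def by (rule entire_bargmann[OF g])
  have fU: "U \<in> fock_space" unfolding U_def by (intro fock_spaceI entire_bargmann bargmann_bounded g)
  have Ub: "cmod (U w) \<le> fock_norm U * exp ((1/4) * (norm w)\<^sup>2 + 0 * norm w)" for w
    using fock_pointwise_bound[OF fU, of w] by simp
  have S: "c * S_tilde_op (bargmann f) (testfun x \<eta>) w = d * U w" for w
    unfolding c_def d_def U_def g_def by (rule S_tilde_op_testfun[OF \<eta> f \<phi>])
  have cU: "cnj (U (\<i> *s vcomplex s)) = (LINT \<xi>|lborel. cnj (g \<xi>) * cnj (bkernel (\<i> *s vcomplex s) \<xi>))" for s
    unfolding U_def by (rule cnj_bargmann)
  have "c\<^sup>2 * (LINT w|gauss_measure. S_tilde_op (bargmann f) (testfun x \<eta>) w * cnj (testfun x \<eta> w))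
      = c * (LINT w|gauss_measure. (c * S_tilde_op (bargmann f) (testfun x \<eta>) w) * cnj (testfun x \<eta> w))"
    unfolding mult.assoc integral_mult_right_zero by (simp only: power2_eq_square mult.assoc)
  also have "\<dots> = d * (c * (LINT w|gauss_measure. U w * cnj (testfun x \<eta> w)))"
    unfolding S mult.assoc integral_mult_right_zero by (simp only: mult.left_commute)
  also have "c * (LINT w|gauss_measure. U w * cnj (testfun x \<eta> w)) = cnj (LINT s|lborel. testweight x \<eta> s * cnj (U (\<i> *s vcomplex s)))"
    unfolding c_def inner_testfun[OF \<eta> U Ub] cnj_integral complex_cnj_mult complex_cnj_cnj ..
  also have "\<dots> = cnj (d * (LINT \<xi>|lborel. cnj (g \<xi>) * complex_of_real (exp (- (norm \<xi>)\<^sup>2 / 2) * exp (- (norm (x - \<xi>))\<^sup>2 / \<eta>))))"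
    unfolding cU d_def
    by (subst Fubini_bkernel_superposition[OF \<eta>])
      (use integrable_mult_gauss_weight[OF g] in \<open>auto simp: measurable_compose[OF _ measurable_cnj]\<close>)
  also have "\<dots> = d * (LINT \<xi>|lborel. (f \<xi> * complex_of_real (exp (- (norm \<xi>)\<^sup>2 / 2))) * complex_of_real (exp (- (norm (x - \<xi>))\<^sup>2 / (\<eta> / 2))))"
  proof -
    have "exp (- (norm (x - \<xi>))\<^sup>2 / (\<eta> / 2)) = exp (- (norm (x - \<xi>))\<^sup>2 / \<eta>) * exp (- (norm (x - \<xi>))\<^sup>2 / \<eta>)" for \<xi>
      unfolding exp_add[symmetric] by (rule arg_cong[where f=exp]) simp
    then show ?thesis
      unfolding complex_cnj_mult cnj_integral complex_cnj_cnj complex_cnj_complex_of_real d_def g_def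
      by (simp only: of_real_mult mult_ac)
  qed
  finally show ?thesis unfolding c_def d_def by (simp only: power2_eq_square mult.assoc)
qed

lemma constant_as_bargmann:
  fixes z :: "complex ^ 'n"
  shows "bargmann (\<lambda>\<xi>. complex_of_real (1 / sqrt pi ^ CARD('n)) * bkernel 0 \<xi>) z = 1"
proof -
  have "bargmann (\<lambda>\<xi>. complex_of_real (1 / sqrt pi ^ CARD('n)) * bkernel 0 \<xi>) z
      = complex_of_real (1 / sqrt pi ^ CARD('n)) * (LINT \<xi>|lborel. bkernel z \<xi> * cnj (bkernel 0 \<xi>))"
    unfolding bargmann_def mult.assoc integral_mult_right_zero by (simp add: bkernel_0 mult.commute)
  then show ?thesis unfolding integral_bkernel_mult_cnj by (simp add: cdot_simps)
qed

lemma constant_fock: "(\<lambda>z. 1) \<in> fock_space"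
  by (rule fock_spaceI[OF entire_const square_integrable_gauss_bound[where \<alpha>=0 and \<beta>=0 and C=1]]) auto

text \<open>
  The symbol \<open>1\<close> gives the identity operator, so comparing the quadratic forms of \<open>\<phi>\<close> and of \<open>1\<close> on the test
  functions compares Gaussian averages of the multiplier with those of a constant.\<close>

lemma multiplier_if_S_tilde_op_bounded:
  fixes \<phi> :: "complex ^ 'n \<Rightarrow> complex"
  assumes \<phi>: "\<phi> \<in> fock_space" and bd: "bounded_on_fock (S_tilde_op \<phi>)"
  shows "\<exists>m \<in> L_infinity. \<forall>z. \<phi> z = (LINT \<xi>|lborel. m \<xi> * exp (- csq (vcomplex \<xi> - (1/2) *s z)))"
proof -
  obtain T where T: "bounded_linear_operator_on_fock T" and TP: "\<And>P. hol_polynomial P \<Longrightarrow> T P = S_tilde_op \<phi> P"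
    using bd unfolding bounded_on_fock_def by blast
  obtain C where C: "\<And>F. F \<in> fock_space \<Longrightarrow> fock_norm (T F) \<le> C * fock_norm F"
    using T unfolding bounded_linear_operator_on_fock_def by blast
  have TF: "T F \<in> fock_space" if "F \<in> fock_space" for F
    using T that unfolding bounded_linear_operator_on_fock_def by blast
  obtain f where f: "square_integrable lborel f" and f\<phi>: "bargmann f = \<phi>"
    using bargmann_surj[OF \<phi>] by blast
  have [measurable]: "f \<in> borel_measurable borel" using f by (simp add: square_integrable_def)
  define N where "N = sqrt pi ^ CARD('n)"
  have N: "N > 0" unfolding N_def by simp
  define v where "v \<xi> = f \<xi> * complex_of_real (exp (- (norm \<xi>)\<^sup>2 / 2))" for \<xi>
  define E where "E \<xi> = (C / N) * exp (- 1 * (norm \<xi>)\<^sup>2)" for \<xi> :: "real ^ 'n"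
  have "AE \<xi> in lborel. cmod (v \<xi>) \<le> 2 * E \<xi>"
  proof (rule AE_norm_le_if_Gaussian_averages_le)
    show "integrable lborel v"
      using integrable_bargmann[OF f, of 0] by (simp add: v_def[abs_def] bkernel_0)
    show "integrable lborel E" unfolding E_def by (intro integrable_mult_right integrable_gaussian) simp
    fix x :: "real ^ 'n" and t :: real assume t: "t > 0"
    \<comment> \<open>The quadratic form involves the squared width \<open>\<eta> / 2\<close>.\<close>
    define \<eta> where "\<eta> = 2 * t\<^sup>2"
    have \<eta>: "\<eta> > 0" "\<eta> / 2 = t\<^sup>2" using t by (simp_all add: \<eta>_def)
    define e where "e \<xi> = exp (- (norm (x - \<xi>))\<^sup>2 / t\<^sup>2)" for \<xi>
    define a where "a = sqrt (pi / ((1 + \<eta>) / 4)) ^ CARD('n)"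
    define b where "b = sqrt (pi / (\<eta> / 4)) ^ CARD('n)"
    have b: "b > 0" using \<eta> unfolding b_def by simp
    define F where "F = testfun x \<eta>"
    have pol: "hol_polynomial (\<lambda>z. complex_of_real (- 1 / (1 + \<eta>)) * csq (vcomplex x - (1/2) *s z))"
      by (rule hol_polynomial_csq_affine)
    have small: "1 / (4 * (1 + \<eta>)) < 1/4" using \<eta>(1) by (intro divide_strict_left_mono) auto
    have fF: "F \<in> fock_space"
      unfolding F_def testfun_def[abs_def]
      by (rule extension_on_exponentials(1)[OF \<phi> T TP pol small testfun_bound[OF \<eta>(1)]])
    have TS: "T F = S_tilde_op \<phi> F"
      unfolding F_def testfun_def[abs_def]
      by (rule extension_on_exponentials(2)[OF \<phi> T TP pol small testfun_bound[OF \<eta>(1)]])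
    have 1: "(complex_of_real a)\<^sup>2 * (LINT w|gauss_measure. T F w * cnj (F w))
        = (complex_of_real b)\<^sup>2 * (LINT \<xi>|lborel. v \<xi> * complex_of_real (e \<xi>))"
    proof -
      have "(complex_of_real a)\<^sup>2 * (LINT w|gauss_measure. S_tilde_op (bargmann f) F w * cnj (F w))
        = (complex_of_real b)\<^sup>2 * (LINT \<xi>|lborel. v \<xi> * complex_of_real (e \<xi>))"
        unfolding F_def a_def b_def v_def e_def \<eta>(2)[symmetric]
        by (rule quadratic_form_testfun[OF \<eta>(1) f]) (simp add: f\<phi> \<phi>)
      then show ?thesis unfolding f\<phi> TS .
    qed
    have S1: "S_tilde_op (\<lambda>z. 1) F = F"
      unfolding S_tilde_op_def by (rule ext) (simp add: fock_reproducing[OF fF])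
    have bk: "bkernel 0 \<xi> * complex_of_real (exp (- (norm \<xi>)\<^sup>2 / 2)) = complex_of_real (exp (- 1 * (norm \<xi>)\<^sup>2))" for \<xi> :: "real ^ 'n"
      unfolding bkernel_0 of_real_mult[symmetric] exp_add[symmetric] by simp
    have 2: "(complex_of_real a)\<^sup>2 * (LINT w|gauss_measure. F w * cnj (F w))
        = (complex_of_real b)\<^sup>2 * complex_of_real ((1 / N) * (LINT \<xi>|lborel. exp (- 1 * (norm \<xi>)\<^sup>2) * e \<xi>))"
    proof -
      define f1 where "f1 \<xi> = complex_of_real (1 / N) * bkernel 0 \<xi>" for \<xi> :: "real ^ 'n"
      have B1: "bargmann f1 = (\<lambda>z. 1)"
        unfolding f1_def[abs_def] N_def using constant_as_bargmann by (rule ext)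
      have f1: "square_integrable lborel f1"
        unfolding f1_def[abs_def] by (intro square_integrable_cmult square_integrable_bkernel)
      have i: "(f1 \<xi> * complex_of_real (exp (- (norm \<xi>)\<^sup>2 / 2))) * complex_of_real (e \<xi>)
          = complex_of_real ((1 / N) * (exp (- 1 * (norm \<xi>)\<^sup>2) * e \<xi>))" for \<xi>
        unfolding f1_def mult.assoc[of _ "bkernel 0 \<xi>"] bk of_real_mult by (simp only: mult.assoc)
      have "(complex_of_real a)\<^sup>2 * (LINT w|gauss_measure. S_tilde_op (bargmann f1) F w * cnj (F w))
          = (complex_of_real b)\<^sup>2 * (LINT \<xi>|lborel. (f1 \<xi> * complex_of_real (exp (- (norm \<xi>)\<^sup>2 / 2))) * complex_of_real (e \<xi>))"
        unfolding a_def b_def F_def e_def \<eta>(2)[symmetric]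
        by (rule quadratic_form_testfun[OF \<eta>(1) f1]) (simp add: B1 constant_fock)
      then show ?thesis unfolding B1 S1 i integral_complex_of_real by simp
    qed
    have nF: "(LINT w|gauss_measure. F w * cnj (F w)) = complex_of_real ((fock_norm F)\<^sup>2)"
      unfolding complex_norm_square[symmetric] fock_norm_sq by (rule integral_complex_of_real)
    have "(cmod (LINT w|gauss_measure. T F w * cnj (F w)))\<^sup>2 \<le> (fock_norm (T F))\<^sup>2 * (fock_norm F)\<^sup>2"
      using Cauchy_Schwarz_integral[OF fock_spaceD(2)[OF TF[OF fF]] square_integrable_cnj[OF fock_spaceD(2)[OF fF]]]
      by (simp add: fock_norm_sq)
    then have "cmod (LINT w|gauss_measure. T F w * cnj (F w)) \<le> fock_norm (T F) * fock_norm F"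
      unfolding power_mult_distrib[symmetric] by (rule power2_le_imp_le) (simp add: fock_norm_nonneg)
    also have "\<dots> \<le> C * (fock_norm F)\<^sup>2"
      using mult_right_mono[OF C[OF fF] fock_norm_nonneg[of F]] by (simp add: power2_eq_square mult.assoc)
    finally have "a\<^sup>2 * cmod (LINT w|gauss_measure. T F w * cnj (F w)) \<le> C * (a\<^sup>2 * (fock_norm F)\<^sup>2)"
      unfolding mult.left_commute[of C] by (rule mult_left_mono) simp
    also have "a\<^sup>2 * (fock_norm F)\<^sup>2 = b\<^sup>2 * ((1 / N) * (LINT \<xi>|lborel. exp (- 1 * (norm \<xi>)\<^sup>2) * e \<xi>))"
      using 2 unfolding nF of_real_power[symmetric] of_real_mult[symmetric] of_real_eq_iff .
    also have "a\<^sup>2 * cmod (LINT w|gauss_measure. T F w * cnj (F w)) = b\<^sup>2 * cmod (LINT \<xi>|lborel. v \<xi> * complex_of_real (e \<xi>))"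
      using arg_cong[OF 1, of cmod] by (simp add: norm_mult norm_power)
    finally have "b\<^sup>2 * cmod (LINT \<xi>|lborel. v \<xi> * complex_of_real (e \<xi>))
        \<le> b\<^sup>2 * ((C / N) * (LINT \<xi>|lborel. exp (- 1 * (norm \<xi>)\<^sup>2) * e \<xi>))"
      by (simp add: mult_ac)
    then have "cmod (LINT \<xi>|lborel. v \<xi> * complex_of_real (e \<xi>)) \<le> (C / N) * (LINT \<xi>|lborel. exp (- 1 * (norm \<xi>)\<^sup>2) * e \<xi>)"
      using b by (simp only: mult_le_cancel_left_pos zero_less_power)
    also have "\<dots> = (LINT \<xi>|lborel. E \<xi> * e \<xi>)"
      unfolding E_def mult.assoc integral_mult_right_zero ..
    finally show "cmod (LINT \<xi>|lborel. v \<xi> * complex_of_real (exp (- (norm (x - \<xi>))\<^sup>2 / t\<^sup>2)))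
        \<le> (LINT \<xi>|lborel. E \<xi> * exp (- (norm (x - \<xi>))\<^sup>2 / t\<^sup>2))"
      unfolding e_def .
  qed
  then have bound: "AE \<xi> in lborel. cmod (f \<xi> * complex_of_real (exp ((norm \<xi>)\<^sup>2 / 2))) \<le> 2 * (C / N)"
  proof eventually_elim
    case (elim \<xi>)
    have "cmod (f \<xi>) * exp (- (norm \<xi>)\<^sup>2 / 2) \<le> 2 * ((C / N) * exp (- 1 * (norm \<xi>)\<^sup>2))"
      using elim by (simp add: v_def E_def norm_mult)
    from mult_right_mono[OF this, of "exp ((norm \<xi>)\<^sup>2)"]
    have "cmod (f \<xi>) * (exp (- (norm \<xi>)\<^sup>2 / 2) * exp ((norm \<xi>)\<^sup>2)) \<le> 2 * ((C / N) * (exp (- 1 * (norm \<xi>)\<^sup>2) * exp ((norm \<xi>)\<^sup>2)))"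
      by (simp only: mult.assoc) simp
    then show ?case unfolding exp_add[symmetric] by (simp add: norm_mult)
  qed
  show ?thesis
  proof (intro bexI allI)
    show "(\<lambda>\<xi>. f \<xi> * complex_of_real (exp ((norm \<xi>)\<^sup>2 / 2))) \<in> L_infinity"
      unfolding L_infinity_def using bound by auto
    show "\<phi> z = (LINT \<xi>|lborel. f \<xi> * complex_of_real (exp ((norm \<xi>)\<^sup>2 / 2)) * exp (- csq (vcomplex \<xi> - (1/2) *s z)))" for z
      unfolding f\<phi>[symmetric] by (rule bargmann_as_multiplier)
  qed
qed

section \<open>A Phragmen-Lindelof argument\<close>

lemma sector_in_quadrant:
  fixes x y \<tau> :: real
  assumes \<tau>: "0 < \<tau>" "\<tau> < 1" and "\<tau> * x \<le> y" "\<tau> * y \<le> x"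
  shows "0 \<le> x" "0 \<le> y"
proof -
  have tt: "\<tau> * \<tau> < 1" using \<tau> mult_strict_mono[of \<tau> 1 \<tau> 1] by simp
  have pos: "0 \<le> a" if "\<tau> * (\<tau> * a) \<le> a" for a
  proof (rule ccontr)
    assume "\<not> 0 \<le> a"
    then have "1 * a < (\<tau> * \<tau>) * a" using tt by (intro mult_strict_right_mono_neg) auto
    with that show False by simp
  qed
  have "\<tau> * (\<tau> * x) \<le> \<tau> * y" "\<tau> * (\<tau> * y) \<le> \<tau> * x" using assms by simp_all
  then have "\<tau> * (\<tau> * x) \<le> x" "\<tau> * (\<tau> * y) \<le> y" using assms by linarith+
  then show "0 \<le> x" "0 \<le> y" by (simp_all add: pos)
qed

text \<open>
  The sector between the rays \<open>Im z = \<tau> * Re z\<close> and \<open>Re z = \<tau> * Im z\<close> has opening less than a right angle.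
  There \<open>- 2 * \<i> * z\<^sup>2\<close> has real part at least \<open>2 * \<tau> * (cmod z)\<^sup>2\<close>, and multiplying it by a logarithm makes
  it beat any growth of order 2, so a small multiple of it can be used as a damping exponent.\<close>

lemma damping_bound:
  assumes \<tau>: "0 < \<tau>" "\<tau> < 1" and z: "\<tau> * Re z \<le> Im z" "\<tau> * Im z \<le> Re z"
  shows "2 * \<tau> * (cmod z)\<^sup>2 * ln (cmod (1 + (1 - \<i>) * z)) - 2 * pi * (cmod z)\<^sup>2
      \<le> Re (- 2 * \<i> * z\<^sup>2 * Ln (1 + (1 - \<i>) * z))"
    and "Re (1 + (1 - \<i>) * z) \<ge> 1" and "cmod (1 + (1 - \<i>) * z) \<ge> cmod z"
proof -
  define x y where "x = Re z" and "y = Im z"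
  define w where "w = 1 + (1 - \<i>) * z"
  have xy: "x \<ge> 0" "y \<ge> 0"
    using sector_in_quadrant[OF \<tau> z] by (simp_all add: x_def y_def)
  have Rw: "Re w = 1 + x + y" and Iw: "Im w = y - x" by (simp_all add: w_def x_def y_def)
  show "Re (1 + (1 - \<i>) * z) \<ge> 1" using Rw xy unfolding w_def by simp
  have w0: "w \<noteq> 0"
  proof
    assume "w = 0"
    then show False using Rw xy by simp
  qed
  have n: "(cmod z)\<^sup>2 = x\<^sup>2 + y\<^sup>2" by (simp add: cmod_power2 x_def y_def)
  have "(cmod w)\<^sup>2 = (1 + x + y)\<^sup>2 + (y - x)\<^sup>2" unfolding cmod_power2 Rw Iw ..
  also have "\<dots> = (1 + 2 * x + 2 * y) + x\<^sup>2 + y\<^sup>2 + (x\<^sup>2 + y\<^sup>2)" by (simp add: power2_eq_square algebra_simps)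
  finally have "(cmod z)\<^sup>2 \<le> (cmod w)\<^sup>2" unfolding n using xy by simp
  then show "cmod (1 + (1 - \<i>) * z) \<ge> cmod z" unfolding w_def by (rule power2_le_imp_le) simp
  have lnw: "ln (cmod w) \<ge> 0"
  proof -
    have "1 \<le> Re w" using Rw xy by simp
    then have "1 \<le> cmod w" using complex_Re_le_cmod[of w] by linarith
    then show ?thesis by simp
  qed
  have "\<tau> * x * x \<le> y * x" "\<tau> * y * y \<le> x * y"
    using z xy by (simp_all add: x_def y_def mult_right_mono)
  then have "\<tau> * (cmod z)\<^sup>2 \<le> 2 * (x * y)" unfolding n by (simp add: power2_eq_square algebra_simps)
  from mult_right_mono[OF this, of "2 * ln (cmod w)"] lnw
  have 1: "2 * \<tau> * (cmod z)\<^sup>2 * ln (cmod w) \<le> 4 * x * y * ln (cmod w)" by (simp add: mult_ac)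
  have "\<bar>Im (Ln w)\<bar> \<le> pi" using mpi_less_Im_Ln[OF w0] Im_Ln_le_pi[OF w0] by simp
  moreover have "\<bar>x\<^sup>2 - y\<^sup>2\<bar> \<le> (cmod z)\<^sup>2" unfolding n by (simp add: abs_le_iff)
  ultimately have "\<bar>2 * (x\<^sup>2 - y\<^sup>2) * Im (Ln w)\<bar> \<le> 2 * ((cmod z)\<^sup>2 * pi)"
    unfolding abs_mult mult.assoc by (intro mult_mono) auto
  then have 2: "- (2 * pi * (cmod z)\<^sup>2) \<le> 2 * (x\<^sup>2 - y\<^sup>2) * Im (Ln w)" by (simp add: abs_le_iff mult_ac)
  have "Re (- 2 * \<i> * z\<^sup>2 * Ln w) = 4 * x * y * Re (Ln w) + 2 * (x\<^sup>2 - y\<^sup>2) * Im (Ln w)"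
    by (simp add: Re_power2 Im_power2 x_def y_def algebra_simps)
  also have "Re (Ln w) = ln (cmod w)" by (rule Re_Ln[OF w0])
  finally show "2 * \<tau> * (cmod z)\<^sup>2 * ln (cmod (1 + (1 - \<i>) * z)) - 2 * pi * (cmod z)\<^sup>2
      \<le> Re (- 2 * \<i> * z\<^sup>2 * Ln (1 + (1 - \<i>) * z))"
    using 1 2 unfolding w_def by linarith
qed

text \<open>
  The maximum principle is applied to \<open>h z * exp (- \<epsilon> * \<psi> z)\<close> on the part of the sector inside a large disc. The
  damping exponent \<open>\<psi>\<close> has real part bounded below by a constant \<open>- M\<close>, whose effect disappears as \<open>\<epsilon>\<close> tends
  to 0.\<close>

lemma Phragmen_Lindelof_sector:
  assumes h: "h holomorphic_on UNIV" and \<tau>: "0 < \<tau>" "\<tau> < 1"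
    and ray1: "\<And>z. Im z = \<tau> * Re z \<Longrightarrow> Re z \<ge> 0 \<Longrightarrow> cmod (h z) \<le> C"
    and ray2: "\<And>z. Re z = \<tau> * Im z \<Longrightarrow> Im z \<ge> 0 \<Longrightarrow> cmod (h z) \<le> C"
    and growth: "\<And>z. \<tau> * Re z \<le> Im z \<Longrightarrow> \<tau> * Im z \<le> Re z \<Longrightarrow> cmod (h z) \<le> C * exp (A * (cmod z)\<^sup>2)"
    and z: "\<tau> * Re z \<le> Im z" "\<tau> * Im z \<le> Re z"
  shows "cmod (h z) \<le> C"
proof -
  define \<psi> where "\<psi> z = - 2 * \<i> * z\<^sup>2 * Ln (1 + (1 - \<i>) * z)" for z
  define M where "M = 2 * pi * (exp (pi / \<tau>))\<^sup>2"
  have C0: "C \<ge> 0" using order_trans[OF norm_ge_zero ray1[of 0]] by simp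
  have M0: "M \<ge> 0" unfolding M_def by simp
  have \<psi>M: "- M \<le> Re (\<psi> z)" if z: "\<tau> * Re z \<le> Im z" "\<tau> * Im z \<le> Re z" for z
  proof -
    note d = damping_bound[OF \<tau> z]
    define L where "L = ln (cmod (1 + (1 - \<i>) * z))"
    have c1: "1 \<le> cmod (1 + (1 - \<i>) * z)" using d(2) complex_Re_le_cmod order_trans by blast
    then have L0: "L \<ge> 0" unfolding L_def by simp
    have *: "(cmod z)\<^sup>2 * (2 * \<tau> * L - 2 * pi) \<le> Re (\<psi> z)"
      using d(1) unfolding \<psi>_def L_def by (simp add: algebra_simps)
    show ?thesis
    proof (cases "\<tau> * L \<ge> pi")
      case True
      then have "0 \<le> (cmod z)\<^sup>2 * (2 * \<tau> * L - 2 * pi)" by (intro mult_nonneg_nonneg) auto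
      then show ?thesis using * M0 by linarith
    next
      case False
      then have "L \<le> pi / \<tau>" using \<tau> by (simp add: field_simps)
      then have "exp L \<le> exp (pi / \<tau>)" by simp
      moreover have "exp L = cmod (1 + (1 - \<i>) * z)" unfolding L_def using c1 by (intro exp_ln) linarith
      ultimately have "cmod (1 + (1 - \<i>) * z) \<le> exp (pi / \<tau>)" by simp
      then have "(cmod z)\<^sup>2 \<le> (exp (pi / \<tau>))\<^sup>2" using d(3) by (intro power_mono) auto
      then have "- M \<le> - (2 * pi * (cmod z)\<^sup>2)" unfolding M_def by simp
      also have "\<dots> \<le> (cmod z)\<^sup>2 * (2 * \<tau> * L - 2 * pi)"
        using L0 \<tau> by (simp add: algebra_simps)
      finally show ?thesis using * by linarith
    qed
  qed
  have main: "cmod (h z) * exp (- \<epsilon> * Re (\<psi> z)) \<le> C * exp (\<epsilon> * M)" if \<epsilon>: "\<epsilon> > 0" for \<epsilon>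
  proof -
    \<comment> \<open>On the arc \<open>cmod u = r\<close> the damping exceeds the growth \<open>A * r\<^sup>2\<close> of the logarithm of \<open>h\<close>.\<close>
    define r where "r = max (cmod z) (exp ((A + 2 * pi * \<epsilon>) / (2 * \<tau> * \<epsilon>)))"
    define S where "S = {z. \<tau> * Re z \<le> Im z} \<inter> {z. \<tau> * Im z \<le> Re z} \<inter> cball 0 r"
    define O' where "O' = {z. \<tau> * Re z < Im z} \<inter> {z. \<tau> * Im z < Re z} \<inter> ball 0 r"
    define H where "H z = h z * exp (- complex_of_real \<epsilon> * \<psi> z)" for z
    have nH: "cmod (H z) = cmod (h z) * exp (- \<epsilon> * Re (\<psi> z))" for z
      by (simp add: H_def norm_mult)
    have clS: "closed S" unfolding S_def
      by (intro closed_Int closed_Collect_le closed_cball continuous_intros)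
    have opO: "open O'" unfolding O'_def
      by (intro open_Int open_Collect_less open_ball continuous_intros)
    have OS: "O' \<subseteq> interior S"
      by (rule interior_maximal[OF _ opO]) (auto simp: O'_def S_def)
    have "H holomorphic_on S"
      unfolding H_def \<psi>_def
    proof (intro holomorphic_intros holomorphic_on_subset[OF h])
      fix z assume "z \<in> S"
      then have "Re (1 + (1 - \<i>) * z) \<ge> 1" using damping_bound(2)[OF \<tau>] by (auto simp: S_def)
      then show "1 + (1 - \<i>) * z \<notin> \<real>\<^sub>\<le>\<^sub>0" by (auto simp: complex_nonpos_Reals_iff)
    qed auto
    then have hol: "H holomorphic_on interior S" and cont: "continuous_on (closure S) H"
      using holomorphic_on_subset[OF _ interior_subset] holomorphic_on_imp_continuous_on
        closure_closed[OF clS] by metis+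
    have "cmod (H z) \<le> C * exp (\<epsilon> * M)"
    proof (rule maximum_modulus_frontier[OF hol cont])
      show "bounded S" unfolding S_def by (rule bounded_subset[OF bounded_cball]) auto
      show "z \<in> S" using z by (auto simp: S_def r_def)
      fix u assume u: "u \<in> frontier S"
      then have uS: "u \<in> S" and "u \<notin> O'"
        using clS OS by (auto simp: frontier_def)
      then have u1: "\<tau> * Re u \<le> Im u" "\<tau> * Im u \<le> Re u"
        and cases: "Im u = \<tau> * Re u \<or> Re u = \<tau> * Im u \<or> cmod u = r"
        by (auto simp: S_def O'_def)
      have u0: "Re u \<ge> 0" "Im u \<ge> 0" using sector_in_quadrant[OF \<tau> u1] by auto
      show "cmod (H u) \<le> C * exp (\<epsilon> * M)"
      proof (cases "cmod u = r")
        case True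
        note d = damping_bound[OF \<tau> u1]
        have r0: "r > 0" "cmod u > 0" using True by (auto simp: r_def less_max_iff_disj)
        have "(A + 2 * pi * \<epsilon>) / (2 * \<tau> * \<epsilon>) \<le> ln (cmod (1 + (1 - \<i>) * u))"
        proof -
          have "exp ((A + 2 * pi * \<epsilon>) / (2 * \<tau> * \<epsilon>)) \<le> cmod (1 + (1 - \<i>) * u)"
            using d(3) True by (auto simp: r_def)
          then show ?thesis using r0 d(3) by (subst ln_ge_iff) auto
        qed
        then have "A + 2 * pi * \<epsilon> \<le> 2 * \<tau> * \<epsilon> * ln (cmod (1 + (1 - \<i>) * u))"
          using \<tau> \<epsilon> by (simp add: field_simps)
        from mult_left_mono[OF this, of "(cmod u)\<^sup>2"]
        have "A * (cmod u)\<^sup>2 \<le> \<epsilon> * (2 * \<tau> * (cmod u)\<^sup>2 * ln (cmod (1 + (1 - \<i>) * u)) - 2 * pi * (cmod u)\<^sup>2)"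
          by (simp add: algebra_simps)
        also have "\<dots> \<le> \<epsilon> * Re (\<psi> u)" using d(1) \<epsilon> unfolding \<psi>_def by (intro mult_left_mono) auto
        finally have e: "A * (cmod u)\<^sup>2 + - \<epsilon> * Re (\<psi> u) \<le> 0" by simp
        have "cmod (H u) \<le> (C * exp (A * (cmod u)\<^sup>2)) * exp (- \<epsilon> * Re (\<psi> u))"
          unfolding nH by (intro mult_right_mono growth u1) auto
        also have "\<dots> = C * exp (A * (cmod u)\<^sup>2 + - \<epsilon> * Re (\<psi> u))" by (simp only: exp_add mult.assoc)
        also have "\<dots> \<le> C * exp (\<epsilon> * M)"
        proof (intro mult_left_mono C0)
          have "0 \<le> \<epsilon> * M" using \<epsilon> M0 by simp
          then show "exp (A * (cmod u)\<^sup>2 + - \<epsilon> * Re (\<psi> u)) \<le> exp (\<epsilon> * M)"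
            unfolding exp_le_cancel_iff using e by linarith
        qed
        finally show ?thesis .
      next
        case False
        then have "cmod (h u) \<le> C" using cases u0 ray1[of u] ray2[of u] by auto
        moreover have "- \<epsilon> * Re (\<psi> u) \<le> \<epsilon> * M" using \<psi>M[OF u1] \<epsilon> mult_left_mono[of "- M" "Re (\<psi> u)" \<epsilon>] by simp
        ultimately show ?thesis unfolding nH using C0 by (intro mult_mono) auto
      qed
    qed
    then show ?thesis unfolding nH .
  qed
  have "(\<lambda>k. cmod (h z) * exp (- (1 / real (Suc k)) * Re (\<psi> z))) \<longlonglongrightarrow> cmod (h z) * exp (- 0 * Re (\<psi> z))"
    using LIMSEQ_inverse_real_of_nat by (intro tendsto_intros) (simp add: inverse_eq_divide)
  moreover have "(\<lambda>k. C * exp ((1 / real (Suc k)) * M)) \<longlonglongrightarrow> C * exp (0 * M)"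
    using LIMSEQ_inverse_real_of_nat by (intro tendsto_intros) (simp add: inverse_eq_divide)
  ultimately have "cmod (h z) * exp (- 0 * Re (\<psi> z)) \<le> C * exp (0 * M)"
  proof (rule LIMSEQ_le, intro exI allI impI)
    fix k
    show "cmod (h z) * exp (- (1 / real (Suc k)) * Re (\<psi> z)) \<le> C * exp ((1 / real (Suc k)) * M)"
      by (rule main) simp
  qed
  then show ?thesis by simp
qed

text \<open>
  The factor \<open>exp (\<i> * \<delta> * z\<^sup>2)\<close> has modulus at most 1 in the first quadrant and tames \<open>g\<close> in thin
  sectors along both axes; the sector in between is covered by the previous lemma. Then \<open>\<delta>\<close> tends to 0.\<close>

lemma quadrant_bound:
  assumes g: "g holomorphic_on UNIV" and A: "A > 0"
    and Re_bound: "\<And>z. cmod (g z) \<le> C * exp (A * (Re z)\<^sup>2)"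
    and Im_bound: "\<And>z. cmod (g z) \<le> C * exp (A * (Im z)\<^sup>2)"
    and z: "Re z \<ge> 0" "Im z \<ge> 0"
  shows "cmod (g z) \<le> C"
proof -
  have C0: "C \<ge> 0" using order_trans[OF norm_ge_zero Re_bound[of 0]] by simp
  have main: "cmod (g z) * exp (- 2 * \<delta> * (Re z * Im z)) \<le> C" if \<delta>: "0 < \<delta>" "2 * \<delta> < A" for \<delta>
  proof -
    \<comment> \<open>The slope up to which \<open>A * (Im z)\<^sup>2\<close> stays below \<open>2 * \<delta> * (Re z * Im z)\<close>.\<close>
    define \<tau> where "\<tau> = 2 * \<delta> / A"
    have \<tau>: "0 < \<tau>" "\<tau> < 1" "A * \<tau> = 2 * \<delta>" using \<delta> A by (auto simp: \<tau>_def)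
    define h where "h z = g z * exp (\<i> * complex_of_real \<delta> * z\<^sup>2)" for z
    have nh: "cmod (h z) = cmod (g z) * exp (- 2 * \<delta> * (Re z * Im z))" for z
      by (simp add: h_def norm_mult Im_power2)
    have near_real: "cmod (h z) \<le> C" if "0 \<le> Re z" "0 \<le> Im z" "Im z \<le> \<tau> * Re z" for z
    proof -
      have "A * (Im z)\<^sup>2 \<le> A * (\<tau> * Re z * Im z)"
        unfolding power2_eq_square using A mult_right_mono[OF that(3,2)] by (intro mult_left_mono) auto
      also have "\<dots> = (A * \<tau>) * (Re z * Im z)" by (simp only: mult_ac)
      also have "\<dots> = 2 * \<delta> * (Re z * Im z)" unfolding \<tau>(3) ..
      finally have "A * (Im z)\<^sup>2 + - 2 * \<delta> * (Re z * Im z) \<le> 0" by simp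
      then have "C * exp (A * (Im z)\<^sup>2 + - 2 * \<delta> * (Re z * Im z)) \<le> C * 1"
        using C0 by (intro mult_left_mono) auto
      moreover have "cmod (h z) \<le> C * exp (A * (Im z)\<^sup>2) * exp (- 2 * \<delta> * (Re z * Im z))"
        unfolding nh by (intro mult_right_mono Im_bound) auto
      ultimately show ?thesis unfolding exp_add by (simp add: mult.assoc)
    qed
    have near_imag: "cmod (h z) \<le> C" if "0 \<le> Re z" "0 \<le> Im z" "Re z \<le> \<tau> * Im z" for z
    proof -
      have "A * (Re z)\<^sup>2 \<le> A * (\<tau> * Im z * Re z)"
        unfolding power2_eq_square using A mult_right_mono[OF that(3,1)] by (intro mult_left_mono) auto
      also have "\<dots> = (A * \<tau>) * (Re z * Im z)" by (simp only: mult_ac)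
      also have "\<dots> = 2 * \<delta> * (Re z * Im z)" unfolding \<tau>(3) ..
      finally have "A * (Re z)\<^sup>2 + - 2 * \<delta> * (Re z * Im z) \<le> 0" by simp
      then have "C * exp (A * (Re z)\<^sup>2 + - 2 * \<delta> * (Re z * Im z)) \<le> C * 1"
        using C0 by (intro mult_left_mono) auto
      moreover have "cmod (h z) \<le> C * exp (A * (Re z)\<^sup>2) * exp (- 2 * \<delta> * (Re z * Im z))"
        unfolding nh by (intro mult_right_mono Re_bound) auto
      ultimately show ?thesis unfolding exp_add by (simp add: mult.assoc)
    qed
    have "cmod (h z) \<le> C"
    proof (cases "\<tau> * Re z \<le> Im z \<and> \<tau> * Im z \<le> Re z")
      case False
      then show ?thesis using near_real near_imag z by force
    next
      case True
      show ?thesis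
      proof (rule Phragmen_Lindelof_sector[where h=h and \<tau>=\<tau> and A=A])
        show "h holomorphic_on UNIV" unfolding h_def by (intro holomorphic_intros g)
        show "cmod (h z) \<le> C" if "Im z = \<tau> * Re z" "Re z \<ge> 0" for z
          using that \<tau> by (intro near_real) auto
        show "cmod (h z) \<le> C" if "Re z = \<tau> * Im z" "Im z \<ge> 0" for z
          using that \<tau> by (intro near_imag) auto
        show "cmod (h z) \<le> C * exp (A * (cmod z)\<^sup>2)" if s: "\<tau> * Re z \<le> Im z" "\<tau> * Im z \<le> Re z" for z
        proof -
          have "0 \<le> Re z * Im z" using sector_in_quadrant[OF \<tau>(1,2) s] by simp
          then have "exp (- 2 * \<delta> * (Re z * Im z)) \<le> 1" using \<delta> by simp
          then have "cmod (h z) \<le> (C * exp (A * (Im z)\<^sup>2)) * 1"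
            unfolding nh using C0 by (intro mult_mono Im_bound) auto
          also have "\<dots> \<le> C * exp (A * (cmod z)\<^sup>2)"
            using C0 A by (simp add: cmod_power2 mult_left_mono)
          finally show ?thesis .
        qed
      qed (use \<tau> True in auto)
    qed
    then show ?thesis unfolding nh .
  qed
  define \<delta> where "\<delta> k = (A / 4) * (1 / real (Suc k))" for k
  have \<delta>: "0 < \<delta> k" "2 * \<delta> k < A" for k
    using A by (auto simp: \<delta>_def field_simps add_pos_nonneg)
  have "\<delta> \<longlonglongrightarrow> (A / 4) * 0"
    unfolding \<delta>_def using LIMSEQ_inverse_real_of_nat by (intro tendsto_intros) (simp add: inverse_eq_divide)
  then have "(\<lambda>k. cmod (g z) * exp (- 2 * \<delta> k * (Re z * Im z))) \<longlonglongrightarrow> cmod (g z) * exp (- 2 * ((A / 4) * 0) * (Re z * Im z))"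
    by (intro tendsto_intros)
  then have "cmod (g z) * exp (- 2 * ((A / 4) * 0) * (Re z * Im z)) \<le> C"
    by (rule LIMSEQ_le_const2) (use main[OF \<delta>] in auto)
  then show ?thesis by simp
qed

text \<open>The hypotheses are invariant under multiplication by powers of \<open>\<i>\<close>, so \<open>g\<close> is bounded in every quadrant.\<close>

lemma constant_if_bounded_along_axes:
  assumes g: "g holomorphic_on UNIV" and A: "A > 0"
    and Re_bound: "\<And>z. cmod (g z) \<le> C * exp (A * (Re z)\<^sup>2)"
    and Im_bound: "\<And>z. cmod (g z) \<le> C * exp (A * (Im z)\<^sup>2)"
  shows "g z = g 0"
proof -
  have rot: "cmod (g (c * z)) \<le> C" if c: "c \<in> {1, \<i>, -1, - \<i>}" and z: "Re z \<ge> 0" "Im z \<ge> 0" for c z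
  proof (rule quadrant_bound[where g="\<lambda>z. g (c * z)" and A=A])
    show "(\<lambda>z. g (c * z)) holomorphic_on UNIV"
      using holomorphic_on_compose[of "\<lambda>z. c * z" UNIV g] holomorphic_on_subset[OF g]
      by (auto simp: o_def intro: holomorphic_intros)
    show "cmod (g (c * u)) \<le> C * exp (A * (Re u)\<^sup>2)" for u
      using c Re_bound[of "c * u"] Im_bound[of "c * u"] by auto
    show "cmod (g (c * u)) \<le> C * exp (A * (Im u)\<^sup>2)" for u
      using c Re_bound[of "c * u"] Im_bound[of "c * u"] by auto
  qed (use A z in auto)
  have "cmod (g z) \<le> C" for z
  proof -
    consider "Re z \<ge> 0" "Im z \<ge> 0" | "Re z \<le> 0" "Im z \<ge> 0" | "Re z \<le> 0" "Im z \<le> 0" | "Re z \<ge> 0" "Im z \<le> 0"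
      by linarith
    then show ?thesis
    proof cases
      case 1 then show ?thesis using rot[of 1 z] by simp
    next
      case 2 then show ?thesis using rot[of "\<i>" "- \<i> * z"] by (simp add: mult.assoc[symmetric])
    next
      case 3 then show ?thesis using rot[of "-1" "- z"] by simp
    next
      case 4 then show ?thesis using rot[of "- \<i>" "\<i> * z"] by (simp add: mult.assoc[symmetric])
    qed
  qed
  then have "bounded (range g)" by (auto simp: bounded_iff)
  then have "g constant_on UNIV" by (rule Liouville_theorem[OF g])
  then show ?thesis by (metis constant_on_def UNIV_I)
qed

section \<open>Symbols with two bounded multipliers\<close>

text \<open>The real part of \<open>z\<close> only translates the modulus of the Gaussian factor, and the imaginary part only scales it.\<close>

lemma multiplier_growth:
  fixes \<phi> :: "complex ^ 'n \<Rightarrow> complex"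
  assumes m: "m \<in> L_infinity"
    and \<phi>: "\<And>z. \<phi> z = (LINT \<xi>|lborel. m \<xi> * exp (- csq (vcomplex \<xi> - (1/2) *s z)))"
  obtains C where "C \<ge> 0" "\<And>x y. cmod (\<phi> (vcomplex x + \<i> *s vcomplex y)) \<le> C * exp ((norm y)\<^sup>2 / 4)"
proof -
  obtain B where [measurable]: "m \<in> borel_measurable borel" and B: "AE \<xi> in lborel. cmod (m \<xi>) \<le> B"
    using m by (auto simp: L_infinity_def)
  define J where "J = (LINT \<xi>|lborel. exp (- 1 * (norm (\<xi> :: real ^ 'n))\<^sup>2))"
  have J: "J \<ge> 0" unfolding J_def by (simp add: integral_nonneg_AE)
  have "cmod (\<phi> (vcomplex x + \<i> *s vcomplex y)) \<le> (\<bar>B\<bar> * J) * exp ((norm y)\<^sup>2 / 4)" for x y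
  proof -
    define e where "e \<xi> = exp (- 1 * (norm (- ((1/2) *\<^sub>R x) + \<xi>))\<^sup>2)" for \<xi>
    have [measurable]: "e \<in> borel_measurable borel" unfolding e_def by measurable
    have me: "(\<lambda>\<xi> :: real ^ 'n. exp (- 1 * (norm \<xi>)\<^sup>2)) \<in> borel_measurable borel" by measurable
    have ie: "integrable lborel e" and Je: "(LINT \<xi>|lborel. e \<xi>) = J"
      unfolding e_def J_def
      using integrable_lborel_translate[OF me, of "- ((1/2) *\<^sub>R x)"] integral_lborel_translate[OF me, of "- ((1/2) *\<^sub>R x)"]
        integrable_gaussian[of 1, where 'a="real ^ 'n"] by auto
    have n: "cmod (exp (- csq (vcomplex \<xi> - (1/2) *s (vcomplex x + \<i> *s vcomplex y)))) = e \<xi> * exp ((norm y)\<^sup>2 / 4)" for \<xi>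
    proof -
      have v: "vcomplex \<xi> - (1/2) *s (vcomplex x + \<i> *s vcomplex y)
          = vcomplex (- ((1/2) *\<^sub>R x) + \<xi>) + (- \<i> / 2) *s vcomplex y"
        by (simp add: vec_eq_iff vcomplex_def algebra_simps)
      have "Re (- csq (vcomplex \<xi> - (1/2) *s (vcomplex x + \<i> *s vcomplex y))) = - 1 * (norm (- ((1/2) *\<^sub>R x) + \<xi>))\<^sup>2 + (norm y)\<^sup>2 / 4"
        unfolding v csq_add csq_smult csq_vcomplex cdot_smult_right cdot_vcomplex
        by (simp add: power2_eq_square del: of_real_power)
      then show ?thesis unfolding e_def exp_add[symmetric] norm_exp_eq_Re by simp
    qed
    have i2: "integrable lborel (\<lambda>\<xi>. \<bar>B\<bar> * (e \<xi> * exp ((norm y)\<^sup>2 / 4)))" using ie by simp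
    have ae: "AE \<xi> in lborel. norm (m \<xi> * exp (- csq (vcomplex \<xi> - (1/2) *s (vcomplex x + \<i> *s vcomplex y)))) \<le> \<bar>B\<bar> * (e \<xi> * exp ((norm y)\<^sup>2 / 4))"
      using B
    proof eventually_elim
      case (elim \<xi>)
      have "e \<xi> \<ge> 0" by (simp add: e_def)
      then show ?case unfolding norm_mult n using elim by (intro mult_right_mono) auto
    qed
    have i1: "integrable lborel (\<lambda>\<xi>. norm (m \<xi> * exp (- csq (vcomplex \<xi> - (1/2) *s (vcomplex x + \<i> *s vcomplex y)))))"
      by (rule Bochner_Integration.integrable_bound[OF i2]) (use ae in \<open>auto elim: eventually_mono\<close>)
    have "cmod (\<phi> (vcomplex x + \<i> *s vcomplex y)) \<le> (LINT \<xi>|lborel. norm (m \<xi> * exp (- csq (vcomplex \<xi> - (1/2) *s (vcomplex x + \<i> *s vcomplex y)))))"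
      unfolding \<phi> by (rule integral_norm_bound)
    also have "\<dots> \<le> (LINT \<xi>|lborel. \<bar>B\<bar> * (e \<xi> * exp ((norm y)\<^sup>2 / 4)))"
      by (rule integral_mono_AE[OF i1 i2 ae])
    finally show ?thesis using Je by simp
  qed
  then show thesis using that[of "\<bar>B\<bar> * J"] J by simp
qed

text \<open>
  On a complex line through the origin in a real direction the two representations bound the symbol by
  Gaussians of \<open>Re\<close> and of \<open>Im\<close>, so it is constant there, hence at all real points.\<close>

lemma constant_if_two_multipliers:
  fixes \<phi> :: "complex ^ 'n \<Rightarrow> complex"
  assumes \<phi>: "entire \<phi>"
    and m: "m \<in> L_infinity" "\<And>z. \<phi> z = (LINT \<xi>|lborel. m \<xi> * exp (- csq (vcomplex \<xi> - (1/2) *s z)))"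
    and m': "m' \<in> L_infinity" "\<And>z. \<phi> (- \<i> *s z) = (LINT \<xi>|lborel. m' \<xi> * exp (- csq (vcomplex \<xi> - (1/2) *s z)))"
  shows "\<phi> constant_on UNIV"
proof -
  obtain C where C: "C \<ge> 0" "\<And>x y. cmod (\<phi> (vcomplex x + \<i> *s vcomplex y)) \<le> C * exp ((norm y)\<^sup>2 / 4)"
    using multiplier_growth[OF m] by blast
  obtain C' where C': "C' \<ge> 0" "\<And>x y. cmod (\<phi> (- \<i> *s (vcomplex x + \<i> *s vcomplex y))) \<le> C' * exp ((norm y)\<^sup>2 / 4)"
    using multiplier_growth[OF m'(1), of "\<lambda>z. \<phi> (- \<i> *s z)"] m'(2) by blast
  have real: "\<phi> (vcomplex a) = \<phi> 0" for a
  proof -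
    define g where "g t = \<phi> (0 + t *s vcomplex a)" for t
    \<comment> \<open>The summand 1 makes the constant positive also for \<open>a = 0\<close>.\<close>
    define A where "A = (norm a)\<^sup>2 / 4 + 1"
    define D where "D = max C C'"
    have hol: "g holomorphic_on UNIV" unfolding g_def by (rule entire_holomorphic_on_line[OF \<phi>])
    have AD: "(norm (s *\<^sub>R a))\<^sup>2 / 4 \<le> A * s\<^sup>2" for s by (simp add: A_def power_mult_distrib algebra_simps)
    have "g 1 = g 0"
    proof (rule constant_if_bounded_along_axes[OF hol, where A=A and C=D])
      show "A > 0" unfolding A_def by (simp add: add_nonneg_pos)
      fix t
      have t1: "0 + t *s vcomplex a = vcomplex (Re t *\<^sub>R a) + \<i> *s vcomplex (Im t *\<^sub>R a)"
        by (simp add: vec_eq_iff vcomplex_def complex_eq_iff)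
      have t2: "0 + t *s vcomplex a = - \<i> *s (vcomplex (- Im t *\<^sub>R a) + \<i> *s vcomplex (Re t *\<^sub>R a))"
        by (simp add: vec_eq_iff vcomplex_def complex_eq_iff)
      have "cmod (g t) \<le> C * exp ((norm (Im t *\<^sub>R a))\<^sup>2 / 4)" unfolding g_def t1 by (rule C(2))
      also have "\<dots> \<le> D * exp (A * (Im t)\<^sup>2)" using C C' AD by (intro mult_mono) (auto simp: D_def)
      finally show "cmod (g t) \<le> D * exp (A * (Im t)\<^sup>2)" .
      have "cmod (g t) \<le> C' * exp ((norm (Re t *\<^sub>R a))\<^sup>2 / 4)" unfolding g_def t2 by (rule C'(2))
      also have "\<dots> \<le> D * exp (A * (Re t)\<^sup>2)" using C C' AD by (intro mult_mono) (auto simp: D_def)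
      finally show "cmod (g t) \<le> D * exp (A * (Re t)\<^sup>2)" .
    qed
    then show ?thesis by (simp add: g_def)
  qed
  have "\<phi> z = \<phi> 0" for z
    by (rule entire_eq_if_eq_on_reals[OF \<phi> entire_const]) (rule real)
  then show ?thesis unfolding constant_on_def by blast
qed

section \<open>Rotation of the symbol\<close>

lemma hol_polynomial_smult: "hol_polynomial P \<Longrightarrow> hol_polynomial (\<lambda>z. P (c *s z))"
proof -
  assume "hol_polynomial P"
  then obtain A a where A: "finite A" "P = (\<lambda>z. \<Sum>\<alpha>\<in>A. a \<alpha> * (\<Prod>j\<in>UNIV. (z $ j) ^ \<alpha> j))"
    unfolding hol_polynomial_def by blast
  have "P (c *s z) = (\<Sum>\<alpha>\<in>A. (a \<alpha> * (\<Prod>j\<in>UNIV. c ^ \<alpha> j)) * (\<Prod>j\<in>UNIV. (z $ j) ^ \<alpha> j))" for z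
    unfolding A(2) by (simp add: power_mult_distrib prod.distrib mult.assoc)
  then show ?thesis using hol_polynomialI[OF A(1), of "\<lambda>\<alpha>. a \<alpha> * (\<Prod>j\<in>UNIV. c ^ \<alpha> j)" "\<lambda>\<alpha>. \<alpha>"] by simp
qed

lemma fock_smult:
  assumes c: "cmod c = 1" and F: "F \<in> fock_space"
  shows "(\<lambda>z. F (c *s z)) \<in> fock_space" "fock_norm (\<lambda>z. F (c *s z)) = fock_norm F"
proof -
  have e: "entire (\<lambda>z. F (c *s z))" using entire_affine[OF fock_spaceD(1)[OF F], of 0 c] by simp
  have [measurable]: "F \<in> borel_measurable borel" by (rule entire_measurable[OF fock_spaceD(1)[OF F]])
  have m: "(\<lambda>z. (cmod (F z))\<^sup>2) \<in> borel_measurable borel" by measurable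
  show "(\<lambda>z. F (c *s z)) \<in> fock_space"
    using F e integrable_gauss_unit_smult[OF c m] by (simp add: fock_space_def)
  show "fock_norm (\<lambda>z. F (c *s z)) = fock_norm F"
    using integral_gauss_unit_smult[OF c m] by (simp add: fock_norm_def)
qed

text \<open>Unitary scalars act on the Fock space by isometries that preserve polynomials.\<close>

lemma bounded_on_fock_conjugate:
  assumes S: "bounded_on_fock S" and c: "cmod c = 1" and d: "cmod d = 1"
    and S': "\<And>P. hol_polynomial P \<Longrightarrow> S' P = (\<lambda>z. S (\<lambda>u. P (c *s u)) (d *s z))"
  shows "bounded_on_fock S'"
proof -
  obtain T where T: "bounded_linear_operator_on_fock T" and TP: "\<And>P. hol_polynomial P \<Longrightarrow> T P = S P"
    using S unfolding bounded_on_fock_def by blast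
  obtain C where C: "\<And>F. F \<in> fock_space \<Longrightarrow> fock_norm (T F) \<le> C * fock_norm F"
    using T unfolding bounded_linear_operator_on_fock_def by blast
  have TF: "T F \<in> fock_space" if "F \<in> fock_space" for F
    using T that unfolding bounded_linear_operator_on_fock_def by blast
  have lin: "T (\<lambda>z. a * F z + b * G z) = (\<lambda>z. a * T F z + b * T G z)"
    if "F \<in> fock_space" "G \<in> fock_space" for F G a b
    using T that unfolding bounded_linear_operator_on_fock_def by blast
  define T' where "T' F z = T (\<lambda>u. F (c *s u)) (d *s z)" for F z
  have "bounded_linear_operator_on_fock T'"
    unfolding bounded_linear_operator_on_fock_def
  proof (intro conjI ballI allI exI)
    show "T' F \<in> fock_space" if "F \<in> fock_space" for F
      unfolding T'_def[abs_def] by (rule fock_smult(1)[OF d TF[OF fock_smult(1)[OF c that]]])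
    show "T' (\<lambda>z. a * F z + b * G z) = (\<lambda>z. a * T' F z + b * T' G z)"
      if "F \<in> fock_space" "G \<in> fock_space" for F G a b
      unfolding T'_def[abs_def] lin[OF fock_smult(1)[OF c that(1)] fock_smult(1)[OF c that(2)]] ..
    show "fock_norm (T' F) \<le> C * fock_norm F" if "F \<in> fock_space" for F
      using C[OF fock_smult(1)[OF c that]] fock_smult(2)[OF d TF[OF fock_smult(1)[OF c that]]] fock_smult(2)[OF c that]
      unfolding T'_def[abs_def] by simp
  qed
  moreover have "T' P = S' P" if "hol_polynomial P" for P
    unfolding T'_def[abs_def] S'[OF that] TP[OF hol_polynomial_smult[OF that]] ..
  ultimately show ?thesis unfolding bounded_on_fock_def by blast
qed

text \<open>Substitution of \<open>\<i> *s w\<close> for \<open>w\<close>: conjugation turns \<open>\<i>\<close> into \<open>- \<i>\<close>, which produces the sign in \<open>z - vcnj w\<close>.\<close>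

lemma S_tilde_op_rotated:
  assumes [measurable]: "\<phi> \<in> borel_measurable borel" "F \<in> borel_measurable borel"
  shows "S_tilde_op (\<lambda>z. \<phi> (- \<i> *s z)) F (\<i> *s z) = S_op \<phi> (\<lambda>u. F (\<i> *s u)) z"
proof -
  have m: "(\<lambda>w. F w * \<phi> (- \<i> *s (\<i> *s z + vcnj w)) * exp (cdot (\<i> *s z) (vcnj w) / 2)) \<in> borel_measurable borel"
    by measurable
  have "- \<i> *s (\<i> *s z + vcnj (\<i> *s w)) = z - vcnj w" for w
    by (simp add: vec_eq_iff vcnj_def algebra_simps)
  moreover have "cdot (\<i> *s z) (vcnj (\<i> *s w)) = cdot z (vcnj w)" for w
    by (simp add: cdot_simps)
  ultimately show ?thesis
    unfolding S_tilde_op_def S_op_def using integral_gauss_unit_smult[OF _ m, of "\<i>"] by simp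
qed

lemma S_op_bounded_iff_S_tilde_op_bounded:
  assumes \<phi>: "\<phi> \<in> fock_space"
  shows "bounded_on_fock (S_op \<phi>) \<longleftrightarrow> bounded_on_fock (S_tilde_op (\<lambda>z. \<phi> (- \<i> *s z)))"
proof
  have m: "\<phi> \<in> borel_measurable borel" by (rule entire_measurable[OF fock_spaceD(1)[OF \<phi>]])
  have i: "\<i> *s (- \<i> *s z) = z" "- \<i> *s (\<i> *s z) = z" for z :: "complex ^ 'a"
    by (simp_all add: vec_eq_iff)
  have pm: "P \<in> borel_measurable borel" if "hol_polynomial P" for P
    by (rule entire_measurable[OF hol_polynomial_entire[OF that]])
  {
    assume "bounded_on_fock (S_op \<phi>)"
    then show "bounded_on_fock (S_tilde_op (\<lambda>z. \<phi> (- \<i> *s z)))"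
    proof (rule bounded_on_fock_conjugate[where c="\<i>" and d="- \<i>"])
      show "S_tilde_op (\<lambda>z. \<phi> (- \<i> *s z)) P = (\<lambda>z. S_op \<phi> (\<lambda>u. P (\<i> *s u)) (- \<i> *s z))"
        if "hol_polynomial P" for P
        unfolding S_tilde_op_rotated[OF m pm[OF that], symmetric] i ..
    qed auto
  next
    assume "bounded_on_fock (S_tilde_op (\<lambda>z. \<phi> (- \<i> *s z)))"
    then show "bounded_on_fock (S_op \<phi>)"
    proof (rule bounded_on_fock_conjugate[where c="- \<i>" and d="\<i>"])
      show "S_op \<phi> P = (\<lambda>z. S_tilde_op (\<lambda>z. \<phi> (- \<i> *s z)) (\<lambda>u. P (- \<i> *s u)) (\<i> *s z))"
        if "hol_polynomial P" for P
        unfolding S_tilde_op_rotated[OF m pm[OF hol_polynomial_smult[OF that]]] i ..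
    qed auto
  }
qed

section \<open>The characterisation of bounded operators\<close>

theorem theorem1p1:
  fixes \<phi> :: "complex ^ 'n \<Rightarrow> complex"
  assumes "\<phi> \<in> fock_space"
  shows "(bounded_on_fock (S_op \<phi>) \<longleftrightarrow>
            (\<exists>m \<in> L_infinity. \<forall>z.
               \<phi> z = (LINT \<xi>|lborel. m \<xi> * exp (- csq (vcomplex \<xi> - (\<i> / 2) *s z)))))
       \<and> (bounded_on_fock (S_tilde_op \<phi>) \<longleftrightarrow>
            (\<exists>m \<in> L_infinity. \<forall>z.
               \<phi> z = (LINT \<xi>|lborel. m \<xi> * exp (- csq (vcomplex \<xi> - (1 / 2) *s z)))))
       \<and> (\<not> \<phi> constant_on UNIV \<longrightarrow>
            unbounded_on_fock (S_op \<phi>) \<or> unbounded_on_fock (S_tilde_op \<phi>))"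
proof -
  have tilde: "bounded_on_fock (S_tilde_op \<psi>) \<longleftrightarrow>
      (\<exists>m \<in> L_infinity. \<forall>z. \<psi> z = (LINT \<xi>|lborel. m \<xi> * exp (- csq (vcomplex \<xi> - (1 / 2) *s z))))"
    if "\<psi> \<in> fock_space" for \<psi> :: "complex ^ 'n \<Rightarrow> complex"
    using multiplier_if_S_tilde_op_bounded[OF that] S_tilde_op_bounded by blast
  define \<psi> where "\<psi> z = \<phi> (- \<i> *s z)" for z
  have \<psi>: "\<psi> \<in> fock_space" unfolding \<psi>_def[abs_def] by (rule fock_smult(1)[OF _ assms]) simp
  have S: "bounded_on_fock (S_op \<phi>) \<longleftrightarrow> bounded_on_fock (S_tilde_op \<psi>)"
    unfolding \<psi>_def[abs_def] by (rule S_op_bounded_iff_S_tilde_op_bounded[OF assms])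
  have rot: "(\<forall>z. \<psi> z = (LINT \<xi>|lborel. m \<xi> * exp (- csq (vcomplex \<xi> - (1 / 2) *s z))))
      \<longleftrightarrow> (\<forall>z. \<phi> z = (LINT \<xi>|lborel. m \<xi> * exp (- csq (vcomplex \<xi> - (\<i> / 2) *s z))))" for m
  proof -
    have h: "(1 / 2) *s (\<i> *s z) = (\<i> / 2) *s z" and i1: "- \<i> *s (\<i> *s z) = z" and i2: "\<i> *s (- \<i> *s z) = z"
      for z :: "complex ^ 'n" by (simp_all add: vec_eq_iff)
    show ?thesis
    proof (intro iffI allI)
      fix z assume "\<forall>z. \<psi> z = (LINT \<xi>|lborel. m \<xi> * exp (- csq (vcomplex \<xi> - (1 / 2) *s z)))"
      from this[rule_format, of "\<i> *s z"]
      show "\<phi> z = (LINT \<xi>|lborel. m \<xi> * exp (- csq (vcomplex \<xi> - (\<i> / 2) *s z)))"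
        unfolding \<psi>_def i1 h .
    next
      fix z assume "\<forall>z. \<phi> z = (LINT \<xi>|lborel. m \<xi> * exp (- csq (vcomplex \<xi> - (\<i> / 2) *s z)))"
      from this[rule_format, of "- \<i> *s z"]
      show "\<psi> z = (LINT \<xi>|lborel. m \<xi> * exp (- csq (vcomplex \<xi> - (1 / 2) *s z)))"
        unfolding \<psi>_def h[symmetric] i2 .
    qed
  qed
  have const: "\<phi> constant_on UNIV" if b: "bounded_on_fock (S_op \<phi>)" "bounded_on_fock (S_tilde_op \<phi>)"
  proof -
    obtain m where "m \<in> L_infinity" "\<forall>z. \<phi> z = (LINT \<xi>|lborel. m \<xi> * exp (- csq (vcomplex \<xi> - (1 / 2) *s z)))"
      using b(2) tilde[OF assms] by blast
    moreover obtain m' where "m' \<in> L_infinity" "\<forall>z. \<psi> z = (LINT \<xi>|lborel. m' \<xi> * exp (- csq (vcomplex \<xi> - (1 / 2) *s z)))"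
      using b(1) S tilde[OF \<psi>] by blast
    ultimately show ?thesis
      using constant_if_two_multipliers[OF fock_spaceD(1)[OF assms], of m m'] unfolding \<psi>_def by blast
  qed
  show ?thesis
    using S tilde[OF \<psi>] tilde[OF assms] const unfolding rot unbounded_on_fock_def by blast
qed

end
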